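(* Let $(\mathcal M,\tau)$ and $(\mathcal N,\widetilde\tau)$ be von Neumann algebras with normal faithful tracial states, and let $x_1,\dots,x_n\in\mathcal M$ and $y_1,\dots,y_n\in\mathcal N$. Let $0<p<\infty$ be such that $p$ is not an even integer. Suppose that for all $m\in\mathbb N$ and all $a_1,\dots,a_n\in M_m$, $$\Big\|1+\sum_i a_i\otimes x_i\Big\|_p=\Big\|1+\sum_i a_i\otimes y_i\Big\|_p .$$ Then the $n$-tuples $(x_1,\dots,x_n)$ and $(y_1,\dots,y_n)$ have the same $*$-distributions. More precisely, for every polynomial $P\in\mathbb C\langle X_1,\dots,X_{2n}\rangle$ in $2n$ noncommuting variables, $$\tau\big(P(x_1,\dots,x_n,x_1^*,\dots,x_n^* )\big)=\widetilde\tau\big(P(y_1,\dots,y_n,y_1^*,\dots,y_n^* )\big).$$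
   Context: $M_m$ is the algebra of complex $m\times m$ matrices with normalized trace $\mathrm{tr}_m=\frac1m\mathrm{Tr}$. For $S\in M_m\otimes\mathcal M$, $\|S\|_p=\big((\mathrm{tr}_m\otimes\tau)(|S|^p)\big)^{1/p}$, similarly for $\mathcal N$ with $\widetilde\tau$; $1$ denotes the unit of $M_m\otimes\mathcal M$ or $M_m\otimes\mathcal N$. *)

theory Defs
  imports
    "HOL-Analysis.Analysis"
    "HOL-Library.Poly_Mapping"
    "HOL-Library.Nonpos_Ints"
    "HOL-Computational_Algebra.Polynomial"
    "Jordan_Normal_Form.Matrix"
begin

section \<open>Complex Hilbert spaces\<close>

class scaleC =
  fixes scaleC :: "complex \<Rightarrow> 'a \<Rightarrow> 'a" (infixr \<open>*\<^sub>C\<close> 75)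

text \<open>
  The inner product is conjugate linear in the first argument; definiteness comes from the
  underlying real inner product space. The zero space is excluded, so that the bounded operators
  satisfy \<open>0 \<noteq> 1\<close>; this loses nothing below because the zero algebra has no state.
\<close>

class chilbert_space = real_inner + complete_space + scaleC +
  fixes cinner :: "'a \<Rightarrow> 'a \<Rightarrow> complex"
  assumes scaleC_add_right: "c *\<^sub>C (x + y) = c *\<^sub>C x + c *\<^sub>C y"
    and scaleC_add_left: "(c + d) *\<^sub>C x = c *\<^sub>C x + d *\<^sub>C x"
    and scaleC_scaleC: "c *\<^sub>C d *\<^sub>C x = (c * d) *\<^sub>C x"
    and scaleR_conv_scaleC: "r *\<^sub>R x = complex_of_real r *\<^sub>C x"
    and cinner_commute: "cinner x y = cnj (cinner y x)"
    and cinner_add_right: "cinner x (y + z) = cinner x y + cinner x z"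
    and cinner_scaleC_right: "cinner x (c *\<^sub>C y) = c * cinner x y"
    and inner_conv_cinner: "inner x y = Re (cinner x y)"
    and ex_nonzero: "\<exists>x. x \<noteq> 0"

lemma cinner_scaleC_left: "cinner (c *\<^sub>C x) y = cnj c * cinner x (y :: 'a::chilbert_space)"
  by (metis cinner_commute cinner_scaleC_right complex_cnj_mult)

lemma norm_scaleC: "norm (c *\<^sub>C x) = cmod c * norm (x :: 'a::chilbert_space)"
proof -
  have im: "Im (cinner x x) = 0"
    using arg_cong[OF cinner_commute[of x x], of Im] by simp
  have "inner (c *\<^sub>C x) (c *\<^sub>C x) = Re ((c * cnj c) * cinner x x)"
    by (simp add: inner_conv_cinner cinner_scaleC_left cinner_scaleC_right mult_ac)
  also have "\<dots> = (cmod c)\<^sup>2 * inner x x"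
    by (simp add: complex_mult_cnj cmod_def inner_conv_cinner im)
  finally show ?thesis
    by (simp add: norm_eq_sqrt_inner real_sqrt_mult)
qed

lemma scaleC_zero_right: "c *\<^sub>C 0 = (0 :: 'a::chilbert_space)"
  using scaleC_add_right[of c 0 "0 :: 'a"] by simp

lemma bounded_linear_scaleC: "bounded_linear (\<lambda>x :: 'a::chilbert_space. c *\<^sub>C x)"
proof (rule bounded_linear_intro[of _ "cmod c"])
  show "c *\<^sub>C r *\<^sub>R x = r *\<^sub>R c *\<^sub>C x" for r and x :: 'a
    by (simp add: scaleR_conv_scaleC scaleC_scaleC mult.commute)
  show "norm (c *\<^sub>C x) \<le> norm x * cmod c" for x :: 'a
    by (simp add: norm_scaleC)
qed (rule scaleC_add_right)

lemma scaleC_minus_right: "c *\<^sub>C (- x) = - (c *\<^sub>C (x :: 'a::chilbert_space))"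
  by (rule linear_neg[OF bounded_linear.linear[OF bounded_linear_scaleC]])

lemma scaleC_diff_right: "c *\<^sub>C (x - y) = c *\<^sub>C x - c *\<^sub>C (y :: 'a::chilbert_space)"
  by (rule linear_diff[OF bounded_linear.linear[OF bounded_linear_scaleC]])


section \<open>The algebra of bounded complex-linear operators\<close>

typedef (overloaded) ('h::chilbert_space) cop =
  "{T :: 'h \<Rightarrow>\<^sub>L 'h. \<forall>c x. blinfun_apply T (c *\<^sub>C x) = c *\<^sub>C blinfun_apply T x}"
  by (rule exI[of _ 0]) (simp add: scaleC_zero_right)

setup_lifting type_definition_cop

lift_definition cop_apply :: "'h::chilbert_space cop \<Rightarrow> 'h \<Rightarrow> 'h" is blinfun_apply .

lift_definition scaleC_blinfun :: "complex \<Rightarrow> ('h::chilbert_space \<Rightarrow>\<^sub>L 'h) \<Rightarrow> ('h \<Rightarrow>\<^sub>L 'h)"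
  is "\<lambda>c T x. c *\<^sub>C T x"
  by (rule bounded_linear_compose[OF bounded_linear_scaleC])

lemma norm_id_blinfun_chilbert: "norm (id_blinfun :: 'h::chilbert_space \<Rightarrow>\<^sub>L 'h) = 1"
proof (rule antisym)
  show "norm (id_blinfun :: 'h \<Rightarrow>\<^sub>L 'h) \<le> 1"
    by (rule norm_blinfun_bound) simp_all
  obtain x :: 'h where x: "x \<noteq> 0" using ex_nonzero by blast
  have "norm x \<le> norm (id_blinfun :: 'h \<Rightarrow>\<^sub>L 'h) * norm x"
    using norm_blinfun[of "id_blinfun :: 'h \<Rightarrow>\<^sub>L 'h" x] by simp
  with x show "1 \<le> norm (id_blinfun :: 'h \<Rightarrow>\<^sub>L 'h)" by simp
qed

instantiation cop :: (chilbert_space) real_normed_algebra_1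
begin

lift_definition zero_cop :: "'a cop" is 0 by (simp add: scaleC_zero_right)
lift_definition one_cop :: "'a cop" is id_blinfun by simp
lift_definition plus_cop :: "'a cop \<Rightarrow> 'a cop \<Rightarrow> 'a cop" is "(+)"
  by (simp add: blinfun.add_left scaleC_add_right)
lift_definition uminus_cop :: "'a cop \<Rightarrow> 'a cop" is uminus
  by (simp add: blinfun.minus_left scaleC_minus_right)
lift_definition minus_cop :: "'a cop \<Rightarrow> 'a cop \<Rightarrow> 'a cop" is "(-)"
  by (simp add: blinfun.diff_left scaleC_diff_right)
lift_definition times_cop :: "'a cop \<Rightarrow> 'a cop \<Rightarrow> 'a cop" is "(o\<^sub>L)" by simp
lift_definition scaleR_cop :: "real \<Rightarrow> 'a cop \<Rightarrow> 'a cop" is "scaleR"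
  by (simp add: blinfun.scaleR_left scaleR_conv_scaleC scaleC_scaleC mult.commute)
lift_definition norm_cop :: "'a cop \<Rightarrow> real" is norm .
definition dist_cop :: "'a cop \<Rightarrow> 'a cop \<Rightarrow> real" where "dist_cop S T = norm (S - T)"
definition sgn_cop :: "'a cop \<Rightarrow> 'a cop" where "sgn_cop T = inverse (norm T) *\<^sub>R T"
definition uniformity_cop :: "('a cop \<times> 'a cop) filter" where
  "uniformity_cop = (INF e\<in>{0 <..}. principal {(x, y). dist x y < e})"
definition open_cop :: "'a cop set \<Rightarrow> bool" where
  "open_cop U = (\<forall>x\<in>U. \<forall>\<^sub>F (x', y) in uniformity. x' = x \<longrightarrow> y \<in> U)"

instance
proof
  fix a b c :: "'a cop" and r s :: real and U :: "'a cop set"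
  show "a + b + c = a + (b + c)" by transfer simp
  show "a + b = b + a" by transfer simp
  show "0 + a = a" by transfer simp
  show "- a + a = 0" by transfer simp
  show "a - b = a + - b" by transfer simp
  show "r *\<^sub>R (a + b) = r *\<^sub>R a + r *\<^sub>R b" by transfer (simp add: scaleR_add_right)
  show "(r + s) *\<^sub>R a = r *\<^sub>R a + s *\<^sub>R a" by transfer (simp add: scaleR_add_left)
  show "r *\<^sub>R s *\<^sub>R a = (r * s) *\<^sub>R a" by transfer simp
  show "1 *\<^sub>R a = a" by transfer simp
  show "a * b * c = a * (b * c)" by transfer (auto intro!: blinfun_eqI)
  show "(a + b) * c = a * c + b * c"
    by transfer (auto intro!: blinfun_eqI simp: blinfun.add_left)
  show "a * (b + c) = a * b + a * c"
    by transfer (auto intro!: blinfun_eqI simp: blinfun.add_left blinfun.add_right)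
  show "r *\<^sub>R a * b = r *\<^sub>R (a * b)"
    by transfer (auto intro!: blinfun_eqI simp: blinfun.scaleR_left)
  show "a * r *\<^sub>R b = r *\<^sub>R (a * b)"
    by transfer (auto intro!: blinfun_eqI simp: blinfun.scaleR_left blinfun.scaleR_right)
  show "1 * a = a" by transfer (auto intro!: blinfun_eqI)
  show "a * 1 = a" by transfer (auto intro!: blinfun_eqI)
  show "(0 :: 'a cop) \<noteq> 1"
    by transfer (metis norm_id_blinfun_chilbert norm_zero zero_neq_one)
  show "dist a b = norm (a - b)" by (rule dist_cop_def)
  show "sgn a = inverse (norm a) *\<^sub>R a" by (rule sgn_cop_def)
  show "(uniformity :: ('a cop \<times> 'a cop) filter) = (INF e\<in>{0 <..}. principal {(x, y). dist x y < e})"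
    by (rule uniformity_cop_def)
  show "open U = (\<forall>x\<in>U. \<forall>\<^sub>F (x', y) in uniformity. x' = x \<longrightarrow> y \<in> U)"
    by (rule open_cop_def)
  show "(norm a = 0) = (a = 0)" by transfer simp
  show "norm (a + b) \<le> norm a + norm b" by transfer (rule norm_triangle_ineq)
  show "norm (r *\<^sub>R a) = \<bar>r\<bar> * norm a" by transfer simp
  show "norm (a * b) \<le> norm a * norm b" by transfer (rule norm_blinfun_compose)
  show "norm (1 :: 'a cop) = 1" by transfer (rule norm_id_blinfun_chilbert)
qed

end

instantiation cop :: (chilbert_space) scaleC
begin

lift_definition scaleC_cop :: "complex \<Rightarrow> 'a cop \<Rightarrow> 'a cop" is scaleC_blinfun
  by (simp add: scaleC_blinfun.rep_eq scaleC_scaleC mult.commute)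

instance ..

end

definition cop_adj :: "'h::chilbert_space cop \<Rightarrow> 'h cop" where
  "cop_adj T = (THE S. \<forall>\<xi> \<eta>. cinner (cop_apply T \<xi>) \<eta> = cinner \<xi> (cop_apply S \<eta>))"

definition cop_pos :: "'h::chilbert_space cop \<Rightarrow> bool" where
  "cop_pos T \<longleftrightarrow> (\<forall>\<xi>. cinner \<xi> (cop_apply T \<xi>) \<in> \<real>\<^sub>\<ge>\<^sub>0)"

definition cop_le :: "'h::chilbert_space cop \<Rightarrow> 'h cop \<Rightarrow> bool" where
  "cop_le S T \<longleftrightarrow> cop_pos (T - S)"


section \<open>Von Neumann algebras and normal faithful tracial states\<close>

definition commutant :: "'h::chilbert_space cop set \<Rightarrow> 'h cop set" where
  "commutant M = {T. \<forall>S\<in>M. S * T = T * S}"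

definition von_neumann_algebra :: "'h::chilbert_space cop set \<Rightarrow> bool" where
  "von_neumann_algebra M \<longleftrightarrow> (\<forall>T\<in>M. cop_adj T \<in> M) \<and> commutant (commutant M) = M"

text \<open>Only the values of \<open>\<tau>\<close> on \<open>M\<close> matter in the following predicates.\<close>

definition state_on :: "'h::chilbert_space cop set \<Rightarrow> ('h cop \<Rightarrow> complex) \<Rightarrow> bool" where
  "state_on M \<tau> \<longleftrightarrow>
     (\<forall>S\<in>M. \<forall>T\<in>M. \<tau> (S + T) = \<tau> S + \<tau> T) \<and>
     (\<forall>c. \<forall>T\<in>M. \<tau> (c *\<^sub>C T) = c * \<tau> T) \<and>
     (\<forall>T\<in>M. cop_pos T \<longrightarrow> \<tau> T \<in> \<real>\<^sub>\<ge>\<^sub>0) \<and>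
     \<tau> 1 = 1"

definition tracial_on :: "'h::chilbert_space cop set \<Rightarrow> ('h cop \<Rightarrow> complex) \<Rightarrow> bool" where
  "tracial_on M \<tau> \<longleftrightarrow> (\<forall>S\<in>M. \<forall>T\<in>M. \<tau> (S * T) = \<tau> (T * S))"

definition faithful_on :: "'h::chilbert_space cop set \<Rightarrow> ('h cop \<Rightarrow> complex) \<Rightarrow> bool" where
  "faithful_on M \<tau> \<longleftrightarrow> (\<forall>T\<in>M. cop_pos T \<and> \<tau> T = 0 \<longrightarrow> T = 0)"

text \<open>
  Normality: \<open>\<tau> (sup D) = sup (\<tau> ` D)\<close> for every upward directed set \<open>D\<close> of positive elements
  of \<open>M\<close> that has a supremum \<open>T\<close> in \<open>M\<close>.
\<close>

definition normal_on :: "'h::chilbert_space cop set \<Rightarrow> ('h cop \<Rightarrow> complex) \<Rightarrow> bool" where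
  "normal_on M \<tau> \<longleftrightarrow>
     (\<forall>D T. D \<noteq> {} \<and> D \<subseteq> {S\<in>M. cop_pos S} \<and>
        (\<forall>A\<in>D. \<forall>B\<in>D. \<exists>C\<in>D. cop_le A C \<and> cop_le B C) \<and>
        T \<in> M \<and> (\<forall>S\<in>D. cop_le S T) \<and>
        (\<forall>U\<in>M. (\<forall>S\<in>D. cop_le S U) \<longrightarrow> cop_le T U)
      \<longrightarrow> Re (\<tau> T) = (SUP S\<in>D. Re (\<tau> S)))"

definition normal_faithful_tracial_state ::
    "'h::chilbert_space cop set \<Rightarrow> ('h cop \<Rightarrow> complex) \<Rightarrow> bool" where
  "normal_faithful_tracial_state M \<tau> \<longleftrightarrow>
     state_on M \<tau> \<and> normal_on M \<tau> \<and> faithful_on M \<tau> \<and> tracial_on M \<tau>"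


section \<open>Matrices over an operator algebra\<close>

text \<open>
  \<open>M\<^sub>m \<otimes> B(H)\<close>, acting on \<open>\<complex>\<^sup>m \<otimes> H\<close>, is identified with the algebra of \<open>m \<times> m\<close> matrices with
  entries in \<open>B(H)\<close>; \<open>M\<^sub>m \<otimes> M\<close> consists of the matrices with entries in \<open>M\<close>.
\<close>

definition mat_sum :: "nat \<Rightarrow> 'i set \<Rightarrow> ('i \<Rightarrow> 'a::comm_monoid_add mat) \<Rightarrow> 'a mat" where
  "mat_sum m I F = mat m m (\<lambda>kl. \<Sum>i\<in>I. F i $$ kl)"

definition mat_tensor :: "complex mat \<Rightarrow> 'h::chilbert_space cop \<Rightarrow> 'h cop mat" where
  "mat_tensor a x = map_mat (\<lambda>c. c *\<^sub>C x) a"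

definition mat_scaleC :: "complex \<Rightarrow> 'h::chilbert_space cop mat \<Rightarrow> 'h cop mat" where
  "mat_scaleC c A = map_mat (\<lambda>T. c *\<^sub>C T) A"

definition mat_adj :: "'h::chilbert_space cop mat \<Rightarrow> 'h cop mat" where
  "mat_adj A = map_mat cop_adj (transpose_mat A)"

text \<open>The functional \<open>tr\<^sub>m \<otimes> \<tau>\<close> with the normalized trace \<open>tr\<^sub>m\<close>.\<close>

definition mat_trace_state :: "nat \<Rightarrow> ('h::chilbert_space cop \<Rightarrow> complex) \<Rightarrow> 'h cop mat \<Rightarrow> complex" where
  "mat_trace_state m \<tau> A = (\<Sum>i<m. \<tau> (A $$ (i, i))) / of_nat m"

text \<open>
  The spectrum in \<open>M\<^sub>m \<otimes> B(H)\<close>; for elements of \<open>M\<^sub>m \<otimes> M\<close> it is the same as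
  the spectrum in \<open>M\<^sub>m \<otimes> M\<close>.
\<close>

definition mat_spectrum :: "nat \<Rightarrow> 'h::chilbert_space cop mat \<Rightarrow> complex set" where
  "mat_spectrum m A = {z. \<not> invertible_mat (A - mat_scaleC z (1\<^sub>m m))}"

definition mat_poly :: "nat \<Rightarrow> real poly \<Rightarrow> 'h::chilbert_space cop mat \<Rightarrow> 'h cop mat" where
  "mat_poly m q A =
     mat_sum m {..degree q} (\<lambda>k. mat_scaleC (complex_of_real (coeff q k)) (A ^\<^sub>m k))"

text \<open>
  Continuous functional calculus for self-adjoint \<open>A\<close> and real \<open>f\<close> continuous on the spectrum:
  \<open>f(A)\<close> is the norm limit of \<open>q\<^sub>k(A)\<close> for any polynomials \<open>q\<^sub>k\<close> converging to \<open>f\<close> uniformly on the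
  spectrum. For a fixed matrix size, convergence in the operator norm of \<open>\<complex>\<^sup>m \<otimes> H\<close> is the same as
  operator norm convergence of all entries.
\<close>

definition mat_cfc :: "nat \<Rightarrow> (real \<Rightarrow> real) \<Rightarrow> 'h::chilbert_space cop mat \<Rightarrow> 'h cop mat" where
  "mat_cfc m f A =
     (THE R. R \<in> carrier_mat m m \<and>
        (\<forall>q :: nat \<Rightarrow> real poly.
           uniform_limit {t. complex_of_real t \<in> mat_spectrum m A} (\<lambda>k. poly (q k)) f sequentially \<longrightarrow>
           (\<forall>i<m. \<forall>j<m. (\<lambda>k. mat_poly m (q k) A $$ (i, j)) \<longlonglongrightarrow> R $$ (i, j))))"

definition mat_abs :: "nat \<Rightarrow> 'h::chilbert_space cop mat \<Rightarrow> 'h cop mat" where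
  "mat_abs m A = mat_cfc m sqrt (mat_adj A * A)"

text \<open>
  \<open>mat_abs m A\<close> is positive, so for \<open>p > 0\<close> only the values of \<open>t powr p\<close> with \<open>t \<ge> 0\<close> matter, and
  \<open>0 powr p = 0\<close>. The trace in the norm is real and nonnegative.
\<close>

definition mat_abs_power :: "nat \<Rightarrow> real \<Rightarrow> 'h::chilbert_space cop mat \<Rightarrow> 'h cop mat" where
  "mat_abs_power m p A = mat_cfc m (\<lambda>t. t powr p) (mat_abs m A)"

definition Lp_norm ::
    "('h::chilbert_space cop \<Rightarrow> complex) \<Rightarrow> nat \<Rightarrow> real \<Rightarrow> 'h cop mat \<Rightarrow> real" where
  "Lp_norm \<tau> m p S = Re (mat_trace_state m \<tau> (mat_abs_power m p S)) powr (1 / p)"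


section \<open>Noncommutative polynomials\<close>

text \<open>
  An element of \<open>\<complex>\<langle>X\<^sub>0, \<dots>, X\<^sub>N\<^sub>-\<^sub>1\<rangle>\<close> is a finitely supported family of coefficients indexed by words
  in the letters \<open>0, \<dots>, N - 1\<close>.
\<close>

type_synonym ncpoly = "nat list \<Rightarrow>\<^sub>0 complex"

definition ncpolys :: "nat \<Rightarrow> ncpoly set" where
  "ncpolys N = {P. \<forall>w \<in> Poly_Mapping.keys P. set w \<subseteq> {..<N}}"

definition nc_eval :: "ncpoly \<Rightarrow> (nat \<Rightarrow> 'h::chilbert_space cop) \<Rightarrow> 'h cop" where
  "nc_eval P z =
     (\<Sum>w \<in> Poly_Mapping.keys P. Poly_Mapping.lookup P w *\<^sub>C prod_list (map z w))"

text \<open>The \<open>2n\<close>-tuple \<open>(x\<^sub>0, \<dots>, x\<^sub>n\<^sub>-\<^sub>1, x\<^sub>0\<^sup>*, \<dots>, x\<^sub>n\<^sub>-\<^sub>1\<^sup>*)\<close>.\<close>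

definition with_adj :: "nat \<Rightarrow> (nat \<Rightarrow> 'h::chilbert_space cop) \<Rightarrow> nat \<Rightarrow> 'h cop" where
  "with_adj n x i = (if i < n then x i else cop_adj (x (i - n)))"

end

theory Submission
  imports Defs "HOL-Computational_Algebra.Fundamental_Theorem_Algebra"
begin

text \<open>
  Put \<open>S = \<Sum>\<^sub>i a\<^sub>i \<otimes> x\<^sub>i\<close>.  For small \<open>S\<close> the element \<open>|1 + S|\<^sup>p = ((1 + S)\<^sup>* (1 + S))\<^bsup>p/2\<^esup>\<close> is the sum of the
  binomial series in \<open>D = S + S\<^sup>* + S\<^sup>* S\<close>, so its trace is a power series in traces of words in \<open>S\<close> and
  \<open>S\<^sup>*\<close>.  The coefficient of a word of length \<open>K\<close> depends only on its pattern of stars: cutting the word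
  into blocks \<open>S\<close>, \<open>S\<^sup>*\<close> and \<open>S\<^sup>* S\<close> in all possible ways and summing with Vandermonde's identity gives
  \<open>(p/2 + r) choose K\<close>, where \<open>r\<close> is the number of adjacent pairs \<open>S\<^sup>* S\<close> (\<open>sum_gbinomial_blocks\<close>).

  To isolate a moment \<open>\<tau> (z\<^sub>0 \<cdots> z\<^sub>K\<^sub>-\<^sub>1)\<close> whose letters are among the \<open>x\<^sub>i\<close> and \<open>x\<^sub>i\<^sup>*\<close>, the letters are placed on
  the edges of a \<open>K\<close>-cycle: the \<open>a\<^sub>i\<close> are \<open>K \<times> K\<close> matrices, and the edge of the \<open>l\<close>-th letter has the
  weight \<open>s \<lambda>\<^sub>l\<close> with \<open>s > 0\<close> small and \<open>\<lambda>\<^sub>l\<close> a fourth root of unity.  Averaging over the \<open>\<lambda>\<^sub>l\<close> removes all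
  words of length less than \<open>K\<close> and leaves, in length \<open>K\<close>, only those that use every edge once and
  forwards.  The trace removes all of these except the rotations of \<open>z\<^sub>0 \<cdots> z\<^sub>K\<^sub>-\<^sub>1\<close>, and each rotation
  contributes the same moment because \<open>\<tau>\<close> is tracial (\<open>phase_sum_trace\<close>).  After division by \<open>s\<^sup>K\<close> the
  limit \<open>s \<rightarrow> 0\<close> is therefore a constant times the moment (\<open>pencil_trace_limit\<close>).  Up to a factor
  \<open>4\<^sup>K / K\<close> the constant is the sum of the coefficients of the rotations, which equals
  \<open>(p/2) ((p/2 + R - 1) choose (K - 1))\<close> for the number \<open>R\<close> of cyclically adjacent pairs.  It does not
  vanish, since \<open>p/2\<close> is not an integer (\<open>sum_rotations_nonzero\<close>).  The \<open>L\<^sub>p\<close>-norms thus determine all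
  moments.

  The analytic part identifies \<open>|1 + S|\<^sup>p\<close>, which is given by uniform polynomial approximation on
  spectra, with the binomial series (\<open>mat_abs_power_eq_binomial_series\<close>).  The main tool is the bound of
  \<open>q(A)\<close> by the supremum of \<open>|q|\<close> on the real spectrum, for self-adjoint \<open>A\<close> (\<open>mat_poly_entry_bound\<close>).
  It holds because \<open>q(A)\<^sup>2 - \<parallel>q(A)\<parallel>\<^sup>2\<close> is not bounded below and factors over the complex numbers into
  terms \<open>A - z\<close>.
\<close>

section \<open>Bounded operators as a complex Banach algebra\<close>

lemma cop_eqI: "(\<And>v. cop_apply S v = cop_apply T v) \<Longrightarrow> S = T"
  by transfer (rule blinfun_eqI)

lemma cop_apply_simps [simp]:
  "cop_apply 0 v = 0"
  "cop_apply 1 v = v"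
  "cop_apply (S + T) v = cop_apply S v + cop_apply T v"
  "cop_apply (S - T) v = cop_apply S v - cop_apply T v"
  "cop_apply (- T) v = - cop_apply T v"
  "cop_apply (S * T) v = cop_apply S (cop_apply T v)"
  "cop_apply (r *\<^sub>R T) v = r *\<^sub>R cop_apply T v"
  "cop_apply (c *\<^sub>C T) v = c *\<^sub>C cop_apply T v"
  by (transfer; simp add: blinfun.add_left blinfun.diff_left blinfun.minus_left
      blinfun.scaleR_left scaleC_blinfun.rep_eq)+

lemma cop_apply_linear [simp]:
  "cop_apply T 0 = 0"
  "cop_apply T (v + w) = cop_apply T v + cop_apply T w"
  "cop_apply T (v - w) = cop_apply T v - cop_apply T w"
  "cop_apply T (c *\<^sub>C v) = c *\<^sub>C cop_apply T v"
  "cop_apply T (sum g I) = (\<Sum>i\<in>I. cop_apply T (g i))"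
  by (transfer; simp add: blinfun.add_right blinfun.diff_right blinfun.sum_right)+

lemma cop_apply_sum: "cop_apply (sum F I) v = (\<Sum>i\<in>I. cop_apply (F i) v)"
  by (induction I rule: infinite_finite_induct) auto

lemma norm_cop_apply_le: "norm (cop_apply T v) \<le> norm T * norm v"
  by transfer (rule norm_blinfun)

lemma norm_cop_bound: "0 \<le> b \<Longrightarrow> (\<And>v. norm (cop_apply T v) \<le> b * norm v) \<Longrightarrow> norm T \<le> b"
  by transfer (rule norm_blinfun_bound)

lemma scaleC_simps [simp]:
  "c *\<^sub>C (0 :: 'a::chilbert_space) = 0"
  "1 *\<^sub>C (v :: 'a) = v"
  "0 *\<^sub>C (v :: 'a) = 0"
  "c *\<^sub>C d *\<^sub>C (v :: 'a) = (c * d) *\<^sub>C v"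
  "c *\<^sub>C (- v) = - (c *\<^sub>C (v :: 'a))"
proof -
  show "1 *\<^sub>C v = v" "0 *\<^sub>C v = 0"
    using scaleR_conv_scaleC[of 1 v] scaleR_conv_scaleC[of 0 v] by simp_all
qed (rule scaleC_zero_right scaleC_scaleC scaleC_minus_right)+

lemma scaleC_uminus_left: "(- c) *\<^sub>C (v :: 'a::chilbert_space) = - (c *\<^sub>C v)"
  using scaleC_add_left[of c "- c" v] by (simp add: eq_neg_iff_add_eq_0 add.commute)

lemma scaleC_sum_right: "c *\<^sub>C (\<Sum>i\<in>I. g i :: 'a::chilbert_space) = (\<Sum>i\<in>I. c *\<^sub>C g i)"
  by (induction I rule: infinite_finite_induct) (auto simp: scaleC_add_right)

lemma cop_scaleC_simps [simp]:
  "c *\<^sub>C (0 :: 'h::chilbert_space cop) = 0"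
  "1 *\<^sub>C (T :: 'h cop) = T"
  "0 *\<^sub>C (T :: 'h cop) = 0"
  "c *\<^sub>C d *\<^sub>C (T :: 'h cop) = (c * d) *\<^sub>C T"
  "(c *\<^sub>C S) * (T :: 'h cop) = c *\<^sub>C (S * T)"
  "S * (c *\<^sub>C T) = c *\<^sub>C (S * (T :: 'h cop))"
  by (rule cop_eqI; simp)+

lemma cop_scaleC_add_right: "c *\<^sub>C (S + T) = c *\<^sub>C S + c *\<^sub>C (T :: 'h::chilbert_space cop)"
  and cop_scaleC_add_left: "(c + d) *\<^sub>C T = c *\<^sub>C T + d *\<^sub>C (T :: 'h::chilbert_space cop)"
  and cop_scaleC_minus_left: "(- c) *\<^sub>C T = - (c *\<^sub>C (T :: 'h::chilbert_space cop))"
  and cop_scaleR_scaleC: "r *\<^sub>R T = complex_of_real r *\<^sub>C (T :: 'h::chilbert_space cop)"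
  by (rule cop_eqI; simp add: scaleC_add_right scaleC_add_left scaleC_uminus_left scaleR_conv_scaleC)+

lemma cop_scaleC_diff_right: "c *\<^sub>C (S - T) = c *\<^sub>C S - c *\<^sub>C (T :: 'h::chilbert_space cop)"
  by (rule cop_eqI) (simp add: scaleC_diff_right)

lemma cop_scaleC_sum_right: "c *\<^sub>C (\<Sum>i\<in>I. F i :: 'h::chilbert_space cop) = (\<Sum>i\<in>I. c *\<^sub>C F i)"
  by (induction I rule: infinite_finite_induct) (auto simp: cop_scaleC_add_right)

lemma cop_scaleC_sum_left: "(\<Sum>i\<in>I. c i) *\<^sub>C (T :: 'h::chilbert_space cop) = (\<Sum>i\<in>I. c i *\<^sub>C T)"
  by (induction I rule: infinite_finite_induct) (auto simp: cop_scaleC_add_left)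

lemma norm_cop_scaleC_le: "norm (c *\<^sub>C (T :: 'h::chilbert_space cop)) \<le> cmod c * norm T"
  by (rule norm_cop_bound)
    (auto simp: norm_scaleC mult.assoc intro!: mult_left_mono norm_cop_apply_le)

instance chilbert_space \<subseteq> banach ..

instance cop :: (chilbert_space) banach
proof
  fix X :: "nat \<Rightarrow> 'a cop"
  assume X: "Cauchy X"
  have isom: "norm (Rep_cop S - Rep_cop T) = norm (S - T)" for S T :: "'a cop"
    by transfer simp
  have "Cauchy (\<lambda>n. Rep_cop (X n))"
    using X unfolding Cauchy_def dist_norm isom .
  then obtain L where L: "(\<lambda>n. Rep_cop (X n)) \<longlonglongrightarrow> L"
    by (auto simp: Cauchy_convergent_iff convergent_def)
  have "blinfun_apply L (c *\<^sub>C v) = c *\<^sub>C blinfun_apply L v" for c v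
  proof (rule LIMSEQ_unique)
    show "(\<lambda>n. Rep_cop (X n) (c *\<^sub>C v)) \<longlonglongrightarrow> L (c *\<^sub>C v)"
      by (intro blinfun.tendsto L tendsto_const)
    have "c *\<^sub>C Rep_cop (X n) v = Rep_cop (X n) (c *\<^sub>C v)" for n
      using Rep_cop[of "X n"] by simp
    moreover have "(\<lambda>n. c *\<^sub>C Rep_cop (X n) v) \<longlonglongrightarrow> c *\<^sub>C L v"
      by (intro bounded_linear.tendsto[OF bounded_linear_scaleC] blinfun.tendsto L tendsto_const)
    ultimately show "(\<lambda>n. Rep_cop (X n) (c *\<^sub>C v)) \<longlonglongrightarrow> c *\<^sub>C L v"
      by (simp only:)
  qed
  then have "L \<in> {T. \<forall>c x. blinfun_apply T (c *\<^sub>C x) = c *\<^sub>C blinfun_apply T x}" by simp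
  then have "Rep_cop (Abs_cop L) = L" by (rule Abs_cop_inverse)
  moreover have "(\<lambda>n. norm (Rep_cop (X n) - L)) \<longlonglongrightarrow> 0"
    using L LIM_zero tendsto_norm_zero by blast
  moreover have "norm (X n - Abs_cop L) = norm (Rep_cop (X n) - Rep_cop (Abs_cop L))" for n
    by (rule isom[symmetric])
  ultimately have "(\<lambda>n. norm (X n - Abs_cop L)) \<longlonglongrightarrow> 0"
    by (simp only:)
  then have "X \<longlonglongrightarrow> Abs_cop L"
    using LIM_zero_cancel tendsto_norm_zero_iff by blast
  then show "convergent X" by (auto simp: convergent_def)
qed


section \<open>Existence of adjoints\<close>

lemma cinner_add_left: "cinner (x + y) z = cinner x z + cinner y (z :: 'a::chilbert_space)"
  by (metis cinner_add_right cinner_commute complex_cnj_add)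

lemma cinner_zero [simp]: "cinner x 0 = 0" "cinner 0 (x :: 'a::chilbert_space) = 0"
  using cinner_add_right[of x 0 0] cinner_add_left[of 0 0 x] by simp_all

lemma cinner_diff_right: "cinner x (y - z) = cinner x y - cinner x (z :: 'a::chilbert_space)"
  by (metis add_diff_cancel_right' cinner_add_right diff_add_cancel)

lemma cinner_sum_right: "cinner x (sum g I) = (\<Sum>i\<in>I. cinner x (g i :: 'a::chilbert_space))"
  by (induction I rule: infinite_finite_induct) (auto simp: cinner_add_right)

lemma cinner_sum_left: "cinner (sum g I) x = (\<Sum>i\<in>I. cinner (g i) (x :: 'a::chilbert_space))"
  by (induction I rule: infinite_finite_induct) (auto simp: cinner_add_left)

lemma cinner_self: "cinner x x = complex_of_real ((norm (x :: 'a::chilbert_space))\<^sup>2)"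
  using arg_cong[OF cinner_commute[of x x], of Im] inner_conv_cinner[of x x]
  by (simp add: complex_eq_iff power2_norm_eq_inner)

lemma cinner_conv_inner:
  "cinner x y = Complex (inner x y) (inner (\<i> *\<^sub>C x) (y :: 'a::chilbert_space))"
  by (simp add: complex_eq_iff inner_conv_cinner cinner_scaleC_left)

lemma cinner_eqI: "(\<And>x. cinner x y = cinner x z) \<Longrightarrow> y = (z :: 'a::chilbert_space)"
  by (metis inner_conv_cinner inner_eq_zero_iff inner_diff_right right_minus_eq)

lemma cmod_cinner_le: "cmod (cinner x y) \<le> norm x * norm (y :: 'a::chilbert_space)"
proof (cases "cinner x y = 0")
  case False
  define u where "u = cnj (cinner x y) / cmod (cinner x y)"
  have u: "cmod u = 1" using False by (simp add: u_def norm_divide)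
  have "u * cinner x y = cmod (cinner x y)"
    using False by (simp add: u_def complex_norm_square[symmetric] power2_eq_square mult.commute)
  then have "cmod (cinner x y) = inner x (u *\<^sub>C y)"
    by (simp add: inner_conv_cinner cinner_scaleC_right)
  also have "\<dots> \<le> norm x * norm (u *\<^sub>C y)" by (rule norm_cauchy_schwarz)
  finally show ?thesis by (simp add: norm_scaleC u)
qed simp

text \<open>
  The representing vector is the limit of a minimising sequence of
  \<open>J v = \<parallel>v\<parallel>\<^sup>2 - 2 f v\<close>: the parallelogram law makes such a sequence Cauchy, and at the
  minimum the derivative of \<open>J\<close> in every direction vanishes.
\<close>

lemma riesz_representation:
  fixes f :: "'a::{real_inner, complete_space} \<Rightarrow> real"
  assumes "bounded_linear f"
  obtains u where "\<And>v. f v = inner u v"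
proof -
  interpret bounded_linear f by fact
  obtain B where B: "\<And>v. \<bar>f v\<bar> \<le> norm v * B" using pos_bounded by auto
  define J where "J v = (norm v)\<^sup>2 - 2 * f v" for v
  define d where "d = Inf (range J)"
  define r where "r k = inverse (real (Suc k))" for k
  have "J v \<ge> - B\<^sup>2" for v
  proof -
    have "0 \<le> (norm v - B)\<^sup>2" by simp
    then show ?thesis using B[of v] by (simp add: J_def power2_diff)
  qed
  then have bdd: "bdd_below (range J)" unfolding bdd_below_def by blast
  have d: "d \<le> J v" for v unfolding d_def by (rule cInf_lower[OF _ bdd]) simp
  have "\<exists>v. J v < d + r k" for k
    using cInf_lessD[of "range J" "d + r k"] by (auto simp: d_def r_def)
  then obtain X where X: "\<And>k. J (X k) < d + r k" by metis
  have par: "(dist v w)\<^sup>2 \<le> 2 * (J v - d) + 2 * (J w - d)" for v w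
  proof -
    have "4 * J ((1/2) *\<^sub>R (v + w)) + (dist v w)\<^sup>2 = 2 * J v + 2 * J w"
      unfolding J_def dist_norm power2_norm_eq_inner
      by (simp add: add scaleR inner_add_left inner_add_right inner_diff_left inner_diff_right
          inner_commute algebra_simps)
    then show ?thesis using d[of "(1/2) *\<^sub>R (v + w)"] by simp
  qed
  have "Cauchy X"
  proof (rule metric_CauchyI)
    fix e :: real assume "0 < e"
    then obtain k0 where k0: "4 * r k0 < e\<^sup>2"
      using reals_Archimedean[of "e\<^sup>2 / 4"] by (auto simp: r_def field_simps)
    have "dist (X k) (X l) < e" if "k \<ge> k0" "l \<ge> k0" for k l
    proof -
      have "r k \<le> r k0" "r l \<le> r k0"
        using that by (auto simp: r_def field_simps)
      then have "(dist (X k) (X l))\<^sup>2 < e\<^sup>2"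
        using par[of "X k" "X l"] X[of k] X[of l] k0 by (smt (verit, best))
      then show ?thesis using \<open>0 < e\<close> by (meson less_imp_le power_less_imp_less_base)
    qed
    then show "\<exists>M. \<forall>m\<ge>M. \<forall>n\<ge>M. dist (X m) (X n) < e" by blast
  qed
  then obtain u where u: "X \<longlonglongrightarrow> u" by (auto simp: Cauchy_convergent_iff convergent_def)
  have "(\<lambda>k. J (X k)) \<longlonglongrightarrow> J u" unfolding J_def by (intro tendsto_intros tendsto u)
  moreover have "(\<lambda>k. d + r k) \<longlonglongrightarrow> d + 0"
    unfolding r_def by (intro tendsto_intros LIMSEQ_inverse_real_of_nat)
  ultimately have "J u \<le> d + 0"
    by (rule LIMSEQ_le) (use X in \<open>blast intro: less_imp_le\<close>)
  then have min: "J u \<le> J v" for v using d[of v] by linarith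
  have "f v = inner u v" for v
  proof (rule ccontr)
    define c where "c = inner u v - f v"
    assume "f v \<noteq> inner u v"
    then have "c \<noteq> 0" by (simp add: c_def)
    then have "v \<noteq> 0" by (auto simp: c_def zero)
    define t where "t = - c / (norm v)\<^sup>2"
    have "J (u + t *\<^sub>R v) = J u + 2 * t * c + t\<^sup>2 * (norm v)\<^sup>2"
      unfolding J_def c_def power2_norm_eq_inner
      by (simp add: add scaleR inner_add_left inner_add_right inner_commute algebra_simps
          power2_eq_square)
    moreover have "2 * t * c + t\<^sup>2 * (norm v)\<^sup>2 = - (c\<^sup>2 / (norm v)\<^sup>2)"
      using \<open>v \<noteq> 0\<close> by (simp add: t_def field_simps power2_eq_square)
    moreover have "c\<^sup>2 / (norm v)\<^sup>2 > 0" using \<open>c \<noteq> 0\<close> \<open>v \<noteq> 0\<close> by simp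
    ultimately show False using min[of "u + t *\<^sub>R v"] by linarith
  qed
  then show ?thesis using that by blast
qed

lemma ex_cop_adj:
  fixes T :: "'h::chilbert_space cop"
  shows "\<exists>S. \<forall>x y. cinner (cop_apply T x) y = cinner x (cop_apply S y)"
proof -
  have "bounded_linear (\<lambda>x. inner y (cop_apply T x))" for y
    by (rule bounded_linear_compose[OF bounded_linear_inner_right])
      (auto intro!: bounded_linear_intro[of _ "norm T"] simp: scaleR_conv_scaleC norm_cop_apply_le
        mult.commute[of _ "norm T"])
  then have "\<exists>u. \<forall>x. inner y (cop_apply T x) = inner u x" for y
    using riesz_representation by metis
  then obtain g where g: "\<And>x y. inner y (cop_apply T x) = inner (g y) x" by metis
  have ci: "cinner (cop_apply T x) y = cinner x (g y)" for x y
    using g[of y x] g[of y "\<i> *\<^sub>C x"] by (simp add: cinner_conv_inner inner_commute)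
  have add: "g (v + w) = g v + g w" for v w
    by (rule cinner_eqI) (simp add: ci[symmetric] cinner_add_right)
  have scale: "g (c *\<^sub>C v) = c *\<^sub>C g v" for c v
    by (rule cinner_eqI) (simp add: ci[symmetric] cinner_scaleC_right)
  have bd: "norm (g y) \<le> norm y * norm T" for y
  proof (cases "g y = 0")
    case False
    have "norm (g y) * norm (g y) = inner y (cop_apply T (g y))"
      by (simp add: g norm_eq_sqrt_inner)
    also have "\<dots> \<le> norm y * norm (cop_apply T (g y))" by (rule norm_cauchy_schwarz)
    also have "\<dots> \<le> norm y * (norm T * norm (g y))"
      by (intro mult_left_mono norm_cop_apply_le) simp
    finally show ?thesis using False by simp
  qed simp
  have "bounded_linear g"
    by (rule bounded_linear_intro[of _ "norm T"]) (auto simp: add scale bd scaleR_conv_scaleC)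
  then have "blinfun_apply (Blinfun g) = g" by (rule bounded_linear_Blinfun_apply)
  then have "cop_apply (Abs_cop (Blinfun g)) = g"
    by (simp add: cop_apply.rep_eq Abs_cop_inverse scale)
  then show ?thesis using ci by metis
qed

lemma cinner_cop_adj: "cinner x (cop_apply (cop_adj T) y) = cinner (cop_apply T x) y"
proof -
  obtain S where S: "\<forall>x y. cinner (cop_apply T x) y = cinner x (cop_apply S y)"
    using ex_cop_adj by blast
  have "cop_adj T = S" unfolding cop_adj_def
  proof (rule the_equality)
    fix S' assume "\<forall>x y. cinner (cop_apply T x) y = cinner x (cop_apply S' y)"
    with S show "S' = S" by (metis cinner_eqI cop_eqI)
  qed (rule S)
  then show ?thesis using S by simp
qed

lemma cop_adj_eqI:
  "(\<And>x y. cinner (cop_apply T x) y = cinner x (cop_apply S y)) \<Longrightarrow> cop_adj T = S"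
  by (intro cop_eqI cinner_eqI) (simp add: cinner_cop_adj)

lemma cinner_cop_adj_left: "cinner (cop_apply (cop_adj T) x) y = cinner x (cop_apply T y)"
  by (metis cinner_commute cinner_cop_adj)

lemma cop_adj_simps [simp]:
  "cop_adj 0 = 0"
  "cop_adj 1 = 1"
  "cop_adj (cop_adj T) = T"
  "cop_adj (S + T) = cop_adj S + cop_adj T"
  "cop_adj (S * T) = cop_adj T * cop_adj S"
  "cop_adj (c *\<^sub>C T) = cnj c *\<^sub>C cop_adj T"
  by (rule cop_adj_eqI; simp add: cinner_cop_adj cinner_cop_adj_left cinner_add_left
      cinner_add_right cinner_scaleC_left cinner_scaleC_right)+

lemma cop_adj_sum: "cop_adj (sum F I) = (\<Sum>i\<in>I. cop_adj (F i))"
  by (induction I rule: infinite_finite_induct) auto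


lemma norm_cop_adj_le: "norm (cop_adj T) \<le> norm (T :: 'h::chilbert_space cop)"
proof (rule norm_cop_bound)
  fix v
  let ?w = "cop_apply (cop_adj T) v"
  have "norm ?w * norm ?w \<le> (norm T * norm v) * norm ?w"
  proof -
    have "norm ?w * norm ?w = cmod (cinner ?w ?w)"
      by (simp only: cinner_self) (simp add: power2_eq_square norm_mult)
    also have "\<dots> = cmod (cinner (cop_apply T ?w) v)" by (simp add: cinner_cop_adj)
    also have "\<dots> \<le> norm (cop_apply T ?w) * norm v" by (rule cmod_cinner_le)
    also have "\<dots> \<le> (norm T * norm ?w) * norm v" by (intro mult_right_mono norm_cop_apply_le) simp
    finally show ?thesis by (simp add: mult_ac)
  qed
  then show "norm ?w \<le> norm T * norm v"
    by (cases "norm ?w = 0") (auto simp: mult_le_cancel_right)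
qed simp

lemma bounded_linear_cop_adj: "bounded_linear (cop_adj :: 'h::chilbert_space cop \<Rightarrow> 'h cop)"
proof (rule bounded_linear_intro[of _ 1])
  show "cop_adj (r *\<^sub>R T) = r *\<^sub>R cop_adj T" for r and T :: "'h cop"
    by (simp add: cop_scaleR_scaleC)
qed (auto intro: norm_cop_adj_le)

lemma cop_adj_diff: "cop_adj (S - T) = cop_adj S - cop_adj T"
  by (rule linear_diff[OF bounded_linear.linear[OF bounded_linear_cop_adj]])


section \<open>Von Neumann algebras and states\<close>

lemma commutant_closed:
  "0 \<in> commutant M" "1 \<in> commutant M"
  "S \<in> commutant M \<Longrightarrow> T \<in> commutant M \<Longrightarrow> S + T \<in> commutant M"
  "S \<in> commutant M \<Longrightarrow> T \<in> commutant M \<Longrightarrow> S * T \<in> commutant M"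
  "T \<in> commutant M \<Longrightarrow> c *\<^sub>C T \<in> commutant M"
  unfolding commutant_def by (auto simp: distrib_left distrib_right mult.assoc) (metis mult.assoc)

lemma commutant_limit:
  assumes "X \<longlonglongrightarrow> T" "\<And>k. X k \<in> commutant M"
  shows "T \<in> commutant M"
  unfolding commutant_def
proof (intro CollectI ballI)
  fix S assume "S \<in> M"
  then have "(\<lambda>k. S * X k) = (\<lambda>k. X k * S)" using assms(2) by (auto simp: commutant_def)
  moreover have "(\<lambda>k. S * X k) \<longlonglongrightarrow> S * T" "(\<lambda>k. X k * S) \<longlonglongrightarrow> T * S"
    by (intro tendsto_intros assms(1))+
  ultimately show "S * T = T * S" using LIMSEQ_unique by metis
qed

text \<open>
  Both algebras of the final theorem are instances, so that each estimate is stated only once.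
\<close>

locale tracial_algebra =
  fixes M :: "'h::chilbert_space cop set" and \<tau> :: "'h cop \<Rightarrow> complex"
  assumes M_zero: "0 \<in> M" and M_one: "1 \<in> M"
    and M_add: "S \<in> M \<Longrightarrow> T \<in> M \<Longrightarrow> S + T \<in> M"
    and M_mult: "S \<in> M \<Longrightarrow> T \<in> M \<Longrightarrow> S * T \<in> M"
    and M_scaleC: "T \<in> M \<Longrightarrow> c *\<^sub>C T \<in> M"
    and M_adj: "T \<in> M \<Longrightarrow> cop_adj T \<in> M"
    and M_limit: "X \<longlonglongrightarrow> T \<Longrightarrow> (\<And>k. X k \<in> M) \<Longrightarrow> T \<in> M"
    and \<tau>_add: "S \<in> M \<Longrightarrow> T \<in> M \<Longrightarrow> \<tau> (S + T) = \<tau> S + \<tau> T"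
    and \<tau>_scaleC: "T \<in> M \<Longrightarrow> \<tau> (c *\<^sub>C T) = c * \<tau> T"
    and \<tau>_pos: "T \<in> M \<Longrightarrow> cop_pos T \<Longrightarrow> \<tau> T \<in> \<real>\<^sub>\<ge>\<^sub>0"
    and \<tau>_one: "\<tau> 1 = 1"
    and \<tau>_trace: "S \<in> M \<Longrightarrow> T \<in> M \<Longrightarrow> \<tau> (S * T) = \<tau> (T * S)"

text \<open>
  A commutant is closed under norm limits, and \<open>M\<close> is the commutant of its commutant.
\<close>

lemma tracial_algebra_von_neumann:
  assumes M: "von_neumann_algebra M" and \<tau>: "normal_faithful_tracial_state M \<tau>"
  shows "tracial_algebra M \<tau>"
proof -
  have M_eq: "M = commutant (commutant M)" using M by (simp add: von_neumann_algebra_def)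
  note cl = commutant_closed[where M = "commutant M", folded M_eq]
  have "T \<in> M" if "X \<longlonglongrightarrow> T" "\<And>k. X k \<in> M" for X T
    using commutant_limit[where M = "commutant M", folded M_eq] that by blast
  with cl M \<tau> show ?thesis
    by unfold_locales
      (auto simp: von_neumann_algebra_def normal_faithful_tracial_state_def state_on_def
        tracial_on_def)
qed

context tracial_algebra
begin

lemma M_sum: "(\<And>i. i \<in> I \<Longrightarrow> F i \<in> M) \<Longrightarrow> sum F I \<in> M"
  by (induction I rule: infinite_finite_induct) (auto simp: M_zero M_add)

lemma \<tau>_zero: "\<tau> 0 = 0"
  using \<tau>_scaleC[OF M_zero, of 0] by simp

lemma \<tau>_sum: "(\<And>i. i \<in> I \<Longrightarrow> F i \<in> M) \<Longrightarrow> \<tau> (sum F I) = (\<Sum>i\<in>I. \<tau> (F i))"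
  by (induction I rule: infinite_finite_induct) (auto simp: \<tau>_zero \<tau>_add M_sum)

lemma M_diff: "S \<in> M \<Longrightarrow> T \<in> M \<Longrightarrow> S - T \<in> M"
  using M_add[of S "(-1) *\<^sub>C T"] M_scaleC[of T "-1"] by (simp add: cop_scaleC_minus_left)

lemma \<tau>_diff: "S \<in> M \<Longrightarrow> T \<in> M \<Longrightarrow> \<tau> (S - T) = \<tau> S - \<tau> T"
  using \<tau>_add[of S "(-1) *\<^sub>C T"] \<tau>_scaleC[of T "-1"] M_scaleC[of T "-1"]
  by (simp add: cop_scaleC_minus_left)

text \<open>For self-adjoint \<open>T\<close> both \<open>\<parallel>T\<parallel> 1 + T\<close> and \<open>\<parallel>T\<parallel> 1 - T\<close> are positive.\<close>

lemma \<tau>_selfadjoint: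
  assumes T: "T \<in> M" and sa: "cop_adj T = T"
  shows "\<tau> T \<in> \<real>" "cmod (\<tau> T) \<le> norm T"
proof -
  define E where "E = complex_of_real (norm T) *\<^sub>C (1 :: 'h cop)"
  have E: "E \<in> M" "\<tau> E = norm T" by (simp_all add: E_def M_scaleC M_one \<tau>_scaleC \<tau>_one)
  have form: "Im (cinner x (cop_apply T x)) = 0"
    "\<bar>Re (cinner x (cop_apply T x))\<bar> \<le> norm T * (norm x)\<^sup>2" for x
  proof -
    have "cinner x (cop_apply T x) = cnj (cinner x (cop_apply T x))"
      by (metis cinner_commute cinner_cop_adj sa)
    then show "Im (cinner x (cop_apply T x)) = 0" by (metis Im_complex_of_real Reals_cnj_iff of_real_Re)
    have "\<bar>Re (cinner x (cop_apply T x))\<bar> \<le> norm x * norm (cop_apply T x)"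
      by (rule order_trans[OF abs_Re_le_cmod cmod_cinner_le])
    also have "\<dots> \<le> norm x * (norm T * norm x)" by (intro mult_left_mono norm_cop_apply_le) simp
    finally show "\<bar>Re (cinner x (cop_apply T x))\<bar> \<le> norm T * (norm x)\<^sup>2"
      by (simp add: power2_eq_square mult_ac)
  qed
  have "cop_pos (E + T)" "cop_pos (E - T)"
    unfolding cop_pos_def
    using form
    by (auto simp: E_def complex_nonneg_Reals_iff cinner_add_right cinner_diff_right cinner_scaleC_right
        cinner_self abs_le_iff simp del: of_real_power) (smt (verit))+
  then have "\<tau> (E + T) \<in> \<real>\<^sub>\<ge>\<^sub>0" "\<tau> (E - T) \<in> \<real>\<^sub>\<ge>\<^sub>0"
    using \<tau>_pos M_add M_diff E T by blast+
  then have *: "norm T + \<tau> T \<in> \<real>\<^sub>\<ge>\<^sub>0" "norm T - \<tau> T \<in> \<real>\<^sub>\<ge>\<^sub>0"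
    using E T by (simp_all add: \<tau>_add \<tau>_diff)
  then show "\<tau> T \<in> \<real>" by (auto simp: complex_nonneg_Reals_iff complex_is_Real_iff)
  with * show "cmod (\<tau> T) \<le> norm T"
    by (auto simp: complex_nonneg_Reals_iff complex_is_Real_iff cmod_eq_Re)
qed

text \<open>
  The factor \<open>2\<close> is the cost of splitting \<open>T\<close> into its real and imaginary part.
\<close>

lemma \<tau>_bounded:
  assumes T: "T \<in> M"
  shows "cmod (\<tau> T) \<le> 2 * norm T"
proof -
  define A where "A = (1/2) *\<^sub>C (T + cop_adj T)"
  define B where "B = (1/(2*\<i>)) *\<^sub>C (T - cop_adj T)"
  have minus: "T - cop_adj T = T + (-1) *\<^sub>C cop_adj T" by (simp add: cop_scaleC_minus_left)
  have M: "A \<in> M" "B \<in> M" by (auto simp: A_def B_def T M_scaleC M_add M_diff M_adj)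
  have "T = A + \<i> *\<^sub>C B"
    by (rule cop_eqI) (simp add: A_def B_def scaleC_add_right scaleC_diff_right flip: scaleC_add_left)
  then have "\<tau> T = \<tau> A + \<i> * \<tau> B" using M by (metis \<tau>_add \<tau>_scaleC M_scaleC)
  moreover have "cop_adj A = A"
    by (simp add: A_def add.commute)
  moreover have "cop_adj B = B"
    unfolding B_def minus by (rule cop_eqI) (simp add: scaleC_diff_right scaleC_add_right scaleC_uminus_left)
  moreover have "norm A \<le> norm T"
  proof -
    have "norm A \<le> (1/2) * norm (T + cop_adj T)"
      unfolding A_def using norm_cop_scaleC_le[of "1/2" "T + cop_adj T"] by simp
    also have "\<dots> \<le> (1/2) * (norm T + norm T)"
      using norm_triangle_ineq[of T "cop_adj T"] norm_cop_adj_le[of T] by simp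
    finally show ?thesis by simp
  qed
  moreover have "norm B \<le> norm T"
  proof -
    have "norm B \<le> (1/2) * norm (T - cop_adj T)"
      unfolding B_def using norm_cop_scaleC_le[of "1/(2*\<i>)" "T - cop_adj T"]
      by (simp add: norm_divide norm_mult)
    also have "\<dots> \<le> (1/2) * (norm T + norm T)"
      using norm_triangle_ineq4[of T "cop_adj T"] norm_cop_adj_le[of T] by simp
    finally show ?thesis by simp
  qed
  ultimately show ?thesis
    using \<tau>_selfadjoint(2)[OF M(1)] \<tau>_selfadjoint(2)[OF M(2)] norm_triangle_ineq[of "\<tau> A" "\<i> * \<tau> B"]
    by (simp add: norm_mult)
qed

lemma \<tau>_tendsto:
  assumes "X \<longlonglongrightarrow> T" "\<And>k. X k \<in> M"
  shows "(\<lambda>k. \<tau> (X k)) \<longlonglongrightarrow> \<tau> T"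
proof (rule LIM_zero_cancel, rule tendsto_norm_zero_cancel, rule tendsto_sandwich)
  have T: "T \<in> M" using assms by (rule M_limit)
  show "\<forall>\<^sub>F k in sequentially. 0 \<le> norm (\<tau> (X k) - \<tau> T)" by simp
  show "\<forall>\<^sub>F k in sequentially. norm (\<tau> (X k) - \<tau> T) \<le> 2 * norm (X k - T)"
    using \<tau>_bounded[of "X _ - T"] assms(2) T by (simp add: \<tau>_diff M_diff)
  show "(\<lambda>k. 2 * norm (X k - T)) \<longlonglongrightarrow> 0"
    using assms(1) LIM_zero tendsto_mult_right_zero tendsto_norm_zero by blast
qed simp

lemma \<tau>_sums:
  assumes "F sums T" "\<And>k. F k \<in> M"
  shows "(\<lambda>k. \<tau> (F k)) sums \<tau> T"
  using \<tau>_tendsto[of "\<lambda>n. sum F {..<n}" T] assms unfolding sums_def by (simp add: M_sum \<tau>_sum)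

end


section \<open>Matrices of operators\<close>

lemma mat_sum_carrier [simp]: "mat_sum m I F \<in> carrier_mat m m"
  by (simp add: mat_sum_def)

lemma mat_scaleC_carrier [simp]: "A \<in> carrier_mat m m \<Longrightarrow> mat_scaleC c A \<in> carrier_mat m m"
  by (simp add: mat_scaleC_def)

lemma mat_adj_carrier [simp]: "A \<in> carrier_mat m m \<Longrightarrow> mat_adj A \<in> carrier_mat m m"
  by (simp add: mat_adj_def)

lemma mat_pow_carrier [simp]: "A \<in> carrier_mat m m \<Longrightarrow> A ^\<^sub>m k \<in> carrier_mat m m"
  by (rule pow_carrier_mat)

lemma mat_mult_carrier [simp]:
  "A \<in> carrier_mat m m \<Longrightarrow> B \<in> carrier_mat m m \<Longrightarrow> A * B \<in> carrier_mat m m"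
  by (rule mult_carrier_mat)

lemma mat_diff_carrier [simp]:
  "B \<in> carrier_mat m m \<Longrightarrow> A - B \<in> carrier_mat m m"
  by (rule minus_carrier_mat)

lemma mat_mult_assoc:
  fixes A B C :: "'a::semiring_0 mat"
  assumes "A \<in> carrier_mat m m" "B \<in> carrier_mat m m" "C \<in> carrier_mat m m"
  shows "A * B * C = A * (B * C)"
  using assms by (rule assoc_mult_mat)

lemma mat_sum_index:
  "i < m \<Longrightarrow> j < m \<Longrightarrow> mat_sum m I F $$ (i, j) = (\<Sum>l\<in>I. F l $$ (i, j))"
  by (simp add: mat_sum_def)

lemma mat_add_index:
  "i < m \<Longrightarrow> j < m \<Longrightarrow> B \<in> carrier_mat m m \<Longrightarrow> (C + B) $$ (i, j) = C $$ (i, j) + B $$ (i, j)"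
  by auto

lemma mat_diff_index:
  "i < m \<Longrightarrow> j < m \<Longrightarrow> B \<in> carrier_mat m m \<Longrightarrow> (C - B) $$ (i, j) = C $$ (i, j) - B $$ (i, j)"
  by auto

lemma mat_scaleC_index:
  "i < m \<Longrightarrow> j < m \<Longrightarrow> A \<in> carrier_mat m m \<Longrightarrow> mat_scaleC c A $$ (i, j) = c *\<^sub>C A $$ (i, j)"
  by (auto simp: mat_scaleC_def)

lemma mat_adj_index:
  "i < m \<Longrightarrow> j < m \<Longrightarrow> A \<in> carrier_mat m m \<Longrightarrow> mat_adj A $$ (i, j) = cop_adj (A $$ (j, i))"
  by (auto simp: mat_adj_def)

lemmas mat_index = mat_sum_index mat_add_index mat_diff_index mat_scaleC_index mat_adj_index

lemma mat_mult_index: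
  fixes A B :: "'a::semiring_0 mat"
  assumes "A \<in> carrier_mat m m" "B \<in> carrier_mat m m" "i < m" "j < m"
  shows "(A * B) $$ (i, j) = (\<Sum>k<m. A $$ (i, k) * B $$ (k, j))"
  using assms by (auto simp: scalar_prod_def atLeast0LessThan intro!: sum.cong)

lemma mat_eqI:
  "A \<in> carrier_mat m m \<Longrightarrow> B \<in> carrier_mat m m \<Longrightarrow>
    (\<And>i j. i < m \<Longrightarrow> j < m \<Longrightarrow> A $$ (i, j) = B $$ (i, j)) \<Longrightarrow> A = B"
  by (rule eq_matI) auto

lemma mat_sum_mult_left:
  fixes A :: "'a::semiring_0 mat"
  assumes "A \<in> carrier_mat m m" "\<And>l. l \<in> I \<Longrightarrow> F l \<in> carrier_mat m m"
  shows "A * mat_sum m I F = mat_sum m I (\<lambda>l. A * F l)"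
proof (rule mat_eqI)
  fix i j assume ij: "i < m" "j < m"
  have "(A * mat_sum m I F) $$ (i, j) = (\<Sum>k<m. \<Sum>l\<in>I. A $$ (i, k) * F l $$ (k, j))"
    using assms ij by (simp add: mat_mult_index[where m = m] mat_sum_index sum_distrib_left)
  also have "\<dots> = (\<Sum>l\<in>I. (A * F l) $$ (i, j))"
    using assms ij by (subst sum.swap) (simp add: mat_mult_index[where m = m])
  finally show "(A * mat_sum m I F) $$ (i, j) = mat_sum m I (\<lambda>l. A * F l) $$ (i, j)"
    using ij by (simp add: mat_sum_index)
qed (use assms in auto)

lemma mat_sum_mult_right:
  fixes A :: "'a::semiring_0 mat"
  assumes "A \<in> carrier_mat m m" "\<And>l. l \<in> I \<Longrightarrow> F l \<in> carrier_mat m m"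
  shows "mat_sum m I F * A = mat_sum m I (\<lambda>l. F l * A)"
proof (rule mat_eqI)
  fix i j assume ij: "i < m" "j < m"
  have "(mat_sum m I F * A) $$ (i, j) = (\<Sum>k<m. \<Sum>l\<in>I. F l $$ (i, k) * A $$ (k, j))"
    using assms ij by (simp add: mat_mult_index[where m = m] mat_sum_index sum_distrib_right)
  also have "\<dots> = (\<Sum>l\<in>I. (F l * A) $$ (i, j))"
    using assms ij by (subst sum.swap) (simp add: mat_mult_index[where m = m])
  finally show "(mat_sum m I F * A) $$ (i, j) = mat_sum m I (\<lambda>l. F l * A) $$ (i, j)"
    using ij by (simp add: mat_sum_index)
qed (use assms in auto)

lemma mat_scaleC_mult:
  fixes A B :: "'h::chilbert_space cop mat"
  assumes "A \<in> carrier_mat m m" "B \<in> carrier_mat m m"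
  shows "mat_scaleC c A * B = mat_scaleC c (A * B)" "A * mat_scaleC c B = mat_scaleC c (A * B)"
  by (rule mat_eqI[where m = m];
      use assms in \<open>auto simp: mat_mult_index[where m = m] mat_index cop_scaleC_sum_right
        simp del: index_mult_mat(1)\<close>)+

lemma mat_scaleC_scaleC: "mat_scaleC c (mat_scaleC d A) = mat_scaleC (c * d) A"
  by (rule eq_matI) (auto simp: mat_scaleC_def)

lemma mat_scaleC_one: "mat_scaleC 1 A = A"
  by (rule eq_matI) (auto simp: mat_scaleC_def)

lemma mat_adj_mult:
  assumes "A \<in> carrier_mat m m" "B \<in> carrier_mat m m"
  shows "mat_adj (A * B) = mat_adj B * mat_adj A"
  by (rule mat_eqI[where m = m])
    (use assms in \<open>auto simp: mat_mult_index[where m = m] mat_index cop_adj_sum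
      simp del: index_mult_mat(1)\<close>)

lemma mat_adj_adj: "mat_adj (mat_adj A) = A"
  by (rule eq_matI) (auto simp: mat_adj_def)

lemma mat_pow_Suc_left:
  fixes A :: "'a::semiring_1 mat"
  assumes A: "A \<in> carrier_mat m m"
  shows "A ^\<^sub>m Suc k = A * A ^\<^sub>m k"
proof (induction k)
  case (Suc k)
  have "A ^\<^sub>m Suc (Suc k) = (A * A ^\<^sub>m k) * A" using Suc by simp
  also have "\<dots> = A * (A ^\<^sub>m k * A)" using A by (simp add: mat_mult_assoc[where m = m])
  finally show ?case by simp
qed (use A in auto)

text \<open>
  The sum of the norms of the entries is a submultiplicative norm; it serves for all convergence
  arguments in which the exact operator norm does not matter.
\<close>

definition mnorm :: "nat \<Rightarrow> 'a::real_normed_vector mat \<Rightarrow> real" where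
  "mnorm m A = (\<Sum>i<m. \<Sum>j<m. norm (A $$ (i, j)))"

lemma mnorm_nonneg [simp]: "0 \<le> mnorm m A"
  by (auto simp: mnorm_def intro!: sum_nonneg)

lemma norm_entry_le_mnorm: "i < m \<Longrightarrow> j < m \<Longrightarrow> norm (A $$ (i, j)) \<le> mnorm m A"
  unfolding mnorm_def
  by (rule order_trans[OF _ member_le_sum[of i]])
    (auto intro!: sum_nonneg member_le_sum[of j "{..<m}" "\<lambda>j. norm (A $$ (i, j))"])

lemma mnorm_add:
  assumes "A \<in> carrier_mat m m" "B \<in> carrier_mat m m"
  shows "mnorm m (A + B) \<le> mnorm m A + mnorm m B"
  unfolding mnorm_def sum.distrib[symmetric]
  by (intro sum_mono) (use assms in \<open>auto intro: norm_triangle_ineq\<close>)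

lemma mnorm_scaleC:
  fixes A :: "'h::chilbert_space cop mat"
  assumes "A \<in> carrier_mat m m"
  shows "mnorm m (mat_scaleC c A) \<le> cmod c * mnorm m A"
  unfolding mnorm_def sum_distrib_left
  by (intro sum_mono) (use assms in \<open>auto simp: mat_index norm_cop_scaleC_le\<close>)

lemma mnorm_mult:
  fixes A :: "'a::real_normed_algebra mat"
  assumes "A \<in> carrier_mat m m" "B \<in> carrier_mat m m"
  shows "mnorm m (A * B) \<le> mnorm m A * mnorm m B"
proof -
  have row: "(\<Sum>j<m. norm (B $$ (k, j))) \<le> mnorm m B" if "k < m" for k
    unfolding mnorm_def by (rule member_le_sum[of k]) (use that in \<open>auto intro: sum_nonneg\<close>)
  have "mnorm m (A * B) \<le> (\<Sum>i<m. \<Sum>j<m. \<Sum>k<m. norm (A $$ (i, k)) * norm (B $$ (k, j)))"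
    unfolding mnorm_def
    by (intro sum_mono) (use assms in \<open>auto simp: mat_mult_index[where m = m]
        simp del: index_mult_mat(1) intro!: sum_norm_le norm_mult_ineq\<close>)
  also have "\<dots> = (\<Sum>i<m. \<Sum>k<m. norm (A $$ (i, k)) * (\<Sum>j<m. norm (B $$ (k, j))))"
    by (rule sum.cong[OF refl], subst sum.swap, simp add: sum_distrib_left)
  also have "\<dots> \<le> (\<Sum>i<m. \<Sum>k<m. norm (A $$ (i, k)) * mnorm m B)"
    by (intro sum_mono mult_left_mono row) auto
  also have "\<dots> = mnorm m A * mnorm m B" by (simp add: mnorm_def sum_distrib_right)
  finally show ?thesis .
qed

lemma mnorm_pow:
  fixes A :: "'a::real_normed_algebra_1 mat"
  assumes A: "A \<in> carrier_mat m m"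
  shows "mnorm m (A ^\<^sub>m Suc k) \<le> mnorm m A ^ Suc k"
proof (induction k)
  case (Suc k)
  have "mnorm m (A ^\<^sub>m Suc k * A) \<le> mnorm m (A ^\<^sub>m Suc k) * mnorm m A"
    by (intro mnorm_mult pow_carrier_mat A)
  also have "\<dots> \<le> mnorm m A ^ Suc k * mnorm m A"
    by (intro mult_right_mono Suc) simp
  finally show ?case by (simp add: mult.commute)
qed (use A in auto)

lemma norm_entry_pow:
  fixes A :: "'a::real_normed_algebra_1 mat"
  assumes A: "A \<in> carrier_mat m m" and ij: "i < m" "j < m"
  shows "norm ((A ^\<^sub>m k) $$ (i, j)) \<le> mnorm m A ^ k"
proof (cases k)
  case (Suc l)
  then show ?thesis using norm_entry_le_mnorm[OF ij] mnorm_pow[OF A] order_trans by blast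
qed (use A ij in auto)


section \<open>Polynomials in a matrix\<close>

definition mat_cpoly :: "nat \<Rightarrow> complex poly \<Rightarrow> 'h::chilbert_space cop mat \<Rightarrow> 'h cop mat" where
  "mat_cpoly m g A = mat_sum m {..degree g} (\<lambda>k. mat_scaleC (coeff g k) (A ^\<^sub>m k))"

lemma mat_cpoly_carrier [simp]: "mat_cpoly m g A \<in> carrier_mat m m"
  by (simp add: mat_cpoly_def)

lemma mat_poly_conv_cpoly: "mat_poly m q A = mat_cpoly m (map_poly complex_of_real q) A"
  by (simp add: mat_poly_def mat_cpoly_def degree_map_poly coeff_map_poly)

lemma mat_cpoly_index:
  assumes "A \<in> carrier_mat m m" "degree g \<le> n" "i < m" "j < m"
  shows "mat_cpoly m g A $$ (i, j) = (\<Sum>k\<le>n. coeff g k *\<^sub>C (A ^\<^sub>m k) $$ (i, j))"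
proof -
  have "mat_cpoly m g A $$ (i, j) = (\<Sum>k\<le>degree g. coeff g k *\<^sub>C (A ^\<^sub>m k) $$ (i, j))"
    using assms by (simp add: mat_cpoly_def mat_index)
  also have "\<dots> = (\<Sum>k\<le>n. coeff g k *\<^sub>C (A ^\<^sub>m k) $$ (i, j))"
    using assms by (intro sum.mono_neutral_left) (auto simp: coeff_eq_0)
  finally show ?thesis .
qed

lemma mat_cpoly_0: "A \<in> carrier_mat m m \<Longrightarrow> mat_cpoly m 0 A = 0\<^sub>m m m"
  by (rule mat_eqI[where m = m]) (auto simp: mat_cpoly_index[where n = 0])

lemma mat_cpoly_add:
  assumes "A \<in> carrier_mat m m"
  shows "mat_cpoly m (g + h) A = mat_cpoly m g A + mat_cpoly m h A"
proof (rule mat_eqI)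
  fix i j assume ij: "i < m" "j < m"
  define n where "n = max (degree g) (degree h)"
  have n: "degree g \<le> n" "degree h \<le> n" "degree (g + h) \<le> n"
    by (auto simp: n_def degree_add_le)
  show "mat_cpoly m (g + h) A $$ (i, j) = (mat_cpoly m g A + mat_cpoly m h A) $$ (i, j)"
    using mat_cpoly_index[OF assms n(1) ij] mat_cpoly_index[OF assms n(2) ij]
      mat_cpoly_index[OF assms n(3) ij]
    by (simp add: mat_index[OF ij] cop_scaleC_add_left sum.distrib)
qed auto

lemma mat_cpoly_smult:
  assumes "A \<in> carrier_mat m m"
  shows "mat_cpoly m (Polynomial.smult c g) A = mat_scaleC c (mat_cpoly m g A)"
proof (rule mat_eqI)
  fix i j assume ij: "i < m" "j < m"
  show "mat_cpoly m (Polynomial.smult c g) A $$ (i, j) = mat_scaleC c (mat_cpoly m g A) $$ (i, j)"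
    using mat_cpoly_index[OF assms degree_smult_le ij, of c g] mat_cpoly_index[OF assms order_refl ij, of g]
    by (simp add: mat_index[OF ij] cop_scaleC_sum_right)
qed auto

lemma mat_cpoly_pCons:
  assumes A: "A \<in> carrier_mat m m"
  shows "mat_cpoly m (pCons a g) A = mat_scaleC a (1\<^sub>m m) + A * mat_cpoly m g A"
proof (rule mat_eqI)
  fix i j assume ij: "i < m" "j < m"
  have "(A * mat_cpoly m g A) $$ (i, j) = (\<Sum>k\<le>degree g. coeff g k *\<^sub>C (A ^\<^sub>m Suc k) $$ (i, j))"
    unfolding mat_cpoly_def
    using A ij by (simp add: mat_sum_mult_left mat_index mat_scaleC_mult[where m = m] mat_pow_Suc_left
        del: pow_mat.simps)
  moreover have "mat_cpoly m (pCons a g) A $$ (i, j) =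
      (\<Sum>k\<le>Suc (degree g). coeff (pCons a g) k *\<^sub>C (A ^\<^sub>m k) $$ (i, j))"
    by (rule mat_cpoly_index[OF A _ ij]) (rule degree_pCons_le)
  moreover have "\<dots> = a *\<^sub>C (A ^\<^sub>m 0) $$ (i, j) + (\<Sum>k\<le>degree g. coeff g k *\<^sub>C (A ^\<^sub>m Suc k) $$ (i, j))"
    by (subst sum.atMost_Suc_shift) simp
  ultimately show "mat_cpoly m (pCons a g) A $$ (i, j) =
      (mat_scaleC a (1\<^sub>m m) + A * mat_cpoly m g A) $$ (i, j)"
    using A ij by (simp add: mat_index[where m = m] del: index_mult_mat(1))
qed (use A in auto)

lemma mat_cpoly_mult:
  assumes A: "A \<in> carrier_mat m m"
  shows "mat_cpoly m (g * h) A = mat_cpoly m g A * mat_cpoly m h A"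
proof (induction g)
  case 0
  show ?case using left_mult_zero_mat[OF mat_cpoly_carrier, of m m h A] A by (simp add: mat_cpoly_0)
next
  case (pCons a g)
  have z: "mat_scaleC 0 (1\<^sub>m m) = (0\<^sub>m m m :: 'a cop mat)"
    by (rule mat_eqI[where m = m]) (auto simp: mat_index)
  have "mat_cpoly m (pCons a g * h) A =
      mat_scaleC a (mat_cpoly m h A) + A * (mat_cpoly m g A * mat_cpoly m h A)"
    using A by (simp add: mat_cpoly_add mat_cpoly_smult mat_cpoly_pCons pCons.IH z)
  also have "\<dots> = (mat_scaleC a (1\<^sub>m m) + A * mat_cpoly m g A) * mat_cpoly m h A"
    using A by (subst add_mult_distrib_mat[where nr = m and n = m and nc = m])
      (auto simp: mat_scaleC_mult[where m = m] mat_mult_assoc[where m = m]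
        left_mult_one_mat[where nr = m and nc = m])
  finally show ?case using A by (simp add: mat_cpoly_pCons)
qed

lemma mat_cpoly_const:
  "A \<in> carrier_mat m m \<Longrightarrow> mat_cpoly m [:c:] A = mat_scaleC c (1\<^sub>m m)"
  by (rule mat_eqI[where m = m]) (auto simp: mat_cpoly_index[where n = 0] mat_index)

lemma mat_cpoly_linear:
  fixes A :: "'h::chilbert_space cop mat"
  assumes "A \<in> carrier_mat m m"
  shows "mat_cpoly m [:c, 1:] A = mat_scaleC c (1\<^sub>m m) + A"
proof -
  have "mat_cpoly m [:1:] A = 1\<^sub>m m"
    using assms by (simp only: mat_cpoly_const mat_scaleC_one)
  then show ?thesis using assms mat_cpoly_pCons[OF assms, of c "[:1:]"] by simp
qed

lemma mat_cpoly_pcompose: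
  assumes A: "A \<in> carrier_mat m m"
  shows "mat_cpoly m (pcompose g h) A = mat_cpoly m g (mat_cpoly m h A)"
proof (induction g)
  case 0
  show ?case using A by (simp add: mat_cpoly_0)
next
  case (pCons a g)
  have "mat_cpoly m (pcompose (pCons a g) h) A =
      mat_scaleC a (1\<^sub>m m) + mat_cpoly m h A * mat_cpoly m g (mat_cpoly m h A)"
    using A by (simp only: pcompose_pCons mat_cpoly_add mat_cpoly_mult mat_cpoly_const pCons.IH)
  then show ?case by (simp add: mat_cpoly_pCons)
qed


section \<open>The action on vectors\<close>

text \<open>
  The size \<open>m\<close> is not fixed by a type, so vectors are sequences of which only the first \<open>m\<close> coordinates
  count.
\<close>

definition mat_act :: "nat \<Rightarrow> 'h::chilbert_space cop mat \<Rightarrow> (nat \<Rightarrow> 'h) \<Rightarrow> nat \<Rightarrow> 'h" where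
  "mat_act m A v i = (if i < m then \<Sum>j<m. cop_apply (A $$ (i, j)) (v j) else 0)"

definition vnorm :: "nat \<Rightarrow> (nat \<Rightarrow> 'h::chilbert_space) \<Rightarrow> real" where
  "vnorm m v = L2_set (\<lambda>i. norm (v i)) {..<m}"

definition vinner :: "nat \<Rightarrow> (nat \<Rightarrow> 'h::chilbert_space) \<Rightarrow> (nat \<Rightarrow> 'h) \<Rightarrow> complex" where
  "vinner m v w = (\<Sum>i<m. cinner (v i) (w i))"

lemma vnorm_nonneg [simp]: "0 \<le> vnorm m v"
  by (simp add: vnorm_def)

lemma vinner_self: "vinner m v v = complex_of_real ((vnorm m v)\<^sup>2)"
  by (simp add: vinner_def vnorm_def L2_set_def cinner_self sum_nonneg)

lemma cmod_vinner_le: "cmod (vinner m v w) \<le> vnorm m v * vnorm m w"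
proof -
  have "cmod (vinner m v w) \<le> (\<Sum>i<m. norm (v i) * norm (w i))"
    unfolding vinner_def by (intro sum_norm_le cmod_cinner_le)
  also have "\<dots> \<le> vnorm m v * vnorm m w"
    unfolding vnorm_def using L2_set_mult_ineq[of "\<lambda>i. norm (v i)" "\<lambda>i. norm (w i)"] by simp
  finally show ?thesis .
qed

lemma vinner_commute: "vinner m v w = cnj (vinner m w v)"
  by (simp add: vinner_def) (metis cinner_commute)

lemma vinner_cong: "(\<And>i. i < m \<Longrightarrow> w i = w' i) \<Longrightarrow> vinner m v w = vinner m v w'"
  by (simp add: vinner_def)

lemma vnorm_cong: "(\<And>i. i < m \<Longrightarrow> v i = w i) \<Longrightarrow> vnorm m v = vnorm m w"
  unfolding vnorm_def by (rule L2_set_cong) auto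

lemma vnorm_le_sum: "vnorm m v \<le> (\<Sum>i<m. norm (v i))"
  unfolding vnorm_def by (rule L2_set_le_sum) simp

lemma norm_le_vnorm: "i < m \<Longrightarrow> norm (v i) \<le> vnorm m v"
  unfolding vnorm_def by (rule member_le_L2_set) auto

lemma vnorm_scaleC: "vnorm m (\<lambda>i. c *\<^sub>C v i) = cmod c * vnorm m v"
  by (simp add: vnorm_def norm_scaleC L2_set_right_distrib)

lemma vinner_simps:
  "vinner m v (\<lambda>i. w i + w' i) = vinner m v w + vinner m v w'"
  "vinner m v (\<lambda>i. w i - w' i) = vinner m v w - vinner m v w'"
  "vinner m (\<lambda>i. w i + w' i) v = vinner m w v + vinner m w' v"
  "vinner m v (\<lambda>i. c *\<^sub>C w i) = c * vinner m v w"
  "vinner m (\<lambda>i. c *\<^sub>C w i) v = cnj c * vinner m w v"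
  by (simp_all add: vinner_def cinner_add_left cinner_add_right cinner_diff_right
      cinner_scaleC_left cinner_scaleC_right sum.distrib sum_subtractf sum_distrib_left)

lemma mat_act_diff:
  "B \<in> carrier_mat m m \<Longrightarrow> mat_act m (A - B) v = (\<lambda>i. mat_act m A v i - mat_act m B v i)"
  by (auto simp: mat_act_def mat_index sum_subtractf)

lemma mat_act_scaleC:
  "A \<in> carrier_mat m m \<Longrightarrow> mat_act m (mat_scaleC c A) v = (\<lambda>i. c *\<^sub>C mat_act m A v i)"
  by (auto simp: mat_act_def mat_index scaleC_sum_right)

lemma mat_act_mult:
  "A \<in> carrier_mat m m \<Longrightarrow> B \<in> carrier_mat m m \<Longrightarrow>
    mat_act m (A * B) v = mat_act m A (mat_act m B v)"
  by (auto simp: mat_act_def mat_mult_index[where m = m] cop_apply_sum simp del: index_mult_mat(1)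
      intro!: sum.swap)

lemma mat_act_one: "i < m \<Longrightarrow> mat_act m (1\<^sub>m m) v i = v i"
proof -
  assume "i < m"
  then have "(\<Sum>j<m. cop_apply (1\<^sub>m m $$ (i, j)) (v j)) = (\<Sum>j<m. if j = i then v j else 0)"
    by (intro sum.cong) auto
  with \<open>i < m\<close> show ?thesis by (simp add: mat_act_def)
qed

lemma vnorm_mat_act_one [simp]: "vnorm m (mat_act m (1\<^sub>m m) v) = vnorm m v"
  by (rule vnorm_cong) (rule mat_act_one)

lemma vnorm_mat_act_le: "vnorm m (mat_act m A v) \<le> mnorm m A * vnorm m v"
proof -
  have "vnorm m (mat_act m A v) \<le> (\<Sum>i<m. norm (mat_act m A v i))" by (rule vnorm_le_sum)
  also have "\<dots> \<le> (\<Sum>i<m. \<Sum>j<m. norm (A $$ (i, j)) * vnorm m v)"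
  proof (intro sum_mono)
    fix i assume "i \<in> {..<m}"
    then have "norm (mat_act m A v i) \<le> (\<Sum>j<m. norm (cop_apply (A $$ (i, j)) (v j)))"
      by (simp add: mat_act_def norm_sum)
    also have "\<dots> \<le> (\<Sum>j<m. norm (A $$ (i, j)) * vnorm m v)"
      by (intro sum_mono order_trans[OF norm_cop_apply_le] mult_left_mono norm_le_vnorm) auto
    finally show "norm (mat_act m A v i) \<le> (\<Sum>j<m. norm (A $$ (i, j)) * vnorm m v)" .
  qed
  also have "\<dots> = mnorm m A * vnorm m v" by (simp add: mnorm_def sum_distrib_right)
  finally show ?thesis .
qed

lemma vinner_mat_adj:
  assumes "A \<in> carrier_mat m m"
  shows "vinner m v (mat_act m (mat_adj A) w) = vinner m (mat_act m A v) w"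
proof -
  have "vinner m v (mat_act m (mat_adj A) w) =
      (\<Sum>i<m. \<Sum>j<m. cinner (cop_apply (A $$ (j, i)) (v i)) (w j))"
    using assms by (simp add: vinner_def mat_act_def mat_index cinner_sum_right cinner_cop_adj)
  also have "\<dots> = vinner m (mat_act m A v) w"
    by (subst sum.swap) (simp add: vinner_def mat_act_def cinner_sum_left)
  finally show ?thesis .
qed

lemma norm_entry_le_act:
  assumes b: "0 \<le> b" "\<And>v. vnorm m (mat_act m A v) \<le> b * vnorm m v" and ij: "i < m" "j < m"
  shows "norm (A $$ (i, j)) \<le> b"
proof (rule norm_cop_bound[OF b(1)])
  fix x :: 'a
  define v where "v k = (if k = j then x else 0)" for k
  have v: "vnorm m v = norm x"
  proof -
    have "(\<Sum>k<m. (norm (v k))\<^sup>2) = (\<Sum>k<m. if k = j then (norm x)\<^sup>2 else 0)"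
      by (intro sum.cong) (auto simp: v_def)
    then show ?thesis using ij by (simp add: vnorm_def L2_set_def)
  qed
  have "(\<Sum>k<m. cop_apply (A $$ (i, k)) (v k)) = (\<Sum>k<m. if k = j then cop_apply (A $$ (i, j)) x else 0)"
    by (intro sum.cong) (auto simp: v_def)
  then have "cop_apply (A $$ (i, j)) x = mat_act m A v i" using ij by (simp add: mat_act_def)
  then have "norm (cop_apply (A $$ (i, j)) x) \<le> vnorm m (mat_act m A v)"
    using norm_le_vnorm[OF ij(1)] by metis
  also have "\<dots> \<le> b * norm x" using b(2)[of v] v by simp
  finally show "norm (cop_apply (A $$ (i, j)) x) \<le> b * norm x" .
qed

definition symmetric_mat :: "nat \<Rightarrow> 'h::chilbert_space cop mat \<Rightarrow> bool" where
  "symmetric_mat m A \<longleftrightarrow> A \<in> carrier_mat m m \<and>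
     (\<forall>v w. vinner m (mat_act m A v) w = vinner m v (mat_act m A w))"

lemma symmetric_mat_carrier: "symmetric_mat m A \<Longrightarrow> A \<in> carrier_mat m m"
  by (simp add: symmetric_mat_def)

text \<open>
  Vectors with a single nonzero coordinate recover the entries of a matrix from its
  sesquilinear form.
\<close>

lemma symmetric_mat_iff:
  fixes A :: "'h::chilbert_space cop mat"
  assumes A: "A \<in> carrier_mat m m"
  shows "symmetric_mat m A \<longleftrightarrow> mat_adj A = A"
proof
  assume "mat_adj A = A"
  then show "symmetric_mat m A" using A vinner_mat_adj[OF A] by (simp add: symmetric_mat_def)
next
  assume sym: "symmetric_mat m A"
  show "mat_adj A = A"
  proof (rule mat_eqI)
    fix i j assume ij: "i < m" "j < m"
    have ent: "vinner m (\<lambda>k. if k = a then x else 0) (mat_act m B (\<lambda>k. if k = b then y else 0)) =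
        cinner x (cop_apply (B $$ (a, b)) y)" if "a < m" "b < m" for a b and x y :: 'h and B
    proof -
      have act: "mat_act m B (\<lambda>k. if k = b then y else 0) k = cop_apply (B $$ (k, b)) y" if "k < m" for k
      proof -
        have "(\<Sum>j<m. cop_apply (B $$ (k, j)) (if j = b then y else 0)) =
            (\<Sum>j<m. if j = b then cop_apply (B $$ (k, b)) y else 0)"
          by (intro sum.cong) auto
        then show ?thesis using \<open>b < m\<close> that by (simp add: mat_act_def)
      qed
      have "vinner m (\<lambda>k. if k = a then x else 0) (mat_act m B (\<lambda>k. if k = b then y else 0)) =
          (\<Sum>k<m. if k = a then cinner x (cop_apply (B $$ (a, b)) y) else 0)"
        unfolding vinner_def by (intro sum.cong) (auto simp: act)
      then show ?thesis using \<open>a < m\<close> by simp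
    qed
    show "mat_adj A $$ (i, j) = A $$ (i, j)"
    proof (rule cop_eqI, rule cinner_eqI)
      fix x y :: 'h
      let ?v = "\<lambda>k. if k = i then x else 0" and ?w = "\<lambda>k. if k = j then y else 0"
      have "cinner x (cop_apply (mat_adj A $$ (i, j)) y) = vinner m (mat_act m A ?v) ?w"
        by (metis ent[OF ij] vinner_mat_adj[OF A])
      also have "\<dots> = vinner m ?v (mat_act m A ?w)" using sym by (simp add: symmetric_mat_def)
      also have "\<dots> = cinner x (cop_apply (A $$ (i, j)) y)" by (rule ent[OF ij])
      finally show "cinner x (cop_apply (mat_adj A $$ (i, j)) y) = cinner x (cop_apply (A $$ (i, j)) y)" .
    qed
  qed (use A in auto)
qed

lemma mat_adj_pow:
  assumes A: "A \<in> carrier_mat m m" and "mat_adj A = A"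
  shows "mat_adj (A ^\<^sub>m k) = A ^\<^sub>m k"
proof (induction k)
  case 0
  show ?case by (rule mat_eqI[where m = m]) (use A in \<open>auto simp: mat_index\<close>)
next
  case (Suc k)
  have "mat_adj (A ^\<^sub>m Suc k) = A * A ^\<^sub>m k"
    using A Suc assms by (simp add: mat_adj_mult[where m = m])
  then show ?case using mat_pow_Suc_left[OF A] by metis
qed

lemma symmetric_mat_poly:
  assumes "symmetric_mat m A"
  shows "symmetric_mat m (mat_poly m q A)"
proof -
  have A: "A \<in> carrier_mat m m" using assms by (rule symmetric_mat_carrier)
  have "mat_adj (A ^\<^sub>m k) = A ^\<^sub>m k" for k
    using A assms by (simp add: mat_adj_pow symmetric_mat_iff)
  then have "cop_adj ((A ^\<^sub>m k) $$ (j, i)) = (A ^\<^sub>m k) $$ (i, j)" if "i < m" "j < m" for i j k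
    using mat_adj_index[OF that mat_pow_carrier[OF A], of k] by simp
  then have "mat_adj (mat_poly m q A) = mat_poly m q A"
    unfolding mat_poly_def
    by (intro mat_eqI[where m = m]) (use A in \<open>auto simp: mat_index cop_adj_sum\<close>)
  then show ?thesis by (subst symmetric_mat_iff) (auto simp: mat_poly_def)
qed


section \<open>The spectral bound for polynomials in a symmetric matrix\<close>

definition bounded_below :: "nat \<Rightarrow> 'h::chilbert_space cop mat \<Rightarrow> bool" where
  "bounded_below m A \<longleftrightarrow> (\<exists>c>0. \<forall>v. c * vnorm m v \<le> vnorm m (mat_act m A v))"

lemma bounded_below_mult:
  assumes "A \<in> carrier_mat m m" "B \<in> carrier_mat m m" "bounded_below m A" "bounded_below m B"
  shows "bounded_below m (A * B)"
proof -
  obtain c d where c: "c > 0" "\<And>v. c * vnorm m v \<le> vnorm m (mat_act m A v)"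
    and d: "d > 0" "\<And>v. d * vnorm m v \<le> vnorm m (mat_act m B v)"
    using assms by (auto simp: bounded_below_def)
  have "c * d * vnorm m v \<le> vnorm m (mat_act m (A * B) v)" for v
  proof -
    have "c * (d * vnorm m v) \<le> c * vnorm m (mat_act m B v)"
      using c(1) d(2) by (intro mult_left_mono) auto
    also have "\<dots> \<le> vnorm m (mat_act m A (mat_act m B v))" by (rule c(2))
    finally show ?thesis using assms by (simp add: mat_act_mult mult.assoc)
  qed
  then show ?thesis unfolding bounded_below_def using c(1) d(1) by (intro exI[of _ "c * d"]) auto
qed

lemma mat_act_shift:
  assumes "A \<in> carrier_mat m m" "i < m"
  shows "mat_act m (A - mat_scaleC z (1\<^sub>m m)) v i = mat_act m A v i - z *\<^sub>C v i"
  using assms by (simp add: mat_act_diff[where m = m] mat_act_scaleC[where m = m] mat_act_one)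

text \<open>
  The form \<open>\<langle>v, A v\<rangle>\<close> is real, so \<open>\<langle>v, (A - z) v\<rangle>\<close> has the imaginary part \<open>- Im z \<parallel>v\<parallel>\<^sup>2\<close>.
\<close>

lemma bounded_below_nonreal:
  assumes sym: "symmetric_mat m A" and z: "Im z \<noteq> 0"
  shows "bounded_below m (A - mat_scaleC z (1\<^sub>m m))"
proof -
  have A: "A \<in> carrier_mat m m" using sym by (rule symmetric_mat_carrier)
  have "\<bar>Im z\<bar> * vnorm m v \<le> vnorm m (mat_act m (A - mat_scaleC z (1\<^sub>m m)) v)" for v
  proof -
    let ?w = "mat_act m (A - mat_scaleC z (1\<^sub>m m)) v"
    have "vinner m v (mat_act m A v) = cnj (vinner m v (mat_act m A v))"
      using sym by (metis symmetric_mat_def vinner_commute)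
    then have "Im (vinner m v (mat_act m A v)) = 0"
      by (metis Im_complex_of_real Reals_cnj_iff of_real_Re)
    moreover have "vinner m v ?w = vinner m v (mat_act m A v) - z * vinner m v v"
      by (subst vinner_cong[OF mat_act_shift[OF A]]) (simp_all add: vinner_simps)
    ultimately have "Im (vinner m v ?w) = - (Im z * (vnorm m v)\<^sup>2)"
      by (simp add: vinner_self)
    then have "\<bar>Im z\<bar> * (vnorm m v)\<^sup>2 \<le> cmod (vinner m v ?w)"
      using abs_Im_le_cmod[of "vinner m v ?w"] by (simp add: abs_mult)
    also have "\<dots> \<le> vnorm m v * vnorm m ?w" by (rule cmod_vinner_le)
    finally have "vnorm m v * (\<bar>Im z\<bar> * vnorm m v) \<le> vnorm m v * vnorm m ?w"
      by (simp add: power2_eq_square mult_ac)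
    moreover have "vnorm m v = 0 \<or> vnorm m v > 0" using vnorm_nonneg[of m v] by linarith
    ultimately show ?thesis by (auto simp: mult_le_cancel_left_pos)
  qed
  then show ?thesis using z unfolding bounded_below_def by (intro exI[of _ "\<bar>Im z\<bar>"]) auto
qed

lemma bounded_below_not_spectrum:
  assumes A: "A \<in> carrier_mat m m" and z: "z \<notin> mat_spectrum m A"
  shows "bounded_below m (A - mat_scaleC z (1\<^sub>m m))"
proof -
  define B where "B = A - mat_scaleC z (1\<^sub>m m)"
  have B: "B \<in> carrier_mat m m" unfolding B_def by (intro minus_carrier_mat) auto
  obtain C where BC: "B * C = 1\<^sub>m (dim_row B)" and CB: "C * B = 1\<^sub>m (dim_row C)"
    using z by (auto simp: mat_spectrum_def invertible_mat_def inverts_mat_def B_def)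
  have "dim_col C = m" using arg_cong[OF BC, of dim_col] B by simp
  moreover have "dim_row C = m" using arg_cong[OF CB, of dim_col] B by simp
  ultimately have C: "C \<in> carrier_mat m m" by auto
  have "inverse (mnorm m C + 1) * vnorm m v \<le> vnorm m (mat_act m B v)" for v
  proof -
    have "vnorm m v = vnorm m (mat_act m C (mat_act m B v))"
      using CB C B by (metis carrier_matD(1) mat_act_mult vnorm_mat_act_one)
    also have "\<dots> \<le> mnorm m C * vnorm m (mat_act m B v)" by (rule vnorm_mat_act_le)
    also have "\<dots> \<le> (mnorm m C + 1) * vnorm m (mat_act m B v)" by (intro mult_right_mono) auto
    finally have "vnorm m v \<le> (mnorm m C + 1) * vnorm m (mat_act m B v)" .
    moreover have "mnorm m C + 1 > 0" by (simp add: add_nonneg_pos)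
    ultimately show ?thesis by (simp add: field_simps)
  qed
  then show ?thesis unfolding bounded_below_def B_def[symmetric]
    by (intro exI[of _ "inverse (mnorm m C + 1)"]) (auto simp: add_nonneg_pos)
qed

text \<open>
  Over the complex numbers \<open>g(A)\<close> is a product of factors \<open>A - z\<close>, one for each root \<open>z\<close> of \<open>g\<close>.
\<close>

lemma bounded_below_cpoly:
  assumes A: "A \<in> carrier_mat m m" and g: "g \<noteq> 0"
    and roots: "\<And>z. poly g z = 0 \<Longrightarrow> bounded_below m (A - mat_scaleC z (1\<^sub>m m))"
  shows "bounded_below m (mat_cpoly m g A)"
  using g roots
proof (induction "degree g" arbitrary: g)
  case 0
  then obtain c where c: "g = [:c:]" by (metis degree_eq_zeroE)
  with 0 have "c \<noteq> 0" by auto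
  have "vnorm m (mat_act m (mat_cpoly m g A) v) = cmod c * vnorm m v" for v
  proof -
    have "vnorm m (mat_act m (mat_cpoly m g A) v) = vnorm m (\<lambda>i. c *\<^sub>C v i)"
      by (rule vnorm_cong) (simp add: c mat_cpoly_const[OF A] mat_act_scaleC[where m = m] mat_act_one)
    then show ?thesis by (simp add: vnorm_scaleC)
  qed
  with \<open>c \<noteq> 0\<close> show ?case unfolding bounded_below_def by (intro exI[of _ "cmod c"]) auto
next
  case (Suc n)
  then have "\<not> constant (poly g)" by (metis constant_degree nat.simps(3))
  then obtain z where z: "poly g z = 0" using fundamental_theorem_of_algebra by blast
  then obtain h where h: "g = [:- z, 1:] * h" by (metis dvdE poly_eq_0_iff_dvd)
  with Suc.prems(1) have "h \<noteq> 0" by auto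
  moreover from this have "n = degree h"
    using Suc.hyps(2) by (simp add: h degree_mult_eq del: mult_pCons_left)
  moreover have "bounded_below m (A - mat_scaleC w (1\<^sub>m m))" if "poly h w = 0" for w
    using Suc.prems(2)[of w] that by (simp add: h)
  ultimately have "bounded_below m (mat_cpoly m h A)" by (intro Suc.hyps(1))
  moreover have "mat_cpoly m [:- z, 1:] A = A - mat_scaleC z (1\<^sub>m m)"
    by (rule mat_eqI[where m = m])
      (use A in \<open>auto simp: mat_cpoly_linear mat_index cop_scaleC_minus_left
        intro: minus_carrier_mat\<close>)
  ultimately show ?case
    unfolding h mat_cpoly_mult[OF A]
    by (intro bounded_below_mult) (use A z Suc.prems(2) in auto)
qed

definition mat_opnorm :: "nat \<Rightarrow> 'h::chilbert_space cop mat \<Rightarrow> real" where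
  "mat_opnorm m A = Inf {k. 0 \<le> k \<and> (\<forall>v. vnorm m (mat_act m A v) \<le> k * vnorm m v)}"

lemma mat_opnorm_le:
  "0 \<le> k \<Longrightarrow> (\<And>v. vnorm m (mat_act m A v) \<le> k * vnorm m v) \<Longrightarrow> mat_opnorm m A \<le> k"
  unfolding mat_opnorm_def by (rule cInf_lower) (auto intro!: bdd_belowI[of _ 0])

lemma mat_opnorm_nonneg: "0 \<le> mat_opnorm m A"
  unfolding mat_opnorm_def
  by (rule cInf_greatest) (auto intro!: exI[of _ "mnorm m A"] simp: vnorm_mat_act_le)

lemma vnorm_mat_act_le_opnorm: "vnorm m (mat_act m A v) \<le> mat_opnorm m A * vnorm m v"
proof (cases "vnorm m v = 0")
  case True
  then show ?thesis using vnorm_mat_act_le[of m A v] by simp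
next
  case False
  then have pos: "vnorm m v > 0" using vnorm_nonneg[of m v] by linarith
  have "vnorm m (mat_act m A v) / vnorm m v \<le> mat_opnorm m A"
    unfolding mat_opnorm_def
    by (rule cInf_greatest)
      (use pos in \<open>auto intro!: exI[of _ "mnorm m A"] simp: vnorm_mat_act_le pos_divide_le_eq\<close>)
  then show ?thesis using pos by (simp add: pos_divide_le_eq)
qed

lemma vnorm_diff_power2:
  "(vnorm m (\<lambda>i. v i - w i))\<^sup>2 = (vnorm m v)\<^sup>2 - 2 * Re (vinner m v w) + (vnorm m w)\<^sup>2"
proof -
  have "cinner (v i - w i) (v i - w i) =
      cinner (v i) (v i) - cinner (v i) (w i) - cinner (w i) (v i) + cinner (w i) (w i)" for i
    using cinner_add_left[of "v i - w i" "w i" "v i - w i"] by (simp add: cinner_diff_right algebra_simps)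
  then have "vinner m (\<lambda>i. v i - w i) (\<lambda>i. v i - w i) =
      vinner m v v - vinner m v w - vinner m w v + vinner m w w"
    by (simp add: vinner_def sum.distrib sum_subtractf)
  moreover have "Re (vinner m w v) = Re (vinner m v w)"
    using arg_cong[OF vinner_commute[of m w v], of Re] by simp
  ultimately show ?thesis
    using arg_cong[OF vinner_self[of m "\<lambda>i. v i - w i"], of Re]
      arg_cong[OF vinner_self[of m v], of Re] arg_cong[OF vinner_self[of m w], of Re] by simp
qed

text \<open>
  With \<open>N = \<parallel>Q\<parallel>\<close> for \<open>Q = q(A)\<close>, the operator \<open>Q\<^sup>2 - N\<^sup>2\<close> is not bounded below, because
  \<open>\<parallel>(Q\<^sup>2 - N\<^sup>2) v\<parallel>\<^sup>2 \<le> N\<^sup>2 (N\<^sup>2 \<parallel>v\<parallel>\<^sup>2 - \<parallel>Q v\<parallel>\<^sup>2)\<close> and \<open>N\<close> cannot be lowered.  Factoring \<open>q\<^sup>2 - N\<^sup>2\<close> over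
  the complex numbers, some factor \<open>A - z\<close> is not bounded below; then \<open>z\<close> is real and in the
  spectrum.
\<close>

lemma mat_opnorm_attained:
  fixes A :: "'h::chilbert_space cop mat"
  assumes sym: "symmetric_mat m A" and "0 < m"
    and N: "N = mat_opnorm m (mat_poly m q A)"
    and nz: "q * q - [:N\<^sup>2:] \<noteq> 0"
  shows "\<exists>t. complex_of_real t \<in> mat_spectrum m A \<and> \<bar>poly q t\<bar> = N"
proof (rule ccontr)
  assume none: "\<not> ?thesis"
  have A: "A \<in> carrier_mat m m" using sym by (rule symmetric_mat_carrier)
  define Q where "Q = mat_poly m q A"
  have symQ: "symmetric_mat m Q" unfolding Q_def by (rule symmetric_mat_poly[OF sym])
  then have Q: "Q \<in> carrier_mat m m" by (rule symmetric_mat_carrier)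
  have N0: "0 \<le> N" by (simp add: N mat_opnorm_nonneg)
  define g where "g = map_poly complex_of_real (q * q - [:N\<^sup>2:])"
  have g_eq: "g = map_poly complex_of_real q * map_poly complex_of_real q - [:complex_of_real (N\<^sup>2):]"
    unfolding g_def by (simp add: poly_eq_iff coeff_map_poly coeff_mult coeff_pCons split: nat.split)
  have gnz: "g \<noteq> 0"
  proof
    assume "g = 0"
    then have "coeff (q * q - [:N\<^sup>2:]) k = 0" for k
      using coeff_map_poly[of complex_of_real "q * q - [:N\<^sup>2:]" k] unfolding g_def
      by (metis coeff_0 of_real_0 of_real_eq_0_iff)
    then show False using nz by (auto simp: poly_eq_iff)
  qed
  have roots: "bounded_below m (A - mat_scaleC z (1\<^sub>m m))" if z: "poly g z = 0" for z
  proof (cases "Im z = 0")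
    case True
    then obtain t where t: "z = complex_of_real t" by (metis complex_is_Real_iff Reals_cases)
    have "complex_of_real ((poly q t)\<^sup>2 - N\<^sup>2) = 0"
    proof -
      have "poly (map_poly complex_of_real r) (complex_of_real t) = complex_of_real (poly r t)" for r
        by (induction r) (auto simp: map_poly_pCons)
      then show ?thesis using z unfolding g_def t by (simp add: power2_eq_square)
    qed
    then have "(poly q t)\<^sup>2 = N\<^sup>2" by (simp only: of_real_eq_0_iff right_minus_eq)
    then have "\<bar>poly q t\<bar> = N" using N0 by (metis abs_of_nonneg power2_eq_iff_nonneg power2_abs abs_ge_zero)
    then have "z \<notin> mat_spectrum m A" using none t by blast
    then show ?thesis by (rule bounded_below_not_spectrum[OF A])
  next
    case False
    then show ?thesis by (rule bounded_below_nonreal[OF sym])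
  qed
  obtain c where c: "c > 0" "\<And>v. c * vnorm m v \<le> vnorm m (mat_act m (mat_cpoly m g A) v)"
    using bounded_below_cpoly[OF A gnz roots] by (auto simp: bounded_below_def)
  have gA: "mat_cpoly m g A = Q * Q - mat_scaleC (complex_of_real (N\<^sup>2)) (1\<^sub>m m)"
  proof -
    have "g = map_poly complex_of_real q * map_poly complex_of_real q + [:- complex_of_real (N\<^sup>2):]"
      by (simp add: g_eq)
    then show ?thesis
      by (intro mat_eqI[where m = m])
        (use A Q in \<open>auto simp: mat_cpoly_add mat_cpoly_mult mat_cpoly_const Q_def mat_poly_conv_cpoly mat_index
          cop_scaleC_minus_left simp del: index_mult_mat(1)\<close>)
  qed
  have bound: "c\<^sup>2 * (vnorm m v)\<^sup>2 \<le> N\<^sup>2 * (N\<^sup>2 * (vnorm m v)\<^sup>2 - (vnorm m (mat_act m Q v))\<^sup>2)" for v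
  proof -
    let ?Qv = "mat_act m Q v"
    let ?QQv = "mat_act m Q ?Qv"
    have "(c * vnorm m v)\<^sup>2 \<le> (vnorm m (mat_act m (mat_cpoly m g A) v))\<^sup>2"
      using c by (intro power_mono) auto
    also have "vnorm m (mat_act m (mat_cpoly m g A) v) = vnorm m (\<lambda>i. ?QQv i - complex_of_real (N\<^sup>2) *\<^sub>C v i)"
      unfolding gA using Q
      by (intro vnorm_cong) (simp add: mat_act_shift mat_act_mult)
    also have "(\<dots>)\<^sup>2 = (vnorm m ?QQv)\<^sup>2 - 2 * N\<^sup>2 * (vnorm m ?Qv)\<^sup>2 + (N\<^sup>2)\<^sup>2 * (vnorm m v)\<^sup>2"
    proof -
      have "vinner m ?QQv v = complex_of_real ((vnorm m ?Qv)\<^sup>2)"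
        using symQ by (metis symmetric_mat_def vinner_self)
      moreover have "vnorm m (\<lambda>i. complex_of_real (N\<^sup>2) *\<^sub>C v i) = N\<^sup>2 * vnorm m v"
        by (simp only: vnorm_scaleC norm_of_real) simp
      ultimately show ?thesis
        by (simp add: vnorm_diff_power2 vinner_simps power_mult_distrib del: of_real_power)
    qed
    also have "(vnorm m ?QQv)\<^sup>2 \<le> (N * vnorm m ?Qv)\<^sup>2"
      unfolding N Q_def by (intro power_mono vnorm_mat_act_le_opnorm) auto
    finally show ?thesis by (simp add: power_mult_distrib algebra_simps power2_eq_square)
  qed
  have "N > 0"
  proof (rule ccontr)
    assume "\<not> N > 0"
    then have "N = 0" using N0 by simp
    obtain x :: 'h where "x \<noteq> 0" using ex_nonzero by blast
    then have "vnorm m (\<lambda>_. x) > 0" using norm_le_vnorm[OF \<open>0 < m\<close>, of "\<lambda>_. x"]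
      by (metis order_less_le_trans zero_less_norm_iff)
    then have "c\<^sup>2 * (vnorm m (\<lambda>_. x))\<^sup>2 > 0" using c(1) by simp
    then show False using bound[of "\<lambda>_. x"] \<open>N = 0\<close> by simp
  qed
  \<comment> \<open>The bound improves the norm of \<open>Q\<close> to \<open>K < N\<close>.\<close>
  define K where "K = sqrt (max 0 (N\<^sup>2 - c\<^sup>2 / N\<^sup>2))"
  have "vnorm m (mat_act m Q v) \<le> K * vnorm m v" for v
  proof -
    have "(vnorm m (mat_act m Q v))\<^sup>2 \<le> (N\<^sup>2 - c\<^sup>2 / N\<^sup>2) * (vnorm m v)\<^sup>2"
      using bound[of v] \<open>N > 0\<close> by (simp add: field_simps)
    also have "\<dots> \<le> K\<^sup>2 * (vnorm m v)\<^sup>2"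
      by (intro mult_right_mono) (auto simp: K_def)
    finally have "(vnorm m (mat_act m Q v))\<^sup>2 \<le> (K * vnorm m v)\<^sup>2" by (simp add: power_mult_distrib)
    then show ?thesis by (rule power2_le_imp_le) (auto simp: K_def)
  qed
  then have "N \<le> K" unfolding N Q_def by (intro mat_opnorm_le) (auto simp: K_def)
  moreover have "K < N"
  proof -
    have "K < sqrt (N\<^sup>2)" unfolding K_def using c(1) \<open>N > 0\<close> by (intro real_sqrt_less_mono) auto
    then show ?thesis using N0 by simp
  qed
  ultimately show False by simp
qed

text \<open>
  If \<open>q\<^sup>2\<close> is the constant \<open>\<parallel>q(A)\<parallel>\<^sup>2\<close>, the existence of a suitable spectral point comes from \<open>A\<close> itself, that is, from
  the polynomial \<open>[:0, 1:]\<close>.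
\<close>

lemma mat_poly_entry_bound:
  assumes sym: "symmetric_mat m A" and "0 \<le> c"
    and bd: "\<And>t. complex_of_real t \<in> mat_spectrum m A \<Longrightarrow> \<bar>poly q t\<bar> \<le> c"
    and ij: "i < m" "j < m"
  shows "norm (mat_poly m q A $$ (i, j)) \<le> c"
proof -
  have m: "0 < m" using ij by simp
  define N where "N = mat_opnorm m (mat_poly m q A)"
  have "N \<le> c"
  proof (cases "q * q - [:N\<^sup>2:] = 0")
    case False
    then show ?thesis using mat_opnorm_attained[OF sym m N_def False] bd by auto
  next
    case True
    define N1 where "N1 = mat_opnorm m (mat_poly m [:0, 1:] A)"
    have "[:0, 1:] * [:0, 1:] - [:N1\<^sup>2:] \<noteq> (0 :: real poly)" by simp
    then obtain t where t: "complex_of_real t \<in> mat_spectrum m A"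
      using mat_opnorm_attained[OF sym m N1_def] by blast
    have "(poly q t)\<^sup>2 = N\<^sup>2"
      using arg_cong[OF True, of "\<lambda>r. poly r t"] by (simp add: power2_eq_square)
    then have "\<bar>poly q t\<bar> = N"
      by (metis N_def mat_opnorm_nonneg abs_of_nonneg power2_eq_iff_nonneg power2_abs abs_ge_zero)
    with bd[OF t] show ?thesis by simp
  qed
  moreover have "norm (mat_poly m q A $$ (i, j)) \<le> N"
    unfolding N_def
    by (rule norm_entry_le_act[OF mat_opnorm_nonneg vnorm_mat_act_le_opnorm ij])
  ultimately show ?thesis by simp
qed


section \<open>The Neumann series and the spectrum near the unit\<close>

lemma neumann_inverse:
  fixes E :: "'h::chilbert_space cop mat"
  assumes E: "E \<in> carrier_mat m m" and small: "mnorm m E < 1"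
  shows "\<exists>G \<in> carrier_mat m m. (1\<^sub>m m - E) * G = 1\<^sub>m m \<and> G * (1\<^sub>m m - E) = 1\<^sub>m m"
proof -
  define G where "G = mat m m (\<lambda>ij. suminf (\<lambda>k. (E ^\<^sub>m k) $$ ij))"
  have G: "G \<in> carrier_mat m m" by (simp add: G_def)
  have sums: "(\<lambda>k. (E ^\<^sub>m k) $$ (i, j)) sums G $$ (i, j)" if "i < m" "j < m" for i j
  proof -
    have "summable (\<lambda>k. (E ^\<^sub>m k) $$ (i, j))"
      by (rule summable_comparison_test'[of "\<lambda>k. mnorm m E ^ k" 0])
        (use small norm_entry_pow[OF E that] in \<open>auto intro: summable_geometric\<close>)
    then show ?thesis using that by (simp add: G_def summable_sums)
  qed
  have shift: "(\<lambda>k. (E ^\<^sub>m Suc k) $$ (i, j)) sums (G $$ (i, j) - 1\<^sub>m m $$ (i, j))"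
    if "i < m" "j < m" for i j
    using sums[OF that] that E by (subst sums_Suc_iff) (simp del: pow_mat.simps add: pow_mat.simps(1))
  have "(E * G) $$ (i, j) = G $$ (i, j) - 1\<^sub>m m $$ (i, j)" if ij: "i < m" "j < m" for i j
  proof (rule sums_unique2)
    have "(\<lambda>k. \<Sum>l<m. E $$ (i, l) * (E ^\<^sub>m k) $$ (l, j)) sums (\<Sum>l<m. E $$ (i, l) * G $$ (l, j))"
      by (intro sums_sum sums_mult sums) (use ij in auto)
    then show "(\<lambda>k. (E ^\<^sub>m Suc k) $$ (i, j)) sums (E * G) $$ (i, j)"
      using E G ij by (simp add: mat_pow_Suc_left mat_mult_index[where m = m]
          del: pow_mat.simps index_mult_mat(1))
  qed (rule shift[OF ij])
  moreover have "(G * E) $$ (i, j) = G $$ (i, j) - 1\<^sub>m m $$ (i, j)" if ij: "i < m" "j < m" for i j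
  proof (rule sums_unique2)
    have "(\<lambda>k. \<Sum>l<m. (E ^\<^sub>m k) $$ (i, l) * E $$ (l, j)) sums (\<Sum>l<m. G $$ (i, l) * E $$ (l, j))"
      by (intro sums_sum sums_mult2 sums) (use ij in auto)
    then show "(\<lambda>k. (E ^\<^sub>m Suc k) $$ (i, j)) sums (G * E) $$ (i, j)"
      using E G ij by (simp add: mat_mult_index[where m = m] del: index_mult_mat(1))
  qed (rule shift[OF ij])
  moreover have "(1\<^sub>m m - E) * G = G - E * G" "G * (1\<^sub>m m - E) = G - G * E"
    using E G by (simp_all add: minus_mult_distrib_mat[where nr = m and n = m and nc = m]
        mult_minus_distrib_mat[where nr = m and n = m and nc = m]
        left_mult_one_mat[where nr = m and nc = m] right_mult_one_mat[where nr = m and nc = m])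
  ultimately have "(1\<^sub>m m - E) * G = 1\<^sub>m m" "G * (1\<^sub>m m - E) = 1\<^sub>m m"
    using E G by (auto intro!: mat_eqI[where m = m] simp: mat_index simp del: index_mult_mat(1))
  then show ?thesis using G by blast
qed

text \<open>
  For \<open>t\<close> outside the interval, \<open>A - t = (1 - t) (1 - E)\<close> with \<open>E = (A - 1) / (t - 1)\<close> of norm less than
  \<open>1\<close>, which a Neumann series inverts.
\<close>

lemma mat_spectrum_near_one:
  fixes A :: "'h::chilbert_space cop mat"
  assumes A: "A \<in> carrier_mat m m" and t: "complex_of_real t \<in> mat_spectrum m A"
  shows "t \<in> {1 - mnorm m (A - 1\<^sub>m m) .. 1 + mnorm m (A - 1\<^sub>m m)}"
proof (rule ccontr)
  assume "\<not> ?thesis"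
  then have far: "mnorm m (A - 1\<^sub>m m) < \<bar>t - 1\<bar>" by auto
  have t1: "t \<noteq> 1"
  proof
    assume "t = 1"
    then show False using far mnorm_nonneg[of m "A - 1\<^sub>m m"] by linarith
  qed
  define s where "s = complex_of_real (1 / (t - 1))"
  define E where "E = mat_scaleC s (A - 1\<^sub>m m)"
  have E: "E \<in> carrier_mat m m" using A by (simp add: E_def)
  have s: "cmod s = 1 / \<bar>t - 1\<bar>" by (simp only: s_def norm_of_real) simp
  have "mnorm m E \<le> cmod s * mnorm m (A - 1\<^sub>m m)" unfolding E_def by (rule mnorm_scaleC) simp
  also have "\<dots> < 1" using far t1 unfolding s by (simp add: field_simps)
  finally obtain G where G: "G \<in> carrier_mat m m"
    and inv: "(1\<^sub>m m - E) * G = 1\<^sub>m m" "G * (1\<^sub>m m - E) = 1\<^sub>m m"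
    using neumann_inverse[OF E] by blast
  define c where "c = complex_of_real (1 - t)"
  have c: "c \<noteq> 0" "c * s = -1" using t1 by (auto simp: c_def s_def field_simps)
  have eq: "A - mat_scaleC (complex_of_real t) (1\<^sub>m m) = mat_scaleC c (1\<^sub>m m - E)"
  proof (rule mat_eqI[where m = m])
    fix i j assume ij: "i < m" "j < m"
    have "mat_scaleC c (1\<^sub>m m - E) $$ (i, j) = c *\<^sub>C (1\<^sub>m m $$ (i, j) - E $$ (i, j))"
      using ij E by (simp add: mat_index[where m = m])
    also have "\<dots> = c *\<^sub>C 1\<^sub>m m $$ (i, j) - (c * s) *\<^sub>C (A $$ (i, j) - 1\<^sub>m m $$ (i, j))"
      using ij A
      by (simp add: E_def cop_scaleC_diff_right mat_index[where m = m])
    also have "\<dots> = (A - mat_scaleC (complex_of_real t) (1\<^sub>m m)) $$ (i, j)"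
      using ij A c(2) cop_scaleC_add_left[of 1 "- complex_of_real t" "1 :: 'h cop"]
      by (simp add: mat_index[where m = m] cop_scaleC_minus_left c_def)
    finally show "(A - mat_scaleC (complex_of_real t) (1\<^sub>m m)) $$ (i, j) = mat_scaleC c (1\<^sub>m m - E) $$ (i, j)"
      by simp
  qed (use A E in auto)
  have cG: "mat_scaleC (1 / c) G \<in> carrier_mat m m" using G by simp
  have oneE: "1\<^sub>m m - E \<in> carrier_mat m m" using E by simp
  have "mat_scaleC c (1\<^sub>m m - E) * mat_scaleC (1 / c) G = 1\<^sub>m m"
    "mat_scaleC (1 / c) G * mat_scaleC c (1\<^sub>m m - E) = 1\<^sub>m m"
    using c(1) inv G oneE
    by (simp_all add: mat_scaleC_mult[where m = m] mat_scaleC_scaleC mat_scaleC_one)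
  moreover have "mat_scaleC c (1\<^sub>m m - E) \<in> carrier_mat m m" using oneE by simp
  ultimately have "invertible_mat (mat_scaleC c (1\<^sub>m m - E))"
    unfolding invertible_mat_def inverts_mat_def using cG
    by (intro conjI exI[of _ "mat_scaleC (1 / c) G"]) (simp_all only: carrier_matD square_mat.simps)
  then show False using t by (simp add: mat_spectrum_def eq)
qed


section \<open>Functional calculus by polynomial approximation\<close>

lemma mat_poly_carrier [simp]: "mat_poly m q A \<in> carrier_mat m m"
  by (simp add: mat_poly_def)

lemma mat_poly_index:
  assumes "A \<in> carrier_mat m m" "degree q \<le> n" "i < m" "j < m"
  shows "mat_poly m q A $$ (i, j) = (\<Sum>k\<le>n. coeff q k *\<^sub>R (A ^\<^sub>m k) $$ (i, j))"
  unfolding mat_poly_conv_cpoly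
  using assms by (subst mat_cpoly_index[where n = n])
    (auto simp: degree_map_poly coeff_map_poly cop_scaleR_scaleC)

lemma mat_poly_diff:
  assumes A: "A \<in> carrier_mat m m" and ij: "i < m" "j < m"
  shows "mat_poly m (q - r) A $$ (i, j) = mat_poly m q A $$ (i, j) - mat_poly m r A $$ (i, j)"
proof -
  define n where "n = max (degree q) (degree r)"
  have n: "degree q \<le> n" "degree r \<le> n" "degree (q - r) \<le> n"
    by (auto simp: n_def degree_diff_le)
  show ?thesis
    unfolding mat_poly_index[OF A n(1) ij] mat_poly_index[OF A n(2) ij] mat_poly_index[OF A n(3) ij]
    by (simp add: scaleR_diff_left sum_subtractf)
qed

text \<open>
  Square root and \<open>p\<close>-th power are taken one after the other, so the matrix to which the second
  calculus applies is itself only known as a limit.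
\<close>

lemma mat_poly_tendsto:
  assumes X: "\<And>k. X k \<in> carrier_mat m m" and R: "R \<in> carrier_mat m m"
    and lim: "\<And>i j. i < m \<Longrightarrow> j < m \<Longrightarrow> (\<lambda>k. X k $$ (i, j)) \<longlonglongrightarrow> R $$ (i, j)"
    and ij: "i < m" "j < m"
  shows "(\<lambda>k. mat_poly m q (X k) $$ (i, j)) \<longlonglongrightarrow> mat_poly m q R $$ (i, j)"
proof -
  have pow: "(\<lambda>k. (X k ^\<^sub>m n) $$ (i, j)) \<longlonglongrightarrow> (R ^\<^sub>m n) $$ (i, j)" if "i < m" "j < m" for i j n
    using that
  proof (induction n arbitrary: i j)
    case 0
    have "(X k ^\<^sub>m 0) $$ (i, j) = (R ^\<^sub>m 0) $$ (i, j)" for k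
      using X[of k] R by auto
    then show ?case by simp
  next
    case (Suc n)
    have "(\<lambda>k. \<Sum>l<m. (X k ^\<^sub>m n) $$ (i, l) * X k $$ (l, j)) \<longlonglongrightarrow>
        (\<Sum>l<m. (R ^\<^sub>m n) $$ (i, l) * R $$ (l, j))"
      by (intro tendsto_sum tendsto_mult Suc.IH lim) (use Suc.prems in auto)
    then show ?case
      using X R Suc.prems by (simp add: mat_mult_index[where m = m] del: index_mult_mat(1))
  qed
  show ?thesis
    unfolding mat_poly_index[OF X order_refl ij] mat_poly_index[OF R order_refl ij]
    by (intro tendsto_sum tendsto_scaleR tendsto_const pow ij)
qed

text \<open>
  By the spectral bound, two polynomial sequences with the same uniform limit on the spectrum give
  matrix sequences with the same limit; one sequence is thus enough to determine \<open>f(A)\<close>.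
\<close>

lemma mat_cfc_eqI:
  assumes sym: "symmetric_mat m A" and R: "R \<in> carrier_mat m m"
    and ul: "uniform_limit {t. complex_of_real t \<in> mat_spectrum m A} (\<lambda>k. poly (g k)) f sequentially"
    and lim: "\<And>i j. i < m \<Longrightarrow> j < m \<Longrightarrow> (\<lambda>k. mat_poly m (g k) A $$ (i, j)) \<longlonglongrightarrow> R $$ (i, j)"
  shows "mat_cfc m f A = R"
  unfolding mat_cfc_def
proof (rule the_equality)
  let ?S = "{t. complex_of_real t \<in> mat_spectrum m A}"
  have A: "A \<in> carrier_mat m m" using sym by (rule symmetric_mat_carrier)
  have "(\<lambda>k. mat_poly m (q k) A $$ (i, j)) \<longlonglongrightarrow> R $$ (i, j)"
    if q: "uniform_limit ?S (\<lambda>k. poly (q k)) f sequentially" and ij: "i < m" "j < m" for q i j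
  proof -
    have "uniform_limit ?S (\<lambda>k t. poly (q k) t - poly (g k) t) (\<lambda>t. f t - f t) sequentially"
      by (rule uniform_limit_minus[OF q ul])
    moreover have "(\<lambda>k t. poly (q k) t - poly (g k) t) = (\<lambda>k. poly (q k - g k))" by (intro ext) simp
    ultimately have z: "uniform_limit ?S (\<lambda>k. poly (q k - g k)) (\<lambda>t. 0) sequentially" by simp
    have "(\<lambda>k. mat_poly m (q k) A $$ (i, j) - mat_poly m (g k) A $$ (i, j)) \<longlonglongrightarrow> 0"
    proof (rule tendstoI)
      fix e :: real assume "0 < e"
      then have "\<forall>\<^sub>F k in sequentially. \<forall>t\<in>?S. dist (poly (q k - g k) t) 0 < e / 2"
        using uniform_limitD[OF z, of "e / 2"] by simp
      then show "\<forall>\<^sub>F k in sequentially. dist (mat_poly m (q k) A $$ (i, j) - mat_poly m (g k) A $$ (i, j)) 0 < e"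
      proof eventually_elim
        case (elim k)
        then have "norm (mat_poly m (q k - g k) A $$ (i, j)) \<le> e / 2"
          using \<open>0 < e\<close> by (intro mat_poly_entry_bound[OF sym _ _ ij]) (auto simp: dist_real_def less_imp_le)
        then show ?case using \<open>0 < e\<close> by (simp add: mat_poly_diff[OF A ij] dist_norm)
      qed
    qed
    from tendsto_add[OF this lim[OF ij]] show ?thesis by simp
  qed
  then show "R \<in> carrier_mat m m \<and> (\<forall>q. uniform_limit ?S (\<lambda>k. poly (q k)) f sequentially \<longrightarrow>
      (\<forall>i<m. \<forall>j<m. (\<lambda>k. mat_poly m (q k) A $$ (i, j)) \<longlonglongrightarrow> R $$ (i, j)))"
    using R by blast
next
  fix R' assume R': "R' \<in> carrier_mat m m \<and> (\<forall>q. uniform_limit {t. complex_of_real t \<in> mat_spectrum m A}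
      (\<lambda>k. poly (q k)) f sequentially \<longrightarrow>
      (\<forall>i<m. \<forall>j<m. (\<lambda>k. mat_poly m (q k) A $$ (i, j)) \<longlonglongrightarrow> R' $$ (i, j)))"
  then show "R' = R"
    by (intro mat_eqI[of R' m R] R) (use ul lim LIMSEQ_unique in blast)+
qed


section \<open>Binomial series\<close>

text \<open>
  Partial sums of the binomial series of \<open>t\<^sup>a\<close> around \<open>t = 1\<close>.
\<close>

definition binomial_poly :: "real \<Rightarrow> nat \<Rightarrow> real poly" where
  "binomial_poly a n = (\<Sum>k<n. Polynomial.smult (a gchoose k) ([:-1, 1:] ^ k))"

lemma poly_binomial_poly: "poly (binomial_poly a n) t = (\<Sum>k<n. (a gchoose k) * (t - 1) ^ k)"
  by (simp add: binomial_poly_def poly_sum)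

lemma summable_abs_gbinomial:
  fixes a r :: real
  assumes "0 \<le> r" "r < 1"
  shows "summable (\<lambda>k. \<bar>a gchoose k\<bar> * r ^ k)"
proof -
  have "summable (\<lambda>k. (a gchoose k) * ((1 + r) / 2) ^ k)"
    using gen_binomial_real[of "(1 + r) / 2" a] assms by (intro sums_summable) auto
  then have "summable (\<lambda>k. norm ((a gchoose k) * r ^ k))"
    by (rule powser_insidea) (use assms in auto)
  then show ?thesis using assms by (simp add: abs_mult)
qed

lemma uniform_limit_binomial_poly:
  assumes "0 \<le> r" "r < 1"
  shows "uniform_limit {1 - r .. 1 + r} (\<lambda>n. poly (binomial_poly a n)) (\<lambda>t. t powr a) sequentially"
proof -
  have "uniform_limit {1 - r .. 1 + r} (\<lambda>n t. \<Sum>k<n. (a gchoose k) * (t - 1) ^ k)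
      (\<lambda>t. suminf (\<lambda>k. (a gchoose k) * (t - 1) ^ k)) sequentially"
  proof (rule Weierstrass_m_test)
    fix n t assume "t \<in> {1 - r .. 1 + r}"
    then have "\<bar>t - 1\<bar> \<le> r" by auto
    then show "norm ((a gchoose n) * (t - 1) ^ n) \<le> \<bar>a gchoose n\<bar> * r ^ n"
      by (auto simp: abs_mult power_abs intro!: mult_left_mono power_mono)
  qed (rule summable_abs_gbinomial[OF assms])
  moreover have "suminf (\<lambda>k. (a gchoose k) * (t - 1) ^ k) = t powr a" if "t \<in> {1 - r .. 1 + r}" for t
    using gen_binomial_real[of "t - 1" a] that assms by (auto simp: sums_iff)
  ultimately show ?thesis
    unfolding poly_binomial_poly[abs_def] by (subst uniform_limit_cong') auto
qed

text \<open>
  The matrix \<open>(1 + D)\<^sup>a\<close> for small \<open>D\<close>.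
\<close>

definition binomial_series :: "nat \<Rightarrow> real \<Rightarrow> 'h::chilbert_space cop mat \<Rightarrow> 'h cop mat" where
  "binomial_series m a D = mat m m (\<lambda>ij. suminf (\<lambda>k. (a gchoose k) *\<^sub>R (D ^\<^sub>m k) $$ ij))"

lemma binomial_series_carrier [simp]: "binomial_series m a D \<in> carrier_mat m m"
  by (simp add: binomial_series_def)

lemma binomial_series_sums:
  assumes D: "D \<in> carrier_mat m m" "mnorm m D < 1" and ij: "i < m" "j < m"
  shows "(\<lambda>k. (a gchoose k) *\<^sub>R (D ^\<^sub>m k) $$ (i, j)) sums binomial_series m a D $$ (i, j)"
proof -
  have "summable (\<lambda>k. (a gchoose k) *\<^sub>R (D ^\<^sub>m k) $$ (i, j))"
    by (rule summable_comparison_test'[OF summable_abs_gbinomial[of "mnorm m D" a], of 0])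
      (use D norm_entry_pow[OF D(1) ij] in \<open>auto intro: mult_left_mono\<close>)
  then show ?thesis using ij by (simp add: binomial_series_def summable_sums)
qed

lemma map_poly_of_real_hom:
  "map_poly complex_of_real (q + r) = map_poly of_real q + map_poly of_real r"
  "map_poly complex_of_real (q * r) = map_poly of_real q * map_poly of_real r"
  by (simp_all add: poly_eq_iff coeff_map_poly coeff_mult)

lemma map_poly_of_real_pcompose:
  "map_poly complex_of_real (pcompose q r) = pcompose (map_poly of_real q) (map_poly of_real r)"
proof (induction q)
  case (pCons a q)
  then show ?case
    by (simp only: pcompose_pCons map_poly_of_real_hom map_poly_pCons[of complex_of_real, OF of_real_0])
      (simp add: map_poly_pCons)
qed simp

lemma mat_poly_binomial_poly:
  fixes A :: "'h::chilbert_space cop mat"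
  assumes A: "A \<in> carrier_mat m m" and ij: "i < m" "j < m"
  shows "mat_poly m (binomial_poly a n) A $$ (i, j) = (\<Sum>k<n. (a gchoose k) *\<^sub>R ((A - 1\<^sub>m m) ^\<^sub>m k) $$ (i, j))"
proof -
  have lin: "mat_cpoly m [:-1, 1:] A = A - 1\<^sub>m m"
    by (rule mat_eqI[where m = m])
      (use A in \<open>auto simp: mat_cpoly_linear mat_index[where m = m] cop_scaleC_minus_left\<close>)
  have "mat_cpoly m (1 :: complex poly) A = 1\<^sub>m m"
    using mat_cpoly_const[OF A, of 1] by (simp add: one_pCons mat_scaleC_one)
  then have pow: "mat_cpoly m ([:-1, 1:] ^ k) A = (A - 1\<^sub>m m) ^\<^sub>m k" for k
  proof (induction k)
    case (Suc k)
    then show ?case by (simp only: power_Suc2 mat_cpoly_mult[OF A] lin pow_mat.simps)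
  qed (use A in simp)
  note map_add = map_poly_of_real_hom(1) and map_mult = map_poly_of_real_hom(2)
  have map_pow: "map_poly complex_of_real ([:-1, 1:] ^ k) = [:-1, 1:] ^ k" for k
    by (induction k) (simp_all only: power_Suc power_0 map_mult, simp_all add: map_poly_pCons)
  have map_smult: "map_poly complex_of_real (Polynomial.smult c q) = Polynomial.smult (of_real c) (map_poly of_real q)" for c q
    by (simp add: poly_eq_iff coeff_map_poly)
  show ?thesis
  proof (induction n)
    case 0
    then show ?case using A ij by (simp add: binomial_poly_def mat_poly_conv_cpoly mat_cpoly_0)
  next
    case (Suc n)
    have "binomial_poly a (Suc n) = binomial_poly a n + Polynomial.smult (a gchoose n) ([:-1, 1:] ^ n)"
      by (simp add: binomial_poly_def)
    then have "mat_poly m (binomial_poly a (Suc n)) A $$ (i, j) = mat_poly m (binomial_poly a n) A $$ (i, j)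
        + complex_of_real (a gchoose n) *\<^sub>C ((A - 1\<^sub>m m) ^\<^sub>m n) $$ (i, j)"
      using A ij by (simp add: mat_poly_conv_cpoly map_add map_smult map_pow mat_cpoly_add mat_cpoly_smult
          pow mat_index[where m = m])
    then show ?case using Suc by (simp add: cop_scaleR_scaleC)
  qed
qed

lemma mat_poly_binomial_tendsto:
  fixes A :: "'h::chilbert_space cop mat"
  assumes A: "A \<in> carrier_mat m m" "mnorm m (A - 1\<^sub>m m) < 1" and ij: "i < m" "j < m"
  shows "(\<lambda>n. mat_poly m (binomial_poly a n) A $$ (i, j)) \<longlonglongrightarrow> binomial_series m a (A - 1\<^sub>m m) $$ (i, j)"
  using binomial_series_sums[of "A - 1\<^sub>m m" m i j a] A ij
  by (simp add: mat_poly_binomial_poly sums_def)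

lemma spectrum_subset:
  fixes A :: "'h::chilbert_space cop mat"
  assumes "A \<in> carrier_mat m m" "mnorm m (A - 1\<^sub>m m) \<le> r"
  shows "{t. complex_of_real t \<in> mat_spectrum m A} \<subseteq> {1 - r .. 1 + r}"
  using mat_spectrum_near_one[OF assms(1)] assms(2) by force

lemma abs_half_gbinomial_le_1: "\<bar>(1/2 :: real) gchoose k\<bar> \<le> 1"
proof (induction k)
  case (Suc k)
  have "((1/2 :: real) gchoose Suc k) = (1/2 - real k) / (real k + 1) * (1/2 gchoose k)"
    using gbinomial_mult_1[of "1/2 :: real" k] by (simp add: field_simps)
  also have "\<bar>\<dots>\<bar> \<le> 1 * 1"
    unfolding abs_mult using Suc by (intro mult_mono) (auto simp: field_simps abs_le_iff)
  finally show ?case by simp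
qed simp

text \<open>The geometric series \<open>r + r\<^sup>2 + \<dots>\<close> with \<open>r = 1/4\<close> gives the constant \<open>1/3\<close>.\<close>

lemma mnorm_sqrt_series:
  fixes D :: "'h::chilbert_space cop mat"
  assumes D: "D \<in> carrier_mat m m" "mnorm m D \<le> 1/4"
  shows "mnorm m (binomial_series m (1/2) D - 1\<^sub>m m) \<le> 1/3"
proof -
  define c where "c k = ((1/2 :: real) gchoose Suc k)" for k
  have lim: "(\<lambda>n. \<Sum>k<n. c k *\<^sub>R (D ^\<^sub>m Suc k) $$ (i, j)) \<longlonglongrightarrow> (binomial_series m (1/2) D - 1\<^sub>m m) $$ (i, j)"
    if ij: "i < m" "j < m" for i j
  proof -
    have "(\<lambda>k. c k *\<^sub>R (D ^\<^sub>m Suc k) $$ (i, j)) sums (binomial_series m (1/2) D $$ (i, j) - 1\<^sub>m m $$ (i, j))"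
      unfolding c_def
      using binomial_series_sums[of D m i j "1/2"] D ij
      by (subst sums_Suc_iff[where f = "\<lambda>k. (1/2 gchoose k) *\<^sub>R (D ^\<^sub>m k) $$ (i, j)"]) auto
    then show ?thesis using ij by (simp add: sums_def del: pow_mat.simps)
  qed
  have "(\<lambda>n. \<Sum>i<m. \<Sum>j<m. norm (\<Sum>k<n. c k *\<^sub>R (D ^\<^sub>m Suc k) $$ (i, j))) \<longlonglongrightarrow>
      mnorm m (binomial_series m (1/2) D - 1\<^sub>m m)"
    unfolding mnorm_def by (intro tendsto_sum tendsto_norm lim) auto
  moreover have "(\<Sum>i<m. \<Sum>j<m. norm (\<Sum>k<n. c k *\<^sub>R (D ^\<^sub>m Suc k) $$ (i, j))) \<le> 1/3" for n
  proof -
    have "(\<Sum>i<m. \<Sum>j<m. norm (\<Sum>k<n. c k *\<^sub>R (D ^\<^sub>m Suc k) $$ (i, j)))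
        \<le> (\<Sum>i<m. \<Sum>j<m. \<Sum>k<n. norm ((D ^\<^sub>m Suc k) $$ (i, j)))"
    proof (intro sum_mono sum_norm_le)
      fix i j k
      have "\<bar>c k\<bar> * norm ((D ^\<^sub>m Suc k) $$ (i, j)) \<le> 1 * norm ((D ^\<^sub>m Suc k) $$ (i, j))"
        unfolding c_def by (intro mult_right_mono abs_half_gbinomial_le_1) simp
      then show "norm (c k *\<^sub>R (D ^\<^sub>m Suc k) $$ (i, j)) \<le> norm ((D ^\<^sub>m Suc k) $$ (i, j))" by simp
    qed
    also have "\<dots> = (\<Sum>k<n. mnorm m (D ^\<^sub>m Suc k))"
      unfolding mnorm_def by (simp only: sum.swap[where B = "{..<n}"])
    also have "\<dots> \<le> (\<Sum>k<n. (1/4) ^ Suc k)"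
      by (intro sum_mono order_trans[OF mnorm_pow[OF D(1)]] power_mono D(2)) simp
    also have "\<dots> = (1/4) * (\<Sum>k<n. (1/4 :: real) ^ k)" by (simp add: sum_distrib_left)
    also have "(\<Sum>k<n. (1/4 :: real) ^ k) \<le> 4/3" proof -
      have "(\<Sum>k<n. (1/4 :: real) ^ k) = (1 - (1/4) ^ n) / (1 - 1/4)" by (subst sum_gp_strict) simp
      then show ?thesis by simp
    qed
    finally show ?thesis by simp
  qed
  ultimately show ?thesis by (intro LIMSEQ_le_const2) auto
qed

lemma symmetric_binomial_series:
  assumes D: "symmetric_mat m D" "mnorm m D < 1"
  shows "symmetric_mat m (binomial_series m a D)"
proof -
  have car: "D \<in> carrier_mat m m" using D(1) by (rule symmetric_mat_carrier)
  have "mat_adj (binomial_series m a D) = binomial_series m a D"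
  proof (rule mat_eqI[where m = m])
    fix i j assume ij: "i < m" "j < m"
    have pow: "cop_adj ((D ^\<^sub>m k) $$ (j, i)) = (D ^\<^sub>m k) $$ (i, j)" for k
      using mat_adj_index[OF ij mat_pow_carrier[OF car], of k] mat_adj_pow[OF car, of k] D(1)
      by (simp add: symmetric_mat_iff[OF car])
    have "(\<lambda>k. cop_adj ((a gchoose k) *\<^sub>R (D ^\<^sub>m k) $$ (j, i))) sums cop_adj (binomial_series m a D $$ (j, i))"
      by (rule bounded_linear.sums[OF bounded_linear_cop_adj]) (rule binomial_series_sums[OF car D(2) ij(2,1)])
    then have "(\<lambda>k. (a gchoose k) *\<^sub>R (D ^\<^sub>m k) $$ (i, j)) sums cop_adj (binomial_series m a D $$ (j, i))"
      by (simp add: pow linear_cmul[OF bounded_linear.linear[OF bounded_linear_cop_adj]])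
    then have "cop_adj (binomial_series m a D $$ (j, i)) = binomial_series m a D $$ (i, j)"
      using binomial_series_sums[OF car D(2) ij] by (rule sums_unique2)
    then show "mat_adj (binomial_series m a D) $$ (i, j) = binomial_series m a D $$ (i, j)"
      using ij by (simp add: mat_index)
  qed auto
  then show ?thesis by (simp add: symmetric_mat_iff)
qed

text \<open>
  Composing the two functional calculi in the definition of \<open>|X|\<^sup>p\<close> is legitimate because
  polynomials \<open>g\<close> close to \<open>u \<mapsto> u\<^sup>p\<close> and \<open>b\<close> close to the square root make \<open>g \<circ> b\<close> uniformly close
  to \<open>t \<mapsto> t\<^bsup>p/2\<^esup>\<close> on the spectrum of \<open>X\<^sup>* X\<close>, where the spectral bound applies.
\<close>

lemma mat_abs_power_eq_binomial_series:
  fixes X :: "'h::chilbert_space cop mat"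
  assumes X: "X \<in> carrier_mat m m" and small: "mnorm m (mat_adj X * X - 1\<^sub>m m) \<le> 1/4"
  shows "mat_abs_power m p X = binomial_series m (p / 2) (mat_adj X * X - 1\<^sub>m m)"
proof -
  define A where "A = mat_adj X * X"
  define D where "D = A - 1\<^sub>m m"
  define R where "R = binomial_series m (1/2) D"
  define T where "T = binomial_series m (p/2) D"
  define S where "S = {t. complex_of_real t \<in> mat_spectrum m A}"
  have A: "A \<in> carrier_mat m m" using X by (simp add: A_def)
  have D: "D \<in> carrier_mat m m" "mnorm m D \<le> 1/4" using A small by (simp_all add: D_def A_def)
  have R: "R \<in> carrier_mat m m" and T: "T \<in> carrier_mat m m" by (simp_all add: R_def T_def)
  have adjA: "mat_adj A = A" using X by (simp add: A_def mat_adj_mult[where m = m] mat_adj_adj)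
  then have symA: "symmetric_mat m A" using A by (simp add: symmetric_mat_iff)
  have "mat_adj D = D"
  proof (rule mat_eqI[where m = m])
    fix i j assume ij: "i < m" "j < m"
    have "cop_adj (A $$ (j, i)) = A $$ (i, j)" using adjA mat_adj_index[OF ij A] by simp
    then show "mat_adj D $$ (i, j) = D $$ (i, j)"
      using ij D A by (auto simp: mat_index D_def cop_adj_diff)
  qed (use D in auto)
  then have symD: "symmetric_mat m D" using D by (simp add: symmetric_mat_iff)
  have symR: "symmetric_mat m R" unfolding R_def using D by (intro symmetric_binomial_series symD) simp
  have S: "S \<subseteq> {1 - 1/4 .. 1 + 1/4}" unfolding S_def by (rule spectrum_subset) (use A D in \<open>auto simp: D_def\<close>)
  have D1: "mnorm m (A - 1\<^sub>m m) < 1" using D by (simp add: D_def)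
  have sqrt_lim: "uniform_limit S (\<lambda>n. poly (binomial_poly (1/2) n)) sqrt sequentially"
  proof -
    have "uniform_limit S (\<lambda>n. poly (binomial_poly (1/2) n)) (\<lambda>t. t powr (1/2)) sequentially"
      by (rule uniform_limit_on_subset[OF uniform_limit_binomial_poly[of "1/4"] S]) auto
    moreover have "t powr (1/2) = sqrt t" if "t \<in> S" for t
      using S that by (intro powr_half_sqrt) auto
    ultimately show ?thesis by (subst (asm) uniform_limit_cong'[of S]) auto
  qed
  have abs_eq: "mat_abs m X = R"
    unfolding mat_abs_def A_def[symmetric]
    by (rule mat_cfc_eqI[OF symA R, of "binomial_poly (1/2)"])
      (use sqrt_lim mat_poly_binomial_tendsto[OF A D1] in \<open>auto simp: S_def R_def D_def\<close>)
  have R13: "mnorm m (R - 1\<^sub>m m) \<le> 1/3" unfolding R_def by (rule mnorm_sqrt_series[OF D])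
  have pow_lim: "uniform_limit {1 - 1/3 .. 1 + 1/3} (\<lambda>n. poly (binomial_poly p n)) (\<lambda>t. t powr p) sequentially"
    by (rule uniform_limit_binomial_poly) auto
  have sqrt_range: "sqrt t \<in> {1 - 1/3 .. 1 + 1/3}" if "t \<in> S" for t
  proof -
    have t: "(2/3)\<^sup>2 \<le> t" "t \<le> (4/3)\<^sup>2" using S that by (auto simp: power2_eq_square)
    have "2/3 \<le> sqrt t" using t(1) by (rule real_le_rsqrt)
    moreover have "sqrt t \<le> 4/3" using t(2) by (intro real_le_lsqrt) auto
    ultimately show ?thesis by auto
  qed
  have "mat_cfc m (\<lambda>t. t powr p) R = T"
  proof (rule mat_cfc_eqI[OF symR T, of "binomial_poly p"])
    show "uniform_limit {t. complex_of_real t \<in> mat_spectrum m R} (\<lambda>n. poly (binomial_poly p n))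
        (\<lambda>t. t powr p) sequentially"
      by (rule uniform_limit_on_subset[OF pow_lim spectrum_subset[OF R R13]])
    fix i j assume ij: "i < m" "j < m"
    show "(\<lambda>n. mat_poly m (binomial_poly p n) R $$ (i, j)) \<longlonglongrightarrow> T $$ (i, j)"
    proof (rule metric_LIMSEQ_I)
      fix e :: real assume "0 < e"
      then have "\<forall>\<^sub>F n in sequentially. \<forall>u\<in>{1 - 1/3 .. 1 + 1/3}. dist (poly (binomial_poly p n) u) (u powr p) < e / 4"
        using uniform_limitD[OF pow_lim, of "e / 4"] by simp
      then obtain n0 where n0: "\<And>n u. n \<ge> n0 \<Longrightarrow> u \<in> {1 - 1/3 .. 1 + 1/3} \<Longrightarrow>
          dist (poly (binomial_poly p n) u) (u powr p) < e / 4"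
        unfolding eventually_sequentially by blast
      have "dist (mat_poly m (binomial_poly p n) R $$ (i, j)) (T $$ (i, j)) < e" if n: "n \<ge> n0" for n
      proof -
        define g where "g = binomial_poly p n"
        define b where "b = binomial_poly (1/2)"
        define h where "h k = pcompose g (b k) - binomial_poly (p/2) k" for k
        have b_lim: "\<forall>\<^sub>F k in sequentially. \<forall>t\<in>S. poly (b k) t \<in> {0..2}"
        proof -
          have "\<forall>\<^sub>F k in sequentially. \<forall>t\<in>S. dist (poly (b k) t) (sqrt t) < 1/3"
            using uniform_limitD[OF sqrt_lim, of "1/3"] by (simp add: b_def)
          then show ?thesis
          proof eventually_elim
            case (elim k)
            show ?case
            proof
              fix t assume t: "t \<in> S"
              with elim have "\<bar>poly (b k) t - sqrt t\<bar> < 1/3" by (simp add: dist_real_def)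
              then show "poly (b k) t \<in> {0..2}" using sqrt_range[OF t] unfolding atLeastAtMost_iff by linarith
            qed
          qed
        qed
        have "uniform_limit S (\<lambda>k t. poly g (poly (b k) t)) (\<lambda>t. poly g (sqrt t)) sequentially"
        proof (rule uniform_limit_compose_uniformly_continuous_on[where g = "\<lambda>k. poly (b k)"
              and g' = sqrt and f = "poly g" and B = "{0..2}"])
          show "uniform_limit S (\<lambda>k. poly (b k)) sqrt sequentially" using sqrt_lim by (simp add: b_def)
          show "uniformly_continuous_on {0..2} (poly g)"
            by (intro compact_uniformly_continuous continuous_intros) auto
          show "\<forall>\<^sub>F k in sequentially. \<forall>t\<in>S. poly (b k) t \<in> {0..2}" by (rule b_lim)
        qed simp
        then have ev1: "\<forall>\<^sub>F k in sequentially. \<forall>t\<in>S. dist (poly g (poly (b k) t)) (poly g (sqrt t)) < e / 4"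
          by (rule uniform_limitD) (use \<open>0 < e\<close> in simp)
        have "uniform_limit S (\<lambda>k. poly (binomial_poly (p/2) k)) (\<lambda>t. t powr (p/2)) sequentially"
          by (rule uniform_limit_on_subset[OF uniform_limit_binomial_poly[of "1/4"] S]) auto
        then have ev2: "\<forall>\<^sub>F k in sequentially. \<forall>t\<in>S. dist (poly (binomial_poly (p/2) k) t) (t powr (p/2)) < e / 4"
          by (rule uniform_limitD) (use \<open>0 < e\<close> in simp)
        have ev: "\<forall>\<^sub>F k in sequentially. norm (mat_poly m (h k) A $$ (i, j)) \<le> 3 * e / 4"
          using ev1 ev2
        proof eventually_elim
          case (elim k)
          have "\<bar>poly (h k) t\<bar> \<le> 3 * e / 4" if t: "complex_of_real t \<in> mat_spectrum m A" for t
          proof -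
            have tS: "t \<in> S" using t by (simp add: S_def)
            have "sqrt t powr p = t powr (p/2)"
              using S tS by (subst powr_half_sqrt[symmetric]) (auto simp: powr_powr)
            then have "dist (poly g (sqrt t)) (t powr (p/2)) < e / 4"
              using n0[OF n sqrt_range[OF tS]] by (simp add: g_def)
            then show ?thesis using elim tS
              by (simp add: h_def poly_pcompose dist_real_def) (smt (verit, best) field_sum_of_halves)
          qed
          then show ?case using \<open>0 < e\<close> by (intro mat_poly_entry_bound[OF symA _ _ ij]) auto
        qed
        have "(\<lambda>k. mat_poly m g (mat_poly m (b k) A) $$ (i, j)) \<longlonglongrightarrow> mat_poly m g R $$ (i, j)"
          by (rule mat_poly_tendsto[OF _ R _ ij])
            (use mat_poly_binomial_tendsto[OF A D1] in \<open>auto simp: b_def R_def D_def\<close>)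
        moreover have "mat_poly m (pcompose g (b k)) A = mat_poly m g (mat_poly m (b k) A)" for k
          using A by (simp add: mat_poly_conv_cpoly map_poly_of_real_pcompose mat_cpoly_pcompose)
        moreover have "(\<lambda>k. mat_poly m (binomial_poly (p/2) k) A $$ (i, j)) \<longlonglongrightarrow> T $$ (i, j)"
          unfolding T_def D_def by (rule mat_poly_binomial_tendsto[OF A D1 ij])
        ultimately have "(\<lambda>k. mat_poly m (h k) A $$ (i, j)) \<longlonglongrightarrow> mat_poly m g R $$ (i, j) - T $$ (i, j)"
          by (simp add: h_def mat_poly_diff[OF A ij] tendsto_diff)
        then have "(\<lambda>k. norm (mat_poly m (h k) A $$ (i, j))) \<longlonglongrightarrow> norm (mat_poly m g R $$ (i, j) - T $$ (i, j))"
          by (rule tendsto_norm)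
        then have "norm (mat_poly m g R $$ (i, j) - T $$ (i, j)) \<le> 3 * e / 4"
          using ev by (rule tendsto_upperbound) simp
        then show ?thesis using \<open>0 < e\<close> by (simp add: g_def dist_norm)
      qed
      then show "\<exists>no. \<forall>n\<ge>no. dist (mat_poly m (binomial_poly p n) R $$ (i, j)) (T $$ (i, j)) < e" by blast
    qed
  qed
  then show ?thesis by (simp add: mat_abs_power_def abs_eq T_def D_def A_def)
qed


section \<open>The trace of a power series\<close>

context tracial_algebra
begin

definition mats :: "nat \<Rightarrow> 'h cop mat set" where
  "mats m = {A \<in> carrier_mat m m. \<forall>i<m. \<forall>j<m. A $$ (i, j) \<in> M}"

lemma matsD: "A \<in> mats m \<Longrightarrow> A \<in> carrier_mat m m" "A \<in> mats m \<Longrightarrow> i < m \<Longrightarrow> j < m \<Longrightarrow> A $$ (i, j) \<in> M"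
  by (auto simp: mats_def)

lemma mats_one: "1\<^sub>m m \<in> mats m"
  by (auto simp: mats_def M_one M_zero)

lemma mats_add: "A \<in> mats m \<Longrightarrow> B \<in> mats m \<Longrightarrow> A + B \<in> mats m"
  by (auto simp: mats_def mat_index M_add)

lemma mats_diff: "A \<in> mats m \<Longrightarrow> B \<in> mats m \<Longrightarrow> A - B \<in> mats m"
  by (auto simp: mats_def mat_index M_diff)

lemma mats_mult: "A \<in> mats m \<Longrightarrow> B \<in> mats m \<Longrightarrow> A * B \<in> mats m"
  by (auto simp: mats_def mat_mult_index[where m = m] simp del: index_mult_mat(1) intro!: M_sum M_mult)

lemma mats_pow: "A \<in> mats m \<Longrightarrow> A ^\<^sub>m k \<in> mats m"
proof (induction k)
  case 0
  then have "A ^\<^sub>m 0 = 1\<^sub>m m" using matsD(1) by auto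
  then show ?case by (metis mats_one)
qed (auto intro: mats_mult)

lemma mats_adj: "A \<in> mats m \<Longrightarrow> mat_adj A \<in> mats m"
  by (auto simp: mats_def mat_index M_adj)

lemma mats_scaleC: "A \<in> mats m \<Longrightarrow> mat_scaleC c A \<in> mats m"
  by (auto simp: mats_def mat_index M_scaleC)

lemma mats_sum: "(\<And>l. l \<in> I \<Longrightarrow> F l \<in> mats m) \<Longrightarrow> mat_sum m I F \<in> mats m"
  by (auto simp: mats_def mat_index intro!: M_sum)

lemma trace_sum:
  "(\<And>l. l \<in> I \<Longrightarrow> F l \<in> mats m) \<Longrightarrow> mat_trace_state m \<tau> (mat_sum m I F) = (\<Sum>l\<in>I. mat_trace_state m \<tau> (F l))"
  unfolding mat_trace_state_def sum_divide_distrib[symmetric]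
  by (subst sum.swap) (auto simp: mat_index mats_def intro!: sum.cong \<tau>_sum arg_cong2[of _ _ _ _ "(/)"])

lemma trace_scaleC: "A \<in> mats m \<Longrightarrow> mat_trace_state m \<tau> (mat_scaleC c A) = c * mat_trace_state m \<tau> A"
  by (simp add: mat_trace_state_def mat_index mats_def \<tau>_scaleC sum_distrib_left)

lemma trace_one: "0 < m \<Longrightarrow> mat_trace_state m \<tau> (1\<^sub>m m) = 1"
  by (simp add: mat_trace_state_def \<tau>_one)

lemma cmod_trace_le:
  assumes "A \<in> mats m" "0 < m" "\<And>i. i < m \<Longrightarrow> norm (A $$ (i, i)) \<le> b"
  shows "cmod (mat_trace_state m \<tau> A) \<le> 2 * b"
proof -
  have "cmod (\<Sum>i<m. \<tau> (A $$ (i, i))) \<le> (\<Sum>i<m. 2 * b)"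
  proof (rule sum_norm_le)
    fix i assume "i \<in> {..<m}"
    then show "cmod (\<tau> (A $$ (i, i))) \<le> 2 * b"
      using \<tau>_bounded[of "A $$ (i, i)"] assms(3)[of i] matsD(2)[OF assms(1), of i i] by simp
  qed
  then show ?thesis using assms(2) by (simp add: mat_trace_state_def norm_divide divide_simps mult_ac)
qed

lemma cmod_trace_pow_le:
  assumes "D \<in> mats m" "0 < m" "mnorm m D \<le> d"
  shows "cmod (mat_trace_state m \<tau> (D ^\<^sub>m k)) \<le> 2 * d ^ k"
proof (rule cmod_trace_le[OF mats_pow])
  fix i assume "i < m"
  then have "norm ((D ^\<^sub>m k) $$ (i, i)) \<le> mnorm m D ^ k" by (intro norm_entry_pow matsD assms)
  also have "\<dots> \<le> d ^ k" by (intro power_mono assms) simp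
  finally show "norm ((D ^\<^sub>m k) $$ (i, i)) \<le> d ^ k" .
qed (use assms in auto)

lemma trace_selfadjoint_real:
  assumes A: "A \<in> mats m" "mat_adj A = A"
  shows "mat_trace_state m \<tau> A \<in> \<real>"
proof -
  have "\<tau> (A $$ (i, i)) \<in> \<real>" if "i < m" for i
    using mat_adj_index[of i m i A] A that matsD[OF A(1)] by (intro \<tau>_selfadjoint) auto
  then show ?thesis unfolding mat_trace_state_def by (intro Reals_divide sum_in_Reals) auto
qed

text \<open>
  For \<open>X = 1 + S\<close> this is \<open>S + S\<^sup>* + S\<^sup>* S\<close>, the variable of the binomial series of \<open>|X|\<^sup>p\<close>.
\<close>

definition gram_deviation :: "nat \<Rightarrow> 'h cop mat \<Rightarrow> 'h cop mat" where
  "gram_deviation m X = mat_adj X * X - 1\<^sub>m m"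

lemma gram_deviation_mats: "X \<in> mats m \<Longrightarrow> gram_deviation m X \<in> mats m"
  by (simp add: gram_deviation_def mats_diff mats_mult mats_adj mats_one)

lemma mat_adj_gram_deviation:
  assumes X: "X \<in> carrier_mat m m"
  shows "mat_adj (gram_deviation m X) = gram_deviation m X"
proof (rule mat_eqI[where m = m])
  define A where "A = mat_adj X * X"
  have A: "A \<in> carrier_mat m m" using X by (simp add: A_def)
  fix i j assume ij: "i < m" "j < m"
  have "mat_adj A = A" using X by (simp add: A_def mat_adj_mult[where m = m] mat_adj_adj)
  then have "cop_adj (A $$ (j, i)) = A $$ (i, j)" using mat_adj_index[OF ij A] by simp
  then show "mat_adj (gram_deviation m X) $$ (i, j) = gram_deviation m X $$ (i, j)"
    using ij A by (auto simp: mat_index gram_deviation_def cop_adj_diff simp flip: A_def)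
qed (use X in \<open>auto simp: gram_deviation_def\<close>)

lemma trace_power_sums:
  assumes X: "X \<in> mats m" and small: "mnorm m (gram_deviation m X) \<le> 1/4"
  shows "(\<lambda>k. complex_of_real (p/2 gchoose k) * mat_trace_state m \<tau> (gram_deviation m X ^\<^sub>m k))
    sums mat_trace_state m \<tau> (mat_abs_power m p X)"
proof -
  define D where "D = gram_deviation m X"
  have D: "D \<in> mats m" "D \<in> carrier_mat m m" "mnorm m D \<le> 1/4"
    using X small by (simp_all add: D_def gram_deviation_mats matsD)
  have eq: "mat_abs_power m p X = binomial_series m (p/2) D"
    unfolding D_def gram_deviation_def
    by (rule mat_abs_power_eq_binomial_series) (use X small in \<open>auto simp: gram_deviation_def matsD\<close>)
  have "(\<lambda>k. \<tau> ((p/2 gchoose k) *\<^sub>R (D ^\<^sub>m k) $$ (i, i))) sums \<tau> (mat_abs_power m p X $$ (i, i))"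
    if "i < m" for i
    unfolding eq
    by (rule \<tau>_sums, rule binomial_series_sums)
      (use D that in \<open>auto simp: cop_scaleR_scaleC intro!: M_scaleC matsD mats_pow\<close>)
  then have "(\<lambda>k. \<Sum>i<m. \<tau> ((p/2 gchoose k) *\<^sub>R (D ^\<^sub>m k) $$ (i, i)))
      sums (\<Sum>i<m. \<tau> (mat_abs_power m p X $$ (i, i)))"
    by (intro sums_sum) auto
  then have "(\<lambda>k. (\<Sum>i<m. \<tau> ((p/2 gchoose k) *\<^sub>R (D ^\<^sub>m k) $$ (i, i))) / of_nat m)
      sums mat_trace_state m \<tau> (mat_abs_power m p X)"
    unfolding mat_trace_state_def by (rule sums_divide)
  moreover have "\<tau> ((p/2 gchoose k) *\<^sub>R (D ^\<^sub>m k) $$ (i, i)) = (p/2 gchoose k) * \<tau> ((D ^\<^sub>m k) $$ (i, i))"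
    if "i < m" for i k
    unfolding cop_scaleR_scaleC by (intro \<tau>_scaleC matsD(2)[OF mats_pow[OF D(1)]] that)
  ultimately show ?thesis
    by (simp add: mat_trace_state_def sum_distrib_left flip: D_def)
qed

end

text \<open>
  The bound is taken at the radius \<open>1/4\<close> up to which \<open>|X|\<^sup>p\<close> is expanded; the factor \<open>2\<close> is the norm
  estimate of the trace.
\<close>

definition gbinomial_bound :: "real \<Rightarrow> real" where
  "gbinomial_bound a = 2 * suminf (\<lambda>k. \<bar>a gchoose k\<bar> * (1/4) ^ k)"

text \<open>
  Comparing \<open>d\<^sup>k\<close> with \<open>(1/4)\<^sup>k\<close> gains a factor \<open>(4 d)\<^sup>n\<close> from the terms of index at least \<open>n\<close>; hence the
  tail is \<open>O(d\<^sup>n)\<close>.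
\<close>

lemma binomial_tail_bound:
  fixes f :: "nat \<Rightarrow> complex"
  assumes sums: "(\<lambda>k. complex_of_real (a gchoose k) * f k) sums L"
    and f: "\<And>k. cmod (f k) \<le> 2 * d ^ k" and d: "0 \<le> d" "d \<le> 1/4"
  shows "cmod (L - (\<Sum>k<n. complex_of_real (a gchoose k) * f k)) \<le> gbinomial_bound a * (4 * d) ^ n"
proof -
  define b where "b k = \<bar>a gchoose k\<bar> * (1/4 :: real) ^ k" for k
  have b: "summable b" unfolding b_def by (rule summable_abs_gbinomial) auto
  have b0: "0 \<le> b k" for k by (simp add: b_def)
  let ?g = "\<lambda>k. complex_of_real (a gchoose (k + n)) * f (k + n)"
  have le: "cmod (?g k) \<le> 2 * (4 * d) ^ n * b (k + n)" for k
  proof -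
    have "d ^ (k + n) = (4 * d) ^ k * ((4 * d) ^ n * (1/4) ^ (k + n))"
      by (simp add: power_add power_mult_distrib field_simps)
    also have "\<dots> \<le> 1 * ((4 * d) ^ n * (1/4) ^ (k + n))"
      using d by (intro mult_right_mono power_le_one) auto
    finally have "d ^ (k + n) \<le> (4 * d) ^ n * (1/4) ^ (k + n)" by simp
    then have "\<bar>a gchoose (k + n)\<bar> * (2 * d ^ (k + n)) \<le>
        \<bar>a gchoose (k + n)\<bar> * (2 * ((4 * d) ^ n * (1/4) ^ (k + n)))"
      by (intro mult_left_mono) auto
    moreover have "cmod (?g k) \<le> \<bar>a gchoose (k + n)\<bar> * (2 * d ^ (k + n))"
      unfolding norm_mult norm_of_real by (intro mult_left_mono f) simp
    ultimately show ?thesis by (simp add: b_def mult_ac)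
  qed
  have "(\<lambda>k. ?g k) sums (L - (\<Sum>k<n. complex_of_real (a gchoose k) * f k))"
    by (rule sums_split_initial_segment[OF sums])
  then have "L - (\<Sum>k<n. complex_of_real (a gchoose k) * f k) = suminf ?g" by (simp add: sums_iff)
  also have "cmod (suminf ?g) \<le> suminf (\<lambda>k. 2 * (4 * d) ^ n * b (k + n))"
    by (rule norm_suminf_le[OF le]) (intro summable_mult summable_ignore_initial_segment b)
  also have "\<dots> = 2 * (4 * d) ^ n * suminf (\<lambda>k. b (k + n))"
    by (rule suminf_mult) (intro summable_ignore_initial_segment b)
  also have "\<dots> \<le> 2 * (4 * d) ^ n * suminf b"
  proof (intro mult_left_mono)
    show "suminf (\<lambda>k. b (k + n)) \<le> suminf b"
      using suminf_split_initial_segment[OF b, of n] sum_nonneg[of "{..<n}" b] b0 by simp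
  qed (use d in auto)
  finally show ?thesis by (simp add: gbinomial_bound_def b_def[abs_def] mult_ac)
qed


section \<open>Expansion into words\<close>

definition word_mat :: "nat \<Rightarrow> ('a \<Rightarrow> 'h::chilbert_space cop mat) \<Rightarrow> 'a list \<Rightarrow> 'h cop mat" where
  "word_mat m X w = foldr (\<lambda>a B. X a * B) w (1\<^sub>m m)"

lemma word_mat_simps [simp]:
  "word_mat m X [] = 1\<^sub>m m" "word_mat m X (a # w) = X a * word_mat m X w"
  by (simp_all add: word_mat_def)

lemma word_mat_carrier:
  "(\<And>a. a \<in> L \<Longrightarrow> X a \<in> carrier_mat m m) \<Longrightarrow> set w \<subseteq> L \<Longrightarrow> word_mat m X w \<in> carrier_mat m m"
  by (induction w) auto

text \<open>
  The number of ways to cut a word into \<open>k\<close> blocks, each block being a single letter or a starred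
  letter followed by an unstarred one: the coefficient of the word in \<open>(S + S\<^sup>* + S\<^sup>* S)\<^sup>k\<close>.
\<close>

fun blocks :: "('a \<Rightarrow> bool) \<Rightarrow> nat \<Rightarrow> 'a list \<Rightarrow> nat" where
  "blocks st 0 w = (if w = [] then 1 else 0)"
| "blocks st (Suc k) [] = 0"
| "blocks st (Suc k) [a] = blocks st k []"
| "blocks st (Suc k) (a # b # w) =
     blocks st k (b # w) + (if st a \<and> \<not> st b then blocks st k w else 0)"

lemma blocks_eq_0: "length w < k \<or> 2 * k < length w \<Longrightarrow> blocks st k w = 0"
  by (induction st k w rule: blocks.induct) auto

definition words_le :: "'a set \<Rightarrow> nat \<Rightarrow> 'a list set" where
  "words_le L n = {w. set w \<subseteq> L \<and> length w \<le> n}"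

lemma finite_words_le: "finite L \<Longrightarrow> finite (words_le L n)"
  unfolding words_le_def by (rule finite_lists_length_le)

lemma sum_words_le_Suc:
  fixes f :: "'a list \<Rightarrow> 'b::comm_monoid_add"
  assumes L: "finite L"
  shows "(\<Sum>w\<in>words_le L (Suc n). f w) = f [] + (\<Sum>a\<in>L. \<Sum>w\<in>words_le L n. f (a # w))"
proof -
  have eq: "words_le L (Suc n) = insert [] ((\<lambda>(a, w). a # w) ` (L \<times> words_le L n))"
  proof (rule Set.set_eqI)
    fix w show "w \<in> words_le L (Suc n) \<longleftrightarrow> w \<in> insert [] ((\<lambda>(a, w). a # w) ` (L \<times> words_le L n))"
      by (cases w) (auto simp: words_le_def)
  qed
  have "(\<Sum>w\<in>words_le L (Suc n). f w) = f [] + (\<Sum>w\<in>(\<lambda>(a, w). a # w) ` (L \<times> words_le L n). f w)"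
    unfolding eq using L by (subst sum.insert) (auto intro: finite_words_le)
  also have "(\<Sum>w\<in>(\<lambda>(a, w). a # w) ` (L \<times> words_le L n). f w) =
      (\<Sum>(a, w)\<in>L \<times> words_le L n. f (a # w))"
    by (subst sum.reindex) (auto simp: inj_on_def case_prod_unfold)
  finally show ?thesis by (simp add: sum.cartesian_product)
qed

definition word_term :: "nat \<Rightarrow> ('a \<Rightarrow> 'h::chilbert_space cop mat) \<Rightarrow> ('a \<Rightarrow> complex) \<Rightarrow> 'a list \<Rightarrow> 'h cop mat" where
  "word_term m X c w = mat_scaleC (prod_list (map c w)) (word_mat m X w)"

lemma mat_sum_mult_index:
  fixes F :: "'i \<Rightarrow> 'a::semiring_0 mat" and G :: "'j \<Rightarrow> 'a mat"
  assumes "\<And>a. a \<in> I \<Longrightarrow> F a \<in> carrier_mat m m" "\<And>b. b \<in> J \<Longrightarrow> G b \<in> carrier_mat m m"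
    and ij: "i < m" "j < m"
  shows "(mat_sum m I F * mat_sum m J G) $$ (i, j) = (\<Sum>a\<in>I. \<Sum>b\<in>J. (F a * G b) $$ (i, j))"
proof -
  have "mat_sum m I F * mat_sum m J G = mat_sum m I (\<lambda>a. F a * mat_sum m J G)"
    using assms by (intro mat_sum_mult_right) auto
  then have "(mat_sum m I F * mat_sum m J G) $$ (i, j) = (\<Sum>a\<in>I. (F a * mat_sum m J G) $$ (i, j))"
    using ij by (simp add: mat_sum_index)
  also have "\<dots> = (\<Sum>a\<in>I. \<Sum>b\<in>J. (F a * G b) $$ (i, j))"
    using assms by (intro sum.cong refl) (simp add: mat_sum_mult_left mat_sum_index)
  finally show ?thesis .
qed

text \<open>
  The length bound \<open>n\<close> is kept free so that the induction hypothesis can be used for two different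
  bounds, after splitting off one letter and after splitting off two.
\<close>

lemma power_word_expansion:
  fixes X :: "'a \<Rightarrow> 'h::chilbert_space cop mat"
  assumes L: "finite L" and X: "\<And>a. a \<in> L \<Longrightarrow> X a \<in> carrier_mat m m"
    and D: "D = mat_sum m L (\<lambda>a. mat_scaleC (c a) (X a)) +
      mat_sum m {a\<in>L. st a} (\<lambda>a. mat_scaleC (c a) (X a)) *
      mat_sum m {b\<in>L. \<not> st b} (\<lambda>b. mat_scaleC (c b) (X b))"
    and n: "2 * k \<le> n"
  shows "D ^\<^sub>m k = mat_sum m (words_le L n) (\<lambda>w. mat_scaleC (of_nat (blocks st k w)) (word_term m X c w))"
  using n
proof (induction k arbitrary: n)
  have Dc: "D \<in> carrier_mat m m" unfolding D by auto
  have wt: "word_term m X c w \<in> carrier_mat m m" if "set w \<subseteq> L" for w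
    unfolding word_term_def using that X by (intro mat_scaleC_carrier word_mat_carrier) auto
  {
    case 0
    show ?case
    proof (rule mat_eqI)
      fix i j assume ij: "i < m" "j < m"
      have "(\<Sum>w\<in>words_le L n. mat_scaleC (of_nat (blocks st 0 w)) (word_term m X c w) $$ (i, j))
          = (\<Sum>w\<in>{[]}. mat_scaleC (of_nat (blocks st 0 w)) (word_term m X c w) $$ (i, j))"
        using L ij wt
        by (intro sum.mono_neutral_right finite_words_le) (auto simp: words_le_def mat_index)
      also have "\<dots> = 1\<^sub>m m $$ (i, j)" using ij wt[of "[]"] by (simp add: mat_index word_term_def)
      finally show "(D ^\<^sub>m 0) $$ (i, j) = mat_sum m (words_le L n)
          (\<lambda>w. mat_scaleC (of_nat (blocks st 0 w)) (word_term m X c w)) $$ (i, j)"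
        using ij Dc by (simp add: mat_sum_index)
    qed (use Dc in auto)
  next
    case (Suc k)
    then obtain n' where n': "n = Suc (Suc n')" "2 * k \<le> n'"
      by (metis add_2_eq_Suc le_Suc_ex mult_Suc_right plus_nat.simps(2) le_add1 add_Suc_right)
    define T where "T a = mat_scaleC (c a) (X a)" for a
    have T: "T a \<in> carrier_mat m m" if "a \<in> L" for a using X that by (simp add: T_def)
    define F where "F w = mat_scaleC (of_nat (blocks st k w)) (word_term m X c w)" for w
    have F: "F w \<in> carrier_mat m m" if "set w \<subseteq> L" for w using wt that by (simp add: F_def)
    have TF: "T a * word_term m X c w = word_term m X c (a # w)" if "a \<in> L" "set w \<subseteq> L" for a w
      using X that word_mat_carrier[OF X that(2)]
      by (simp add: T_def word_term_def mat_scaleC_mult[where m = m] mat_scaleC_scaleC mult.commute)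
    have T1: "T a * F w = mat_scaleC (of_nat (blocks st k w)) (word_term m X c (a # w))"
      if "a \<in> L" "set w \<subseteq> L" for a w
      using T[OF that(1)] wt[OF that(2)] by (simp add: F_def mat_scaleC_mult(2)[where m = m] TF that)
    have T2: "T a * T b * F w = mat_scaleC (of_nat (blocks st k w)) (word_term m X c (a # b # w))"
      if "a \<in> L" "b \<in> L" "set w \<subseteq> L" for a b w
    proof -
      have "T a * T b * F w = T a * (T b * F w)"
        using T F that by (intro mat_mult_assoc[where m = m]) auto
      also have "\<dots> = mat_scaleC (of_nat (blocks st k w)) (T a * word_term m X c (b # w))"
        unfolding T1[OF that(2,3)] using T wt that by (intro mat_scaleC_mult(2)[where m = m]) auto
      finally show ?thesis using that by (simp add: TF)
    qed
    let ?U = "mat_sum m L T" and ?A = "mat_sum m {a\<in>L. st a} T" and ?B = "mat_sum m {b\<in>L. \<not> st b} T"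
    have D': "D = ?U + ?A * ?B" by (simp add: D T_def[abs_def])
    have IH1: "D ^\<^sub>m k = mat_sum m (words_le L (Suc n')) F"
      and IH2: "D ^\<^sub>m k = mat_sum m (words_le L n') F"
      using Suc.IH[of "Suc n'"] Suc.IH[of n'] n' by (simp_all add: F_def[abs_def])
    have split: "D ^\<^sub>m Suc k = ?U * mat_sum m (words_le L (Suc n')) F + ?A * (?B * mat_sum m (words_le L n') F)"
    proof -
      have "D ^\<^sub>m Suc k = D * D ^\<^sub>m k" by (rule mat_pow_Suc_left[OF Dc])
      also have "\<dots> = ?U * D ^\<^sub>m k + (?A * ?B) * D ^\<^sub>m k"
        unfolding D' by (rule add_mult_distrib_mat[where nr = m and n = m and nc = m])
          (use Dc in \<open>auto simp flip: D'\<close>)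
      also have "(?A * ?B) * D ^\<^sub>m k = ?A * (?B * D ^\<^sub>m k)"
        using Dc by (intro mat_mult_assoc[where m = m]) auto
      finally show ?thesis by (simp only: IH1[symmetric] IH2[symmetric])
    qed
    have W: "set w \<subseteq> L" if "w \<in> words_le L l" for w l using that by (auto simp: words_le_def)
    show ?case
    proof (rule mat_eqI)
      fix i j assume ij: "i < m" "j < m"
      let ?G = "\<lambda>w. word_term m X c w $$ (i, j)"
      have "(?U * mat_sum m (words_le L (Suc n')) F) $$ (i, j) =
          (\<Sum>a\<in>L. \<Sum>w\<in>words_le L (Suc n'). (T a * F w) $$ (i, j))"
        using T F W by (intro mat_sum_mult_index ij) auto
      also have "\<dots> = (\<Sum>a\<in>L. \<Sum>w\<in>words_le L (Suc n'). of_nat (blocks st k w) *\<^sub>C ?G (a # w))"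
        using ij wt by (intro sum.cong refl) (auto simp: T1 W mat_scaleC_index)
      finally have e1: "(?U * mat_sum m (words_le L (Suc n')) F) $$ (i, j) = \<dots>" .
      have "(?A * (?B * mat_sum m (words_le L n') F)) $$ (i, j) =
          (\<Sum>a\<in>{a\<in>L. st a}. \<Sum>b\<in>{b\<in>L. \<not> st b}. \<Sum>w\<in>words_le L n'. (T a * T b * F w) $$ (i, j))"
      proof -
        have "?A * (?B * mat_sum m (words_le L n') F) = (?A * ?B) * mat_sum m (words_le L n') F"
          by (intro mat_mult_assoc[where m = m, symmetric]) auto
        also have "?A * ?B = mat_sum m {a\<in>L. st a} (\<lambda>a. T a * ?B)"
          using T by (intro mat_sum_mult_right) auto
        also have "\<dots> = mat_sum m {a\<in>L. st a} (\<lambda>a. mat_sum m {b\<in>L. \<not> st b} (\<lambda>b. T a * T b))"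
        proof -
          have "T a * ?B = mat_sum m {b\<in>L. \<not> st b} (\<lambda>b. T a * T b)" if "a \<in> L" for a
            using T that by (intro mat_sum_mult_left) auto
          then show ?thesis
            unfolding mat_sum_def[of m "{a\<in>L. st a}"]
            by (intro arg_cong[of _ _ "mat m m"] ext sum.cong refl) auto
        qed
        finally have "(?A * (?B * mat_sum m (words_le L n') F)) $$ (i, j) =
            (\<Sum>a\<in>{a\<in>L. st a}. \<Sum>w\<in>words_le L n'.
              (mat_sum m {b\<in>L. \<not> st b} (\<lambda>b. T a * T b) * F w) $$ (i, j))"
          using F W by (simp add: mat_sum_mult_index[OF _ _ ij])
        also have "\<dots> = (\<Sum>a\<in>{a\<in>L. st a}. \<Sum>w\<in>words_le L n'. \<Sum>b\<in>{b\<in>L. \<not> st b}. (T a * T b * F w) $$ (i, j))"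
        proof (intro sum.cong refl)
          fix a w assume "a \<in> {a\<in>L. st a}" "w \<in> words_le L n'"
          then have "mat_sum m {b\<in>L. \<not> st b} (\<lambda>b. T a * T b) * F w =
              mat_sum m {b\<in>L. \<not> st b} (\<lambda>b. T a * T b * F w)"
            using T F W by (intro mat_sum_mult_right) auto
          then show "(mat_sum m {b\<in>L. \<not> st b} (\<lambda>b. T a * T b) * F w) $$ (i, j) =
              (\<Sum>b\<in>{b\<in>L. \<not> st b}. (T a * T b * F w) $$ (i, j))"
            using ij by (simp add: mat_sum_index)
        qed
        finally show ?thesis by (simp only: sum.swap[where A = "words_le L n'"])
      qed
      also have "\<dots> = (\<Sum>a\<in>{a\<in>L. st a}. \<Sum>b\<in>{b\<in>L. \<not> st b}. \<Sum>w\<in>words_le L n'.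
          of_nat (blocks st k w) *\<^sub>C ?G (a # b # w))"
        using ij wt by (intro sum.cong refl) (auto simp: T2 W mat_scaleC_index)
      also have "\<dots> = (\<Sum>a\<in>L. \<Sum>b\<in>L. \<Sum>w\<in>words_le L n'.
          of_nat (if st a \<and> \<not> st b then blocks st k w else 0) *\<^sub>C ?G (a # b # w))"
      proof (rule sum.mono_neutral_cong_left)
        fix a assume "a \<in> {a\<in>L. st a}"
        then show "(\<Sum>b\<in>{b\<in>L. \<not> st b}. \<Sum>w\<in>words_le L n'. of_nat (blocks st k w) *\<^sub>C ?G (a # b # w)) =
            (\<Sum>b\<in>L. \<Sum>w\<in>words_le L n'.
              of_nat (if st a \<and> \<not> st b then blocks st k w else 0) *\<^sub>C ?G (a # b # w))"
          using L by (intro sum.mono_neutral_cong_left) (auto simp: finite_words_le)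
      qed (use L in auto)
      finally have e2: "(?A * (?B * mat_sum m (words_le L n') F)) $$ (i, j) = \<dots>" .
      have "(\<Sum>w\<in>words_le L n. of_nat (blocks st (Suc k) w) *\<^sub>C ?G w) =
          (\<Sum>a\<in>L. of_nat (blocks st (Suc k) [a]) *\<^sub>C ?G [a] +
            (\<Sum>b\<in>L. \<Sum>w\<in>words_le L n'. of_nat (blocks st (Suc k) (a # b # w)) *\<^sub>C ?G (a # b # w)))"
        by (simp add: n' sum_words_le_Suc[OF L] del: blocks.simps(3,4))
      also have "\<dots> = (\<Sum>a\<in>L. (of_nat (blocks st k []) *\<^sub>C ?G [a] +
            (\<Sum>b\<in>L. \<Sum>w\<in>words_le L n'. of_nat (blocks st k (b # w)) *\<^sub>C ?G (a # b # w))) +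
            (\<Sum>b\<in>L. \<Sum>w\<in>words_le L n'.
              of_nat (if st a \<and> \<not> st b then blocks st k w else 0) *\<^sub>C ?G (a # b # w)))"
        by (simp add: cop_scaleC_add_left sum.distrib add.assoc)
      also have "\<dots> = (\<Sum>a\<in>L. \<Sum>w\<in>words_le L (Suc n'). of_nat (blocks st k w) *\<^sub>C ?G (a # w)) +
          (\<Sum>a\<in>L. \<Sum>b\<in>L. \<Sum>w\<in>words_le L n'.
            of_nat (if st a \<and> \<not> st b then blocks st k w else 0) *\<^sub>C ?G (a # b # w))"
        by (simp add: sum_words_le_Suc[OF L] sum.distrib)
      also have "\<dots> = (D ^\<^sub>m Suc k) $$ (i, j)"
        unfolding split e1[symmetric] e2[symmetric] using ij
        by (intro mat_add_index[symmetric]) auto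
      finally show "(D ^\<^sub>m Suc k) $$ (i, j) = mat_sum m (words_le L n)
          (\<lambda>w. mat_scaleC (of_nat (blocks st (Suc k) w)) (word_term m X c w)) $$ (i, j)"
        using ij wt by (simp add: mat_sum_index mat_scaleC_index W del: pow_mat.simps)
    qed (use Dc in auto)
  }
qed


section \<open>Counting blocks over the rotations of a word\<close>

fun star_pairs :: "('a \<Rightarrow> bool) \<Rightarrow> 'a list \<Rightarrow> nat" where
  "star_pairs st [] = 0"
| "star_pairs st [a] = 0"
| "star_pairs st (a # b # w) = (if st a \<and> \<not> st b then 1 else 0) + star_pairs st (b # w)"

lemma star_pairs_unstarred: "\<not> st b \<Longrightarrow> star_pairs st (b # w) = star_pairs st w"
  by (cases w) auto

lemma star_pairs_less: "w \<noteq> [] \<Longrightarrow> star_pairs st w < length w"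
  by (induction st w rule: star_pairs.induct) auto

text \<open>
  The starred--unstarred pairs of adjacent letters never overlap, so a division into \<open>k\<close> blocks
  amounts to a choice of \<open>length w - k\<close> of these pairs.
\<close>

lemma blocks_eq_choose:
  "blocks st k w = (if k \<le> length w then star_pairs st w choose (length w - k) else 0)"
proof (induction st k w rule: blocks.induct)
  case (1 st w)
  then show ?case using star_pairs_less[of w st] by (auto simp: binomial_eq_0)
next
  case (3 st k a)
  then show ?case by (cases k) auto
next
  case (4 st k a b w)
  show ?case
  proof (cases "st a \<and> \<not> st b")
    case True
    then have r: "star_pairs st (b # w) = star_pairs st w" by (simp add: star_pairs_unstarred)
    consider "k \<le> length w" | "k = Suc (length w)" | "k > Suc (length w)" by linarith
    then show ?thesis
    proof cases
      case 1
      then have "Suc (length w) - k = Suc (length w - k)" by simp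
      with 1 True 4 r show ?thesis by simp
    qed (use True 4 r in auto)
  next
    case False
    then have "blocks st (Suc k) (a # b # w) = blocks st k (b # w)"
      "star_pairs st (a # b # w) = star_pairs st (b # w)" by auto
    then show ?thesis using 4(1) by simp
  qed
qed simp

lemma sum_gbinomial_blocks:
  fixes a :: real
  shows "(\<Sum>k\<le>length w. (a gchoose k) * real (blocks st k w)) = (a + real (star_pairs st w)) gchoose length w"
proof -
  have "(\<Sum>k\<le>length w. (a gchoose k) * real (blocks st k w)) =
      (\<Sum>k=0..length w. (a gchoose k) * (real (star_pairs st w) gchoose (length w - k)))"
    unfolding atMost_atLeast0
    by (intro sum.cong refl) (simp add: blocks_eq_choose binomial_gbinomial)
  then show ?thesis by (simp only: gbinomial_Vandermonde)
qed

lemma star_pairs_conv_sum: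
  "star_pairs st w = (\<Sum>t<length w - 1. if st (w ! t) \<and> \<not> st (w ! Suc t) then 1 else 0)"
proof (induction st w rule: star_pairs.induct)
  case (3 st a b w)
  then show ?case by (simp add: sum.lessThan_Suc_shift del: sum.lessThan_Suc)
qed auto

text \<open>
  Shifting \<open>i\<close> by one moves the first summand to the end.
\<close>

lemma sum_rotate_mod:
  fixes g :: "nat \<Rightarrow> 'a::cancel_comm_monoid_add"
  assumes "0 < K"
  shows "(\<Sum>t<K. g ((i + t) mod K)) = (\<Sum>l<K. g l)"
proof (induction i)
  case (Suc i)
  have "g ((i + 0) mod K) + (\<Sum>t<K. g ((i + Suc t) mod K)) = (\<Sum>t<Suc K. g ((i + t) mod K))"
    by (rule sum.lessThan_Suc_shift[symmetric])
  also have "\<dots> = g ((i + 0) mod K) + (\<Sum>t<K. g ((i + t) mod K))" by (simp add: add.commute)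
  finally show ?case using Suc by simp
qed simp

text \<open>
  The word \<open>f 0, \<dots>, f (K - 1)\<close>, rotated so that it starts with the letter at \<open>i\<close>.
\<close>

definition cyclic_word :: "nat \<Rightarrow> (nat \<Rightarrow> 'a) \<Rightarrow> nat \<Rightarrow> 'a list" where
  "cyclic_word K f i = map (\<lambda>t. f ((i + t) mod K)) [0..<K]"

lemma length_cyclic_word [simp]: "length (cyclic_word K f i) = K"
  by (simp add: cyclic_word_def)

text \<open>
  The only cyclically adjacent pair that a rotation cannot see consists of its last and its first
  letter.
\<close>

lemma star_pairs_cyclic_word:
  fixes K :: nat and st :: "'a \<Rightarrow> bool" and f :: "nat \<Rightarrow> 'a"
  assumes "0 < K"
  defines "h \<equiv> \<lambda>l. if st (f l) \<and> \<not> st (f (Suc l mod K)) then 1 else (0 :: nat)"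
  shows "star_pairs st (cyclic_word K f i) + h ((K - 1 + i) mod K) = (\<Sum>l<K. h l)"
proof -
  have "star_pairs st (cyclic_word K f i) = (\<Sum>t<K - 1. h ((i + t) mod K))"
    unfolding star_pairs_conv_sum by (auto simp: cyclic_word_def h_def mod_Suc_eq intro!: sum.cong)
  moreover have "(\<Sum>t<K. h ((i + t) mod K)) = (\<Sum>t<K - 1. h ((i + t) mod K)) + h ((i + (K - 1)) mod K)"
    using assms(1) by (cases K) auto
  ultimately show ?thesis
    using sum_rotate_mod[OF assms(1), of h i] by (simp add: add.commute)
qed

lemma gbinomial_nonzero: "x \<notin> \<int> \<Longrightarrow> (x :: real) gchoose k \<noteq> 0"
  by (auto simp: gbinomial_prod_rev)

text \<open>
  With \<open>F r = (a + r) choose K\<close> and \<open>R\<close> cyclically adjacent starred--unstarred pairs, the sum over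
  the rotations is \<open>(K - R) F R + R F (R - 1) = a ((a + R - 1) choose (K - 1))\<close>: a rotation loses
  a pair exactly when it cuts the word in the middle of one.
\<close>

lemma sum_rotations_nonzero:
  fixes a :: real
  assumes K: "0 < K" and a: "a \<notin> \<int>"
  shows "(\<Sum>i<K. \<Sum>k\<le>K. (a gchoose k) * real (blocks st k (cyclic_word K f i))) \<noteq> 0"
proof -
  define h where "h l = (if st (f l) \<and> \<not> st (f (Suc l mod K)) then 1 else (0 :: nat))" for l
  define R where "R = (\<Sum>l<K. h l)"
  define F where "F x = ((x :: real) gchoose K)" for x
  define y where "y = (a + real R - 1) gchoose (K - 1)"
  have h01: "h l = 0 \<or> h l = 1" for l by (simp add: h_def)
  have sp: "star_pairs st (cyclic_word K f i) + h ((K - 1 + i) mod K) = R" for i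
    unfolding R_def h_def by (rule star_pairs_cyclic_word[OF K])
  have "(\<Sum>i<K. \<Sum>k\<le>K. (a gchoose k) * real (blocks st k (cyclic_word K f i))) =
      (\<Sum>i<K. F (a + real (star_pairs st (cyclic_word K f i))))"
    using sum_gbinomial_blocks[of a st "cyclic_word K f _"] by (simp add: F_def)
  also have "\<dots> = (\<Sum>i<K. F (a + real R - real (h ((K - 1 + i) mod K))))"
  proof (intro sum.cong refl)
    fix i
    have "a + real (star_pairs st (cyclic_word K f i)) = a + real R - real (h ((K - 1 + i) mod K))"
      using sp[of i] by linarith
    then show "F (a + real (star_pairs st (cyclic_word K f i))) = F (a + real R - real (h ((K - 1 + i) mod K)))"
      by (simp only:)
  qed
  also have "\<dots> = (\<Sum>l<K. F (a + real R - real (h l)))"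
    by (rule sum_rotate_mod[OF K, of "\<lambda>l. F (a + real R - real (h l))"])
  also have "\<dots> = (\<Sum>l<K. F (a + real R) + real (h l) * (F (a + real R - 1) - F (a + real R)))"
  proof (intro sum.cong refl)
    fix l
    show "F (a + real R - real (h l)) = F (a + real R) + real (h l) * (F (a + real R - 1) - F (a + real R))"
      using h01[of l] by auto
  qed
  also have "\<dots> = real K * F (a + real R) + real R * (F (a + real R - 1) - F (a + real R))"
    by (simp add: sum.distrib sum_distrib_right[symmetric] R_def)
  also have "\<dots> = a * y"
  proof -
    obtain K' where K': "K = Suc K'" using K by (cases K) auto
    have F1: "real K * F (a + real R) = (a + real R) * y"
      using gbinomial_absorption[of K' "a + real R"] by (simp add: F_def y_def K' add.commute)
    have F2: "real K * F (a + real R - 1) = (a + real R - real K) * y"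
      using gbinomial_mult_1[of "a + real R - 1" K'] by (simp add: F_def y_def K' algebra_simps)
    have "real K * (real K * F (a + real R) + real R * (F (a + real R - 1) - F (a + real R))) =
        real K * (real K * F (a + real R)) + real R * (real K * F (a + real R - 1) - real K * F (a + real R))"
      by (simp add: algebra_simps)
    also have "\<dots> = real K * (a * y)" unfolding F1 F2 by (simp add: algebra_simps)
    finally show ?thesis using K by simp
  qed
  finally have eq: "(\<Sum>i<K. \<Sum>k\<le>K. (a gchoose k) * real (blocks st k (cyclic_word K f i))) = a * y" .
  have "a \<noteq> 0" using a by auto
  moreover have "a + real R - 1 \<notin> \<int>"
  proof
    assume "a + real R - 1 \<in> \<int>"
    then have "(a + real R - 1) - real R + 1 \<in> \<int>" by (intro Ints_add Ints_diff) auto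
    then show False using a by simp
  qed
  then have "y \<noteq> 0" unfolding y_def by (rule gbinomial_nonzero)
  ultimately show ?thesis by (simp add: eq)
qed


section \<open>Averaging over fourth roots of unity\<close>

abbreviation fourth_roots :: "complex set" where
  "fourth_roots \<equiv> {1, \<i>, - 1, - \<i>}"

abbreviation conj_unless :: "bool \<Rightarrow> complex \<Rightarrow> complex" where
  "conj_unless b z \<equiv> (if b then z else cnj z)"

lemma fourth_roots_distinct [simp]: "\<i> \<noteq> - \<i>" "- \<i> \<noteq> \<i>" "\<i> \<noteq> -1" "-1 \<noteq> \<i>" "- \<i> \<noteq> 1" "1 \<noteq> - \<i>" "\<i> \<noteq> 1" "1 \<noteq> \<i>"
    "(1 :: complex) \<noteq> -1" "(-1 :: complex) \<noteq> 1"
  by (auto simp: complex_eq_iff)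

lemma sum_fourth_roots: "(\<Sum>z\<in>fourth_roots. conj_unless b z) = 0"
  by auto

lemma sum_fourth_roots2:
  "(\<Sum>z\<in>fourth_roots. conj_unless (\<not> e) z * conj_unless b z) = (if b = e then 4 else 0)"
  by (auto simp: complex_eq_iff)

text \<open>
  The letters \<open>(l, True)\<close> and \<open>(l, False)\<close> stand for the \<open>l\<close>-th matrix and its adjoint, which carry
  the scalars \<open>z\<^sub>l\<close> and \<open>cnj z\<^sub>l\<close>.  The average extracts the words in which every \<open>l\<close> occurs with net
  exponent congruent to that of \<open>(l, \<epsilon> l)\<close> modulo \<open>4\<close>.
\<close>

definition phase :: "(nat \<Rightarrow> complex) \<Rightarrow> (nat \<times> bool) list \<Rightarrow> complex" where
  "phase lam w = prod_list (map (\<lambda>(l, b). conj_unless b (lam l)) w)"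

definition phase_weight :: "nat \<Rightarrow> (nat \<Rightarrow> bool) \<Rightarrow> (nat \<Rightarrow> complex) \<Rightarrow> complex" where
  "phase_weight K \<epsilon> lam = (\<Prod>l<K. conj_unless (\<not> \<epsilon> l) (lam l))"

definition phases :: "nat \<Rightarrow> (nat \<Rightarrow> complex) set" where
  "phases K = (\<Pi>\<^sub>E l\<in>{..<K}. fourth_roots)"

definition phase_sum :: "nat \<Rightarrow> (nat \<Rightarrow> bool) \<Rightarrow> (nat \<times> bool) list \<Rightarrow> complex" where
  "phase_sum K \<epsilon> w = (\<Sum>lam\<in>phases K. phase_weight K \<epsilon> lam * phase lam w)"

definition letter_factor :: "nat \<Rightarrow> (nat \<times> bool) list \<Rightarrow> complex \<Rightarrow> complex" where
  "letter_factor l w z = prod_list (map (\<lambda>(l', b). if l' = l then conj_unless b z else 1) w)"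

text \<open>
  Collecting the factors of each variable turns the sum over all phases into a product of sums over
  single fourth roots of unity.
\<close>

lemma phase_conv_letter_factor:
  "set w \<subseteq> {..<K} \<times> UNIV \<Longrightarrow> phase lam w = (\<Prod>l<K. letter_factor l w (lam l))"
proof (induction w)
  case (Cons a w)
  obtain l b where a: "a = (l, b)" by (cases a)
  have "(\<Prod>l'<K. if l = l' then conj_unless b (lam l') else 1) = conj_unless b (lam l)"
    using Cons.prems by (subst prod.delta') (auto simp: a)
  moreover have "phase lam w = (\<Prod>l<K. letter_factor l w (lam l))" using Cons by simp
  moreover have "letter_factor l' (a # w) z = (if l = l' then conj_unless b z else 1) * letter_factor l' w z" for l' z
    by (simp add: letter_factor_def a)
  moreover have "phase lam (a # w) = conj_unless b (lam l) * phase lam w" by (simp add: phase_def a)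
  ultimately show ?case by (simp add: prod.distrib del: if_distrib)
qed (simp add: phase_def letter_factor_def)

lemma phase_sum_prod:
  assumes "set w \<subseteq> {..<K} \<times> UNIV"
  shows "phase_sum K \<epsilon> w = (\<Prod>l<K. \<Sum>z\<in>fourth_roots. conj_unless (\<not> \<epsilon> l) z * letter_factor l w z)"
  unfolding phase_sum_def phases_def phase_weight_def phase_conv_letter_factor[OF assms]
    prod.distrib[symmetric]
  by (rule prod_sum_PiE[symmetric]) auto

lemma letter_factor_absent: "l \<notin> fst ` set w \<Longrightarrow> letter_factor l w z = 1"
  by (induction w) (auto simp: letter_factor_def)

lemma letter_factor_unique:
  "distinct (map fst w) \<Longrightarrow> (l, b) \<in> set w \<Longrightarrow> letter_factor l w z = conj_unless b z"
proof (induction w)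
  case (Cons a w)
  obtain l' b' where a: "a = (l', b')" by (cases a)
  have step: "letter_factor l (a # w) z = (if l' = l then conj_unless b' z else 1) * letter_factor l w z"
    by (simp add: letter_factor_def a)
  show ?case
  proof (cases "(l, b) = a")
    case True
    then have "l \<notin> fst ` set w" using Cons.prems a by auto
    then show ?thesis using True a unfolding step by (simp add: letter_factor_absent)
  next
    case False
    then have "(l, b) \<in> set w" using Cons.prems by auto
    moreover from this have "l' \<noteq> l" using Cons.prems a by force
    ultimately show ?thesis using Cons unfolding step by simp
  qed
qed simp

lemma phase_sum_missing:
  assumes "set w \<subseteq> {..<K} \<times> UNIV" "l < K" "l \<notin> fst ` set w"
  shows "phase_sum K \<epsilon> w = 0"
proof -
  have "(\<Sum>z\<in>fourth_roots. conj_unless (\<not> \<epsilon> l) z * letter_factor l w z) = 0"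
    using sum_fourth_roots[of "\<not> \<epsilon> l"] by (simp only: letter_factor_absent[OF assms(3)] mult_1_right)
  then show ?thesis unfolding phase_sum_prod[OF assms(1)]
    by (intro prod_zero[OF finite_lessThan] bexI[of _ l]) (simp_all only: lessThan_iff assms(2))
qed

text \<open>
  A word with fewer than \<open>K\<close> letters misses some variable, whose fourth roots of unity sum to zero.
\<close>

lemma phase_sum_short:
  assumes "set w \<subseteq> {..<K} \<times> UNIV" "length w < K"
  shows "phase_sum K \<epsilon> w = 0"
proof -
  have "\<not> {..<K} \<subseteq> fst ` set w"
  proof
    assume "{..<K} \<subseteq> fst ` set w"
    then have "card {..<K} \<le> card (set (map fst w))" by (intro card_mono) auto
    also have "\<dots> \<le> length w" using card_length[of "map fst w"] by simp
    finally show False using assms(2) by simp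
  qed
  then show ?thesis using phase_sum_missing[OF assms(1)] by blast
qed

text \<open>
  If no variable is missing, each occurs exactly once, and a variable with the wrong sign produces the
  sum of the squares of the fourth roots of unity, which is zero.
\<close>

lemma phase_sum_wrong_sign:
  assumes w: "set w \<subseteq> {..<K} \<times> UNIV" "length w = K" and lb: "(l, b) \<in> set w" "b \<noteq> \<epsilon> l"
  shows "phase_sum K \<epsilon> w = 0"
proof (cases "{..<K} \<subseteq> fst ` set w")
  case True
  then have "card {..<K} \<le> card (set (map fst w))" by (intro card_mono) auto
  then have "distinct (map fst w)"
    using w(2) card_length[of "map fst w"] by (intro card_distinct) simp
  then have "(\<Sum>z\<in>fourth_roots. conj_unless (\<not> \<epsilon> l) z * letter_factor l w z) = 0"
    using sum_fourth_roots2[of "\<epsilon> l" b] lb by (simp only: letter_factor_unique[OF _ lb(1)]) simp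
  moreover have "l < K" using w lb by auto
  ultimately show ?thesis unfolding phase_sum_prod[OF w(1)]
    by (intro prod_zero[OF finite_lessThan] bexI[of _ l]) (simp_all only: lessThan_iff)
next
  case False
  then show ?thesis using phase_sum_missing[OF w(1)] by blast
qed

lemma phase_sum_forward:
  assumes w: "set w \<subseteq> {..<K} \<times> UNIV" "distinct (map fst w)" and all: "\<And>l. l < K \<Longrightarrow> (l, \<epsilon> l) \<in> set w"
  shows "phase_sum K \<epsilon> w = 4 ^ K"
proof -
  have "(\<Sum>z\<in>fourth_roots. conj_unless (\<not> \<epsilon> l) z * letter_factor l w z) = 4" if "l < K" for l
    using sum_fourth_roots2[of "\<epsilon> l" "\<epsilon> l"] by (simp only: letter_factor_unique[OF w(2) all[OF that]]) simp
  then show ?thesis unfolding phase_sum_prod[OF w(1)] by simp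
qed

lemma cyclic_word_set:
  assumes "0 < K"
  shows "set (cyclic_word K f i) = f ` {..<K}"
proof -
  have "l \<in> (\<lambda>t. (i + t) mod K) ` {..<K}" if "l < K" for l
  proof
    show "l = (i + (l + (K - i mod K)) mod K) mod K"
    proof -
      have "(i + (l + (K - i mod K)) mod K) mod K = (i mod K + (l + (K - i mod K))) mod K"
        by (simp add: mod_simps)
      also have "i mod K + (l + (K - i mod K)) = l + K" using mod_less_divisor[OF assms, of i] by linarith
      finally show ?thesis using that by simp
    qed
  qed (use assms in auto)
  then have "(\<lambda>t. (i + t) mod K) ` {..<K} = {..<K}" using assms by auto
  then have "f ` (\<lambda>t. (i + t) mod K) ` {..<K} = f ` {..<K}" by simp
  then show ?thesis by (simp add: cyclic_word_def image_image atLeast0LessThan)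
qed

lemma distinct_cyclic_word:
  assumes "0 < K" "inj_on f {..<K}"
  shows "distinct (cyclic_word K f i)"
  using cyclic_word_set[OF assms(1), of f i] assms(2)
  by (intro card_distinct) (simp add: card_image)

lemma phase_sum_cyclic_word:
  assumes "0 < K"
  shows "phase_sum K \<epsilon> (cyclic_word K (\<lambda>l. (l, \<epsilon> l)) i) = 4 ^ K"
proof (rule phase_sum_forward)
  have "map fst (cyclic_word K (\<lambda>l. (l, \<epsilon> l)) i) = cyclic_word K (\<lambda>l. l) i"
    by (simp add: cyclic_word_def)
  then show "distinct (map fst (cyclic_word K (\<lambda>l. (l, \<epsilon> l)) i))"
    using distinct_cyclic_word[OF assms, of "\<lambda>l. l" i] by simp
qed (use cyclic_word_set[OF assms, of "\<lambda>l. (l, \<epsilon> l)" i] in auto)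


section \<open>The cyclic pencil of a word\<close>

text \<open>
  The \<open>l\<close>-th letter of a word of length \<open>K\<close> is \<open>g l\<close> or \<open>(g l)\<^sup>*\<close>, according to \<open>\<epsilon> l\<close>.  It is placed on
  the edge \<open>l \<rightarrow> l + 1\<close> of a \<open>K\<close>-cycle: \<open>g l\<close> occupies the matrix position \<open>(l, l + 1)\<close> if \<open>\<epsilon> l\<close> holds,
  and the transposed position otherwise, so that in both cases the matrix \<open>(l, \<epsilon> l)\<close> carries the
  \<open>l\<close>-th letter of the word at \<open>(l, l + 1)\<close>.
\<close>

definition letter_mat ::
    "nat \<Rightarrow> (nat \<Rightarrow> bool) \<Rightarrow> (nat \<Rightarrow> 'h::chilbert_space cop) \<Rightarrow> nat \<times> bool \<Rightarrow> 'h cop mat" where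
  "letter_mat K \<epsilon> g = (\<lambda>(l, b). mat K K (\<lambda>(i, j).
     if (if b = \<epsilon> l then i = l \<and> j = Suc l mod K else i = Suc l mod K \<and> j = l)
     then if b then g l else cop_adj (g l) else 0))"

definition letter :: "(nat \<Rightarrow> bool) \<Rightarrow> (nat \<Rightarrow> 'h::chilbert_space cop) \<Rightarrow> nat \<Rightarrow> 'h cop" where
  "letter \<epsilon> g l = (if \<epsilon> l then g l else cop_adj (g l))"

definition pencil ::
    "nat \<Rightarrow> (nat \<Rightarrow> bool) \<Rightarrow> (nat \<Rightarrow> 'h::chilbert_space cop) \<Rightarrow> real \<Rightarrow> (nat \<Rightarrow> complex) \<Rightarrow> 'h cop mat" where
  "pencil K \<epsilon> g s lam = 1\<^sub>m K +
     mat_sum K {..<K} (\<lambda>l. mat_scaleC (complex_of_real s * lam l) (letter_mat K \<epsilon> g (l, True)))"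

abbreviation pencil_trace ::
    "('h::chilbert_space cop \<Rightarrow> complex) \<Rightarrow> nat \<Rightarrow> real \<Rightarrow> (nat \<Rightarrow> bool) \<Rightarrow> (nat \<Rightarrow> 'h cop) \<Rightarrow>
     real \<Rightarrow> (nat \<Rightarrow> complex) \<Rightarrow> complex" where
  "pencil_trace \<tau> K p \<epsilon> g s lam \<equiv> mat_trace_state K \<tau> (mat_abs_power K p (pencil K \<epsilon> g s lam))"

abbreviation averaged_trace ::
    "('h::chilbert_space cop \<Rightarrow> complex) \<Rightarrow> nat \<Rightarrow> real \<Rightarrow> (nat \<Rightarrow> bool) \<Rightarrow> (nat \<Rightarrow> 'h cop) \<Rightarrow>
     real \<Rightarrow> complex" where
  "averaged_trace \<tau> K p \<epsilon> g s \<equiv>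
     (\<Sum>lam\<in>phases K. phase_weight K \<epsilon> lam * pencil_trace \<tau> K p \<epsilon> g s lam) / complex_of_real s ^ K"

lemma letter_mat_carrier [simp]: "letter_mat K \<epsilon> g a \<in> carrier_mat K K"
  by (cases a) (simp add: letter_mat_def)

lemma mat_adj_letter_mat:
  "mat_adj (letter_mat K \<epsilon> g (l, True)) = letter_mat K \<epsilon> g (l, False)"
  by (rule mat_eqI[where m = K]) (auto simp: mat_adj_index letter_mat_def)

text \<open>
  Each factor is a single entry at an edge \<open>(l, l + 1)\<close>, so a product is nonzero only along a path of the
  cycle, and then it is the product of the letters on that path.
\<close>

lemma word_mat_forward:
  fixes g :: "nat \<Rightarrow> 'h::chilbert_space cop"
  assumes "set \<pi> \<subseteq> {..<K}" "i < K" "j < K"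
  shows "word_mat K (letter_mat K \<epsilon> g) (map (\<lambda>l. (l, \<epsilon> l)) \<pi>) $$ (i, j) =
    (if \<pi> = map (\<lambda>t. (i + t) mod K) [0..<length \<pi>] \<and> j = (i + length \<pi>) mod K
     then prod_list (map (letter \<epsilon> g) \<pi>) else 0)"
  using assms
proof (induction \<pi> arbitrary: i)
  case (Cons l \<pi>)
  let ?X = "letter_mat K \<epsilon> g" and ?W = "word_mat K (letter_mat K \<epsilon> g) (map (\<lambda>l. (l, \<epsilon> l)) \<pi>)"
  have K: "0 < K" using Cons.prems by auto
  have W: "?W \<in> carrier_mat K K" by (rule word_mat_carrier[of UNIV]) auto
  have X: "?X (l, \<epsilon> l) $$ (i, k) = (if i = l \<and> k = Suc l mod K then letter \<epsilon> g l else 0)" if "k < K" for k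
    using Cons.prems that by (simp add: letter_mat_def letter_def)
  have "(?X (l, \<epsilon> l) * ?W) $$ (i, j) = (\<Sum>k<K. ?X (l, \<epsilon> l) $$ (i, k) * ?W $$ (k, j))"
    using W Cons.prems by (intro mat_mult_index) auto
  also have "\<dots> = (\<Sum>k<K. if k = Suc l mod K then (if i = l then letter \<epsilon> g l * ?W $$ (k, j) else 0) else 0)"
    by (intro sum.cong refl) (simp add: X)
  also have "\<dots> = (if i = l then letter \<epsilon> g l * ?W $$ (Suc l mod K, j) else 0)"
    using K by simp
  finally have eq: "(?X (l, \<epsilon> l) * ?W) $$ (i, j) = \<dots>" .
  have path: "map (\<lambda>t. (i + t) mod K) [0..<length (l # \<pi>)] =
      i # map (\<lambda>t. (Suc i mod K + t) mod K) [0..<length \<pi>]"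
  proof -
    have "map (\<lambda>t. (i + t) mod K) [0..<Suc (length \<pi>)] =
        ((i + 0) mod K) # map (\<lambda>t. (i + Suc t) mod K) [0..<length \<pi>]"
      by (rule map_upt_Suc)
    then show ?thesis using Cons.prems by (simp add: mod_add_left_eq)
  qed
  have last: "(Suc i mod K + length \<pi>) mod K = (i + length (l # \<pi>)) mod K"
    by (simp add: mod_add_left_eq)
  have IH: "?W $$ (Suc i mod K, j) = (if \<pi> = map (\<lambda>t. (Suc i mod K + t) mod K) [0..<length \<pi>] \<and>
      j = (Suc i mod K + length \<pi>) mod K then prod_list (map (letter \<epsilon> g) \<pi>) else 0)"
    using Cons.prems K by (intro Cons.IH) auto
  show ?case
  proof (cases "i = l")
    case True
    have "word_mat K ?X (map (\<lambda>l. (l, \<epsilon> l)) (l # \<pi>)) $$ (i, j) = letter \<epsilon> g l * ?W $$ (Suc i mod K, j)"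
      using eq True by simp
    then show ?thesis unfolding IH path last using True by (simp del: upt_Suc)
  next
    case False
    then show ?thesis unfolding path using eq by (simp del: upt_Suc)
  qed
qed auto

lemma gram_deviation_pencil_expand:
  assumes S: "S \<in> carrier_mat m m"
  shows "mat_adj (1\<^sub>m m + S) * (1\<^sub>m m + S) - 1\<^sub>m m = S + mat_adj S + mat_adj S * S"
proof -
  have adj: "mat_adj (1\<^sub>m m + S) = 1\<^sub>m m + mat_adj S"
    by (rule mat_eqI[where m = m]) (use S in \<open>auto simp: mat_index\<close>)
  have S': "mat_adj S \<in> carrier_mat m m" using S by simp
  have "(1\<^sub>m m + mat_adj S) * (1\<^sub>m m + S) = 1\<^sub>m m * (1\<^sub>m m + S) + mat_adj S * (1\<^sub>m m + S)"
    using S S' by (intro add_mult_distrib_mat[where nr = m and n = m and nc = m]) auto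
  also have "mat_adj S * (1\<^sub>m m + S) = mat_adj S * 1\<^sub>m m + mat_adj S * S"
    using S S' by (intro mult_add_distrib_mat[where nr = m and n = m and nc = m]) auto
  finally have "(1\<^sub>m m + mat_adj S) * (1\<^sub>m m + S) = (1\<^sub>m m + S) + (mat_adj S + mat_adj S * S)"
    using left_mult_one_mat[of "1\<^sub>m m + S" m m] right_mult_one_mat[OF S'] S by simp
  then show ?thesis
    unfolding adj by (intro mat_eqI[where m = m])
      (use S S' in \<open>auto simp: mat_index simp del: index_mult_mat(1)\<close>)
qed

abbreviation letters :: "nat \<Rightarrow> (nat \<times> bool) set" where
  "letters K \<equiv> {..<K} \<times> UNIV"

definition letter_coeff :: "real \<Rightarrow> (nat \<Rightarrow> complex) \<Rightarrow> nat \<times> bool \<Rightarrow> complex" where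
  "letter_coeff s lam = (\<lambda>(l, b). complex_of_real s * conj_unless b (lam l))"

abbreviation starred :: "nat \<times> bool \<Rightarrow> bool" where
  "starred a \<equiv> \<not> snd a"

lemma prod_letter_coeff:
  "prod_list (map (letter_coeff s lam) w) = complex_of_real s ^ length w * phase lam w"
  by (induction w) (auto simp: letter_coeff_def phase_def)

lemma pencil_deviation:
  fixes g :: "nat \<Rightarrow> 'h::chilbert_space cop" and K :: nat and \<epsilon> :: "nat \<Rightarrow> bool"
  defines "T \<equiv> \<lambda>lam s a. mat_scaleC (letter_coeff s lam a) (letter_mat K \<epsilon> g a)"
  shows "mat_adj (pencil K \<epsilon> g s lam) * pencil K \<epsilon> g s lam - 1\<^sub>m K =
    mat_sum K (letters K) (T lam s) +
    mat_sum K {a \<in> letters K. starred a} (T lam s) * mat_sum K {a \<in> letters K. \<not> starred a} (T lam s)"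
proof -
  define S where "S = mat_sum K {..<K} (\<lambda>l. T lam s (l, True))"
  have S: "S \<in> carrier_mat K K" by (simp add: S_def)
  have Tc: "T lam s a \<in> carrier_mat K K" for a by (simp add: T_def)
  have adjT: "mat_adj (T lam s (l, True)) = T lam s (l, False)" for l
  proof (rule mat_eqI[where m = K])
    fix i j assume ij: "i < K" "j < K"
    show "mat_adj (T lam s (l, True)) $$ (i, j) = T lam s (l, False) $$ (i, j)"
      using ij mat_adj_index[OF ij letter_mat_carrier, of \<epsilon> g "(l, True)"]
      by (simp add: mat_index T_def letter_coeff_def mat_adj_letter_mat)
  qed (auto simp: T_def)
  have sets: "{a \<in> letters K. starred a} = (\<lambda>l. (l, False)) ` {..<K}"
    "{a \<in> letters K. \<not> starred a} = (\<lambda>l. (l, True)) ` {..<K}" by auto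
  have re: "mat_sum K ((\<lambda>l. (l, b)) ` {..<K}) (T lam s) = mat_sum K {..<K} (\<lambda>l. T lam s (l, b))" for b
    by (rule mat_eqI[where m = K]) (auto simp: mat_sum_index sum.reindex inj_on_def)
  have adjS: "mat_adj S = mat_sum K {..<K} (\<lambda>l. T lam s (l, False))"
  proof (rule mat_eqI[where m = K])
    fix i j assume ij: "i < K" "j < K"
    have "mat_adj S $$ (i, j) = (\<Sum>l<K. mat_adj (T lam s (l, True)) $$ (i, j))"
      using ij Tc by (simp add: S_def mat_index cop_adj_sum)
    then show "mat_adj S $$ (i, j) = mat_sum K {..<K} (\<lambda>l. T lam s (l, False)) $$ (i, j)"
      using ij by (simp add: adjT mat_sum_index)
  qed (use S in auto)
  have all: "mat_sum K (letters K) (T lam s) = S + mat_adj S"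
  proof (rule mat_eqI[where m = K])
    fix i j assume ij: "i < K" "j < K"
    have "mat_sum K (letters K) (T lam s) $$ (i, j) = (\<Sum>l<K. \<Sum>b\<in>UNIV. T lam s (l, b) $$ (i, j))"
      using ij by (simp add: mat_sum_index sum.cartesian_product)
    also have "\<dots> = (S + mat_adj S) $$ (i, j)"
      unfolding adjS using ij by (simp add: mat_index S_def UNIV_bool sum.distrib)
    finally show "mat_sum K (letters K) (T lam s) $$ (i, j) = (S + mat_adj S) $$ (i, j)" .
  qed (use S in auto)
  have "pencil K \<epsilon> g s lam = 1\<^sub>m K + S"
    by (simp add: pencil_def S_def T_def letter_coeff_def)
  then show ?thesis
    unfolding all sets re adjS[symmetric] S_def[symmetric] by (simp add: gram_deviation_pencil_expand[OF S])
qed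

lemma mnorm_mat_sum: "mnorm m (mat_sum m I F) \<le> (\<Sum>a\<in>I. mnorm m (F a))"
proof -
  have "mnorm m (mat_sum m I F) \<le> (\<Sum>i<m. \<Sum>j<m. \<Sum>a\<in>I. norm (F a $$ (i, j)))"
    unfolding mnorm_def by (intro sum_mono) (simp add: mat_sum_index norm_sum)
  also have "\<dots> = (\<Sum>a\<in>I. mnorm m (F a))"
    unfolding mnorm_def by (simp only: sum.swap[where B = I])
  finally show ?thesis .
qed

text \<open>
  Adding \<open>1\<close> lets the terms of first and second order in \<open>S\<close> be estimated by the same square.
\<close>

definition pencil_bound :: "nat \<Rightarrow> (nat \<Rightarrow> bool) \<Rightarrow> (nat \<Rightarrow> 'h::chilbert_space cop) \<Rightarrow> real" where
  "pencil_bound K \<epsilon> g = (\<Sum>a\<in>letters K. mnorm K (letter_mat K \<epsilon> g a)) + 1"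

lemma phases_norm: "lam \<in> phases K \<Longrightarrow> l < K \<Longrightarrow> cmod (lam l) = 1"
  by (auto simp: phases_def PiE_def Pi_def)

lemma mnorm_pencil_deviation:
  fixes g :: "nat \<Rightarrow> 'h::chilbert_space cop"
  assumes lam: "lam \<in> phases K" and s: "0 \<le> s" "s \<le> 1"
  shows "mnorm K (mat_adj (pencil K \<epsilon> g s lam) * pencil K \<epsilon> g s lam - 1\<^sub>m K) \<le> 2 * (pencil_bound K \<epsilon> g)\<^sup>2 * s"
proof -
  let ?T = "\<lambda>a. mat_scaleC (letter_coeff s lam a) (letter_mat K \<epsilon> g a)"
  let ?B = "pencil_bound K \<epsilon> g"
  have B1: "1 \<le> ?B" by (simp add: pencil_bound_def sum_nonneg)
  have part: "mnorm K (mat_sum K I ?T) \<le> s * ?B" if I: "I \<subseteq> letters K" for I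
  proof -
    have "mnorm K (mat_sum K I ?T) \<le> (\<Sum>a\<in>I. mnorm K (?T a))" by (rule mnorm_mat_sum)
    also have "\<dots> \<le> (\<Sum>a\<in>I. s * mnorm K (letter_mat K \<epsilon> g a))"
    proof (rule sum_mono)
      fix a assume "a \<in> I"
      then have "cmod (letter_coeff s lam a) = s"
        using I s phases_norm[OF lam] by (auto simp: letter_coeff_def norm_mult)
      then show "mnorm K (?T a) \<le> s * mnorm K (letter_mat K \<epsilon> g a)"
        using mnorm_scaleC[OF letter_mat_carrier, where c = "letter_coeff s lam a"] by metis
    qed
    also have "\<dots> = s * (\<Sum>a\<in>I. mnorm K (letter_mat K \<epsilon> g a))" by (simp add: sum_distrib_left)
    also have "(\<Sum>a\<in>I. mnorm K (letter_mat K \<epsilon> g a)) \<le> (\<Sum>a\<in>letters K. mnorm K (letter_mat K \<epsilon> g a))"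
      using I by (intro sum_mono2) auto
    also have "\<dots> \<le> ?B" by (simp add: pencil_bound_def)
    finally show ?thesis using s by (simp add: mult_left_mono)
  qed
  have "mnorm K (mat_adj (pencil K \<epsilon> g s lam) * pencil K \<epsilon> g s lam - 1\<^sub>m K) \<le>
      mnorm K (mat_sum K (letters K) ?T) +
      mnorm K (mat_sum K {a \<in> letters K. starred a} ?T * mat_sum K {a \<in> letters K. \<not> starred a} ?T)"
    unfolding pencil_deviation by (rule mnorm_add) auto
  also have "\<dots> \<le> s * ?B + (s * ?B) * (s * ?B)"
    using s B1
    by (intro add_mono part order_trans[OF mnorm_mult] mult_mono) auto
  also have "\<dots> \<le> s * ?B\<^sup>2 + s * ?B\<^sup>2"
  proof (intro add_mono)
    show "s * ?B \<le> s * ?B\<^sup>2" using s B1 by (intro mult_left_mono) (auto simp: power2_eq_square)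
    have "(s * s) * ?B\<^sup>2 \<le> (s * 1) * ?B\<^sup>2" using s by (intro mult_right_mono mult_left_mono) auto
    then show "(s * ?B) * (s * ?B) \<le> s * ?B\<^sup>2" by (simp add: power2_eq_square mult_ac)
  qed
  finally show ?thesis by (simp add: mult_ac)
qed

lemma phase_weight_norm:
  assumes "lam \<in> phases K" shows "cmod (phase_weight K \<epsilon> lam) = 1"
proof -
  have "cmod (phase_weight K \<epsilon> lam) = (\<Prod>l<K. 1)"
    unfolding phase_weight_def prod_norm[symmetric]
    by (intro prod.cong refl) (use phases_norm[OF assms] in auto)
  then show ?thesis by simp
qed

context tracial_algebra
begin

lemma letter_mat_mats:
  assumes "\<And>l. l < K \<Longrightarrow> g l \<in> M" "a \<in> letters K"
  shows "letter_mat K \<epsilon> g a \<in> mats K"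
  using assms by (auto simp: letter_mat_def mats_def M_zero M_adj)

lemma word_mat_mats:
  "(\<And>a. a \<in> L \<Longrightarrow> X a \<in> mats m) \<Longrightarrow> set w \<subseteq> L \<Longrightarrow> word_mat m X w \<in> mats m"
  by (induction w) (auto intro: mats_one mats_mult)

lemma pencil_mats: "(\<And>l. l < K \<Longrightarrow> g l \<in> M) \<Longrightarrow> pencil K \<epsilon> g s lam \<in> mats K"
  unfolding pencil_def by (intro mats_add mats_one mats_sum mats_scaleC letter_mat_mats) auto

lemma letter_M: "g l \<in> M \<Longrightarrow> letter \<epsilon> g l \<in> M"
  by (simp add: letter_def M_adj)

lemma prod_list_M: "(\<And>T. T \<in> set Ts \<Longrightarrow> T \<in> M) \<Longrightarrow> prod_list Ts \<in> M"
  by (induction Ts) (auto simp: M_one M_mult)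

lemma \<tau>_cyclic_word:
  assumes K: "0 < K" and z: "\<And>l. l < K \<Longrightarrow> z l \<in> M"
  shows "\<tau> (prod_list (cyclic_word K z i)) = \<tau> (prod_list (map z [0..<K]))"
proof (induction i)
  case 0
  have "cyclic_word K z 0 = map z [0..<K]" by (simp add: cyclic_word_def)
  then show ?case by simp
next
  case (Suc i)
  obtain K' where K': "K = Suc K'" using K by (cases K) auto
  define r where "r = map (\<lambda>t. z ((i + Suc t) mod K)) [0..<K']"
  have "cyclic_word K z i = z (i mod K) # r"
    unfolding cyclic_word_def r_def K' by (subst map_upt_Suc) simp
  moreover have "cyclic_word K z (Suc i) = r @ [z (i mod K)]"
    by (simp add: cyclic_word_def r_def K') (metis add_Suc_right mod_add_self2)
  moreover have "prod_list r \<in> M" "z (i mod K) \<in> M"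
    using K z by (auto simp: r_def intro!: prod_list_M)
  ultimately show ?case using Suc by (simp add: \<tau>_trace)
qed

text \<open>
  Of the words of length \<open>K\<close>, only the rotations of the given word survive both the averaging over
  the phases and the trace: the former forces every edge of the cycle to be used forwards, the latter
  forces consecutive letters to be consecutive edges.
\<close>

lemma phase_sum_trace:
  assumes K: "0 < K" and g: "\<And>l. l < K \<Longrightarrow> g l \<in> M"
    and w: "set w \<subseteq> letters K" "length w = K"
  shows "phase_sum K \<epsilon> w * mat_trace_state K \<tau> (word_mat K (letter_mat K \<epsilon> g) w) =
    (if w \<in> cyclic_word K (\<lambda>l. (l, \<epsilon> l)) ` {..<K}
     then 4 ^ K * \<tau> (prod_list (map (letter \<epsilon> g) [0..<K])) / of_nat K else 0)"
proof (cases "\<exists>a\<in>set w. snd a \<noteq> \<epsilon> (fst a)")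
  case True
  then obtain l b where lb: "(l, b) \<in> set w" "b \<noteq> \<epsilon> l" by (metis prod.collapse)
  have "w \<notin> cyclic_word K (\<lambda>l. (l, \<epsilon> l)) ` {..<K}"
    using lb cyclic_word_set[OF K, of "\<lambda>l. (l, \<epsilon> l)"] by fastforce
  then show ?thesis using phase_sum_wrong_sign[OF w lb(1), of \<epsilon>] lb(2) by simp
next
  case False
  define \<pi> where "\<pi> = map fst w"
  have w_eq: "w = map (\<lambda>l. (l, \<epsilon> l)) \<pi>"
  proof -
    have "map (\<lambda>a. (fst a, \<epsilon> (fst a))) w = w"
    proof (rule map_idI)
      fix a assume a: "a \<in> set w"
      have "snd a = \<epsilon> (fst a)" using False a by blast
      then show "(fst a, \<epsilon> (fst a)) = a" by (simp add: prod_eq_iff)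
    qed
    then show ?thesis by (simp add: \<pi>_def comp_def)
  qed
  have \<pi>: "set \<pi> \<subseteq> {..<K}" "length \<pi> = K" using w by (auto simp: \<pi>_def)
  have cyc: "cyclic_word K (\<lambda>l. (l, \<epsilon> l)) i = map (\<lambda>l. (l, \<epsilon> l)) (cyclic_word K (\<lambda>l. l) i)" for i
    by (simp add: cyclic_word_def)
  have inj: "inj (\<lambda>l. (l, \<epsilon> l))" by (auto simp: inj_on_def)
  have tr: "mat_trace_state K \<tau> (word_mat K (letter_mat K \<epsilon> g) w) =
      (\<Sum>i<K. if \<pi> = cyclic_word K (\<lambda>l. l) i then \<tau> (prod_list (map (letter \<epsilon> g) \<pi>)) else 0) / of_nat K"
    unfolding mat_trace_state_def w_eq
    by (intro arg_cong2[of _ _ _ _ "(/)"] sum.cong refl)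
      (use \<pi> in \<open>auto simp: word_mat_forward cyclic_word_def \<tau>_zero\<close>)
  show ?thesis
  proof (cases "w \<in> cyclic_word K (\<lambda>l. (l, \<epsilon> l)) ` {..<K}")
    case True
    then obtain i where i: "i < K" "w = cyclic_word K (\<lambda>l. (l, \<epsilon> l)) i" by auto
    then have \<pi>i: "\<pi> = cyclic_word K (\<lambda>l. l) i" using w_eq cyc inj by (metis inj_map_eq_map)
    have hd: "cyclic_word K (\<lambda>l. l) i ! 0 = i" if "i < K" for i using that by (simp add: cyclic_word_def)
    have "\<pi> = cyclic_word K (\<lambda>l. l) i' \<longleftrightarrow> i' = i" if "i' < K" for i'
      using \<pi>i hd i(1) that by metis
    then have "(\<Sum>i'<K. if \<pi> = cyclic_word K (\<lambda>l. l) i' then \<tau> (prod_list (map (letter \<epsilon> g) \<pi>)) else 0) =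
        (\<Sum>i'<K. if i' = i then \<tau> (prod_list (map (letter \<epsilon> g) \<pi>)) else 0)"
      by (intro sum.cong refl) auto
    also have "\<dots> = \<tau> (prod_list (cyclic_word K (letter \<epsilon> g) i))"
      using i(1) by (simp add: \<pi>i cyclic_word_def comp_def)
    also have "\<dots> = \<tau> (prod_list (map (letter \<epsilon> g) [0..<K]))"
      by (rule \<tau>_cyclic_word[OF K]) (simp add: letter_M g)
    finally have "mat_trace_state K \<tau> (word_mat K (letter_mat K \<epsilon> g) w) =
        \<tau> (prod_list (map (letter \<epsilon> g) [0..<K])) / of_nat K" unfolding tr by simp
    moreover have "phase_sum K \<epsilon> w = 4 ^ K" unfolding i(2) by (rule phase_sum_cyclic_word[OF K])
    ultimately show ?thesis using True by simp
  next
    case nc: False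
    then have "\<pi> \<noteq> cyclic_word K (\<lambda>l. l) i" if "i < K" for i using that w_eq cyc by auto
    then have "mat_trace_state K \<tau> (word_mat K (letter_mat K \<epsilon> g) w) = 0" unfolding tr by simp
    then show ?thesis using nc by simp
  qed
qed

lemma trace_deviation_pow:
  assumes g: "\<And>l. l < K \<Longrightarrow> g l \<in> M"
  shows "mat_trace_state K \<tau> (gram_deviation K (pencil K \<epsilon> g s lam) ^\<^sub>m k) =
    (\<Sum>w\<in>words_le (letters K) (2 * k). of_nat (blocks starred k w) * complex_of_real s ^ length w * phase lam w *
      mat_trace_state K \<tau> (word_mat K (letter_mat K \<epsilon> g) w))"
proof -
  let ?X = "letter_mat K \<epsilon> g" and ?c = "letter_coeff s lam"
  have wm: "word_mat K ?X w \<in> mats K" if "set w \<subseteq> letters K" for w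
    by (rule word_mat_mats[OF letter_mat_mats[OF g] that])
  have "gram_deviation K (pencil K \<epsilon> g s lam) ^\<^sub>m k = mat_sum K (words_le (letters K) (2 * k))
      (\<lambda>w. mat_scaleC (of_nat (blocks starred k w)) (word_term K ?X ?c w))"
    unfolding gram_deviation_def
    by (rule power_word_expansion[OF _ _ pencil_deviation]) auto
  then have "mat_trace_state K \<tau> (gram_deviation K (pencil K \<epsilon> g s lam) ^\<^sub>m k) =
      (\<Sum>w\<in>words_le (letters K) (2 * k). mat_trace_state K \<tau> (mat_scaleC (of_nat (blocks starred k w)) (word_term K ?X ?c w)))"
    using wm by (simp only:) (rule trace_sum, auto simp: word_term_def words_le_def intro!: mats_scaleC)
  also have "\<dots> = (\<Sum>w\<in>words_le (letters K) (2 * k). of_nat (blocks starred k w) * complex_of_real s ^ length w * phase lam w *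
      mat_trace_state K \<tau> (word_mat K ?X w))"
    using wm by (intro sum.cong refl)
      (auto simp: word_term_def words_le_def trace_scaleC mats_scaleC prod_letter_coeff)
  finally show ?thesis .
qed

text \<open>
  In the power series in \<open>s\<close> all coefficients below \<open>s\<^sup>K\<close> average to zero; the limit is the coefficient
  of \<open>s\<^sup>K\<close>.
\<close>

lemma averaged_trace_tendsto:
  assumes K: "0 < K" and g: "\<And>l. l < K \<Longrightarrow> g l \<in> M"
  shows "((\<lambda>s. (\<Sum>lam\<in>phases K. phase_weight K \<epsilon> lam *
      mat_trace_state K \<tau> (gram_deviation K (pencil K \<epsilon> g s lam) ^\<^sub>m k)) / complex_of_real s ^ K)
    \<longlongrightarrow> (\<Sum>i<K. of_nat (blocks starred k (cyclic_word K (\<lambda>l. (l, \<epsilon> l)) i))) *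
      (4 ^ K * \<tau> (prod_list (map (letter \<epsilon> g) [0..<K])) / of_nat K)) (at_right 0)"
proof -
  let ?W = "words_le (letters K) (2 * k)" and ?cyc = "cyclic_word K (\<lambda>l. (l, \<epsilon> l))"
  define T where "T = 4 ^ K * \<tau> (prod_list (map (letter \<epsilon> g) [0..<K])) / of_nat K"
  define F where "F w = phase_sum K \<epsilon> w * mat_trace_state K \<tau> (word_mat K (letter_mat K \<epsilon> g) w)" for w
  define q where "q w = of_nat (blocks starred k w) * F w" for w
  have W: "set w \<subseteq> letters K" if "w \<in> ?W" for w using that by (auto simp: words_le_def)
  have fin: "finite ?W" by (rule finite_words_le) auto
  have "(\<Sum>lam\<in>phases K. phase_weight K \<epsilon> lam *
      mat_trace_state K \<tau> (gram_deviation K (pencil K \<epsilon> g s lam) ^\<^sub>m k)) = (\<Sum>w\<in>?W. q w * complex_of_real s ^ length w)" for s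
  proof -
    have "mat_trace_state K \<tau> (gram_deviation K (pencil K \<epsilon> g s lam) ^\<^sub>m k) =
      (\<Sum>w\<in>?W. of_nat (blocks starred k w) * complex_of_real s ^ length w * phase lam w *
        mat_trace_state K \<tau> (word_mat K (letter_mat K \<epsilon> g) w))" for lam
      by (rule trace_deviation_pow) (rule g)
    then show ?thesis
      unfolding q_def F_def phase_sum_def
      by (simp only: sum_distrib_left sum_distrib_right sum.swap[where A = "phases K"] mult_ac)
  qed
  moreover have "((\<lambda>s. \<Sum>w\<in>?W. q w * (complex_of_real s ^ length w / complex_of_real s ^ K)) \<longlongrightarrow>
      (\<Sum>w\<in>?W. if length w = K then q w else 0)) (at_right 0)"
  proof (rule tendsto_sum)
    fix w assume w: "w \<in> ?W"
    have pos: "\<forall>\<^sub>F s :: real in at_right 0. s > 0" by (simp add: eventually_at_right_less)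
    consider "length w < K" | "length w = K" | "length w > K" by linarith
    then show "((\<lambda>s. q w * (complex_of_real s ^ length w / complex_of_real s ^ K)) \<longlongrightarrow> (if length w = K then q w else 0)) (at_right 0)"
    proof cases
      case 1
      then have "q w = 0" using phase_sum_short[OF W[OF w]] by (simp add: q_def F_def)
      then show ?thesis by simp
    next
      case 2
      have "\<forall>\<^sub>F s in at_right 0. q w = q w * (complex_of_real s ^ length w / complex_of_real s ^ K)"
        using pos by eventually_elim (simp add: 2)
      then show ?thesis using 2 by (auto intro: Lim_transform_eventually[OF tendsto_const])
    next
      case 3
      have "((\<lambda>s. q w * complex_of_real s ^ (length w - K)) \<longlongrightarrow> q w * complex_of_real 0 ^ (length w - K)) (at_right 0)"
        by (intro tendsto_intros)
      then have "((\<lambda>s. q w * complex_of_real s ^ (length w - K)) \<longlongrightarrow> 0) (at_right 0)" using 3 by (simp add: zero_power)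
      moreover have "\<forall>\<^sub>F s in at_right 0. q w * complex_of_real s ^ (length w - K) = q w * (complex_of_real s ^ length w / complex_of_real s ^ K)"
        using pos by eventually_elim (use 3 in \<open>simp add: power_diff\<close>)
      ultimately show ?thesis using 3 by (auto intro: Lim_transform_eventually)
    qed
  qed
  moreover have "(\<Sum>w\<in>?W. if length w = K then q w else 0) = (\<Sum>i<K. of_nat (blocks starred k (?cyc i))) * T"
  proof -
    have inj: "inj_on ?cyc {..<K}"
    proof (rule inj_onI)
      fix i j assume "i \<in> {..<K}" "j \<in> {..<K}" "?cyc i = ?cyc j"
      then show "i = j" using arg_cong[of "?cyc i" "?cyc j" "\<lambda>w. w ! 0"] by (simp add: cyclic_word_def)
    qed
    have cset: "set (?cyc i) \<subseteq> letters K" for i using cyclic_word_set[OF K, of "\<lambda>l. (l, \<epsilon> l)" i] by auto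
    have "(\<Sum>w\<in>?W. if length w = K then q w else 0) = (\<Sum>w\<in>?cyc ` {..<K}. of_nat (blocks starred k w) * T)"
    proof (rule sum.mono_neutral_cong)
      fix w assume w: "w \<in> ?cyc ` {..<K} - ?W"
      then have "length w = K" "\<not> K \<le> 2 * k" using cset by (auto simp: words_le_def)
      then show "of_nat (blocks starred k w) * T = 0" by (simp add: blocks_eq_0)
    next
      fix w assume w: "w \<in> ?W - ?cyc ` {..<K}"
      then show "(if length w = K then q w else 0) = 0"
        using phase_sum_trace[OF K g W[of w], where \<epsilon> = \<epsilon>] by (auto simp: q_def F_def)
    next
      fix w assume w: "w \<in> ?W \<inter> ?cyc ` {..<K}"
      then have "length w = K" by auto
      then show "(if length w = K then q w else 0) = of_nat (blocks starred k w) * T"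
        using w phase_sum_trace[OF K g W[of w], where \<epsilon> = \<epsilon>] by (auto simp: q_def F_def T_def)
    qed (use fin in auto)
    also have "\<dots> = (\<Sum>i<K. of_nat (blocks starred k (?cyc i)) * T)" by (simp add: sum.reindex[OF inj])
    finally show ?thesis by (simp add: sum_distrib_right)
  qed
  ultimately show ?thesis by (simp add: T_def sum_divide_distrib)
qed

lemma pencil_trace_sums:
  fixes p :: real
  assumes K: "0 < K" and g: "\<And>l. l < K \<Longrightarrow> g l \<in> M" and lam: "lam \<in> phases K"
    and s: "0 \<le> s" "s \<le> 1" "2 * (pencil_bound K \<epsilon> g)\<^sup>2 * s \<le> 1/4"
  defines "D \<equiv> gram_deviation K (pencil K \<epsilon> g s lam)"
    and "L \<equiv> pencil_trace \<tau> K p \<epsilon> g s lam"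
  shows "L \<in> \<real>"
    and "cmod (L - (\<Sum>k<n. complex_of_real (p/2 gchoose k) * mat_trace_state K \<tau> (D ^\<^sub>m k))) \<le>
      gbinomial_bound (p/2) * (4 * (2 * (pencil_bound K \<epsilon> g)\<^sup>2 * s)) ^ n"
proof -
  have X: "pencil K \<epsilon> g s lam \<in> mats K" by (rule pencil_mats) (rule g)
  have D: "D \<in> mats K" unfolding D_def by (rule gram_deviation_mats[OF X])
  have small: "mnorm K D \<le> 2 * (pencil_bound K \<epsilon> g)\<^sup>2 * s"
    unfolding D_def gram_deviation_def by (rule mnorm_pencil_deviation[OF lam s(1,2)])
  have sums: "(\<lambda>k. complex_of_real (p/2 gchoose k) * mat_trace_state K \<tau> (D ^\<^sub>m k)) sums L"
    unfolding D_def L_def using small s(3) by (intro trace_power_sums[OF X]) (simp add: D_def)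
  have "mat_adj D = D" unfolding D_def by (rule mat_adj_gram_deviation[OF matsD(1)[OF X]])
  then have "mat_trace_state K \<tau> (D ^\<^sub>m k) \<in> \<real>" for k
    by (intro trace_selfadjoint_real mats_pow[OF D] mat_adj_pow[OF matsD(1)[OF D]])
  then have "Im (complex_of_real (p/2 gchoose k) * mat_trace_state K \<tau> (D ^\<^sub>m k)) = 0" for k
    by (simp add: complex_is_Real_iff)
  moreover note sums_Im[OF sums]
  ultimately have "(\<lambda>k. 0) sums Im L" by (simp only:)
  then have "Im L = 0" using sums_unique2[OF sums_zero] by metis
  then show "L \<in> \<real>" by (simp add: complex_is_Real_iff)
  show "cmod (L - (\<Sum>k<n. complex_of_real (p/2 gchoose k) * mat_trace_state K \<tau> (D ^\<^sub>m k))) \<le>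
      gbinomial_bound (p/2) * (4 * (2 * (pencil_bound K \<epsilon> g)\<^sup>2 * s)) ^ n"
    by (rule binomial_tail_bound[OF sums cmod_trace_pow_le[OF D K small]]) (use s in auto)
qed

lemma eventually_small:
  fixes C :: real
  assumes "0 < b"
  shows "\<forall>\<^sub>F s in at_right 0. C * s < b"
proof -
  have "((\<lambda>s. C * s) \<longlongrightarrow> C * 0) (at_right 0)" by (intro tendsto_intros)
  then show ?thesis using assms by (intro order_tendstoD(2)) auto
qed

text \<open>
  An \<open>L\<^sub>p\<close>-norm determines the trace of the \<open>p\<close>-th power only if that trace is known to be real and
  nonnegative; for small \<open>s\<close> it is close to \<open>1\<close>.
\<close>

lemma pencil_trace_positive:
  fixes p :: real
  assumes K: "0 < K" and g: "\<And>l. l < K \<Longrightarrow> g l \<in> M"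
  shows "\<forall>\<^sub>F s in at_right 0. \<forall>lam\<in>phases K.
    pencil_trace \<tau> K p \<epsilon> g s lam \<in> \<real> \<and>
    0 < Re (pencil_trace \<tau> K p \<epsilon> g s lam)"
proof -
  define C where "C = 2 * (pencil_bound K \<epsilon> g)\<^sup>2"
  have "\<forall>\<^sub>F s :: real in at_right 0. 0 < s" by (simp add: eventually_at_right_less)
  moreover have "\<forall>\<^sub>F s in at_right 0. 1 * s < (1 :: real)" by (rule eventually_small) simp
  moreover have "\<forall>\<^sub>F s in at_right 0. C * s < 1/4" by (rule eventually_small) simp
  moreover have "\<forall>\<^sub>F s in at_right 0. (gbinomial_bound (p/2) * (4 * C)) * s < 1" by (rule eventually_small) simp
  ultimately show ?thesis
  proof eventually_elim
    case (elim s)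
    show ?case
    proof
      fix lam assume lam: "lam \<in> phases K"
      let ?L = "pencil_trace \<tau> K p \<epsilon> g s lam"
      have s: "0 \<le> s" "s \<le> 1" "2 * (pencil_bound K \<epsilon> g)\<^sup>2 * s \<le> 1/4"
        using elim by (auto simp: C_def)
      note ts = pencil_trace_sums[OF K g lam s, of p]
      have "gram_deviation K (pencil K \<epsilon> g s lam) ^\<^sub>m 0 = 1\<^sub>m K"
        using matsD(1)[OF gram_deviation_mats[OF pencil_mats[of K g \<epsilon> s lam, OF g]]] by simp
      then have "cmod (?L - 1) \<le> gbinomial_bound (p/2) * (4 * (C * s))"
        using ts(2)[of 1] K by (simp add: trace_one C_def)
      then have "cmod (?L - 1) < 1" using elim by (simp add: mult_ac)
      then have "\<bar>Re ?L - 1\<bar> < 1" using abs_Re_le_cmod[of "?L - 1"] by simp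
      then show "?L \<in> \<real> \<and> 0 < Re ?L" using ts(1) by auto
    qed
  qed
qed

text \<open>
  The terms of index greater than \<open>K\<close> in the binomial series are \<open>O(s\<^bsup>K+1\<^esup>)\<close> together, so they do not
  contribute after division by \<open>s\<^sup>K\<close>.
\<close>

lemma pencil_trace_limit:
  fixes p :: real
  assumes K: "0 < K" and g: "\<And>l. l < K \<Longrightarrow> g l \<in> M"
  shows "((\<lambda>s. averaged_trace \<tau> K p \<epsilon> g s)
    \<longlongrightarrow> complex_of_real (\<Sum>i<K. \<Sum>k\<le>K. (p/2 gchoose k) * real (blocks starred k (cyclic_word K (\<lambda>l. (l, \<epsilon> l)) i))) *
      (4 ^ K * \<tau> (prod_list (map (letter \<epsilon> g) [0..<K])) / of_nat K)) (at_right 0)"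
proof -
  define C where "C = 2 * (pencil_bound K \<epsilon> g)\<^sup>2"
  define T where "T = 4 ^ K * \<tau> (prod_list (map (letter \<epsilon> g) [0..<K])) / of_nat K"
  define c where "c k = complex_of_real (p/2 gchoose k)" for k
  define L where "L s lam = pencil_trace \<tau> K p \<epsilon> g s lam" for s lam
  define f where "f k s lam = mat_trace_state K \<tau> (gram_deviation K (pencil K \<epsilon> g s lam) ^\<^sub>m k)" for k s lam
  define E where "E = real (card (phases K)) * (gbinomial_bound (p/2) * (4 * C) ^ Suc K)"
  let ?main = "\<lambda>s. \<Sum>k<Suc K. c k * ((\<Sum>lam\<in>phases K. phase_weight K \<epsilon> lam * f k s lam) / complex_of_real s ^ K)"
  let ?full = "\<lambda>s. (\<Sum>lam\<in>phases K. phase_weight K \<epsilon> lam * L s lam) / complex_of_real s ^ K"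
  have "(?main \<longlongrightarrow> (\<Sum>k<Suc K. c k * ((\<Sum>i<K. of_nat (blocks starred k (cyclic_word K (\<lambda>l. (l, \<epsilon> l)) i))) * T))) (at_right 0)"
    unfolding f_def T_def by (intro tendsto_sum tendsto_mult tendsto_const averaged_trace_tendsto K g)
  moreover have "((\<lambda>s. ?full s - ?main s) \<longlongrightarrow> 0) (at_right 0)"
  proof (rule Lim_null_comparison)
    have "((\<lambda>s. E * s) \<longlongrightarrow> E * 0) (at_right 0)" by (intro tendsto_intros)
    then show "((\<lambda>s. E * s) \<longlongrightarrow> 0) (at_right 0)" by simp
    have "\<forall>\<^sub>F s :: real in at_right 0. 0 < s" by (simp add: eventually_at_right_less)
    moreover have "\<forall>\<^sub>F s in at_right 0. 1 * s < (1 :: real)" by (rule eventually_small) simp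
    moreover have "\<forall>\<^sub>F s in at_right 0. C * s < 1/4" by (rule eventually_small) simp
    ultimately show "\<forall>\<^sub>F s in at_right 0. norm (?full s - ?main s) \<le> E * s"
    proof eventually_elim
      case (elim s)
      have s: "0 \<le> s" "s \<le> 1" "2 * (pencil_bound K \<epsilon> g)\<^sup>2 * s \<le> 1/4"
        using elim by (auto simp: C_def)
      have "?main s = (\<Sum>k<Suc K. \<Sum>lam\<in>phases K. phase_weight K \<epsilon> lam * (c k * f k s lam)) / complex_of_real s ^ K"
        by (simp add: sum_divide_distrib sum_distrib_left mult_ac del: sum.lessThan_Suc)
      also have "(\<Sum>k<Suc K. \<Sum>lam\<in>phases K. phase_weight K \<epsilon> lam * (c k * f k s lam)) =
          (\<Sum>lam\<in>phases K. phase_weight K \<epsilon> lam * (\<Sum>k<Suc K. c k * f k s lam))"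
        by (subst sum.swap) (simp only: sum_distrib_left)
      finally have "?full s - ?main s =
          (\<Sum>lam\<in>phases K. phase_weight K \<epsilon> lam * (L s lam - (\<Sum>k<Suc K. c k * f k s lam))) / complex_of_real s ^ K"
        by (simp only: diff_divide_distrib[symmetric] sum_subtractf[symmetric] right_diff_distrib[symmetric])
      also have "norm \<dots> = cmod (\<Sum>lam\<in>phases K. phase_weight K \<epsilon> lam * (L s lam - (\<Sum>k<Suc K. c k * f k s lam))) / s ^ K"
        using elim(1) by (simp add: norm_divide norm_power)
      also have "\<dots> \<le> (\<Sum>lam\<in>phases K. gbinomial_bound (p/2) * (4 * (C * s)) ^ Suc K) / s ^ K"
      proof (intro divide_right_mono sum_norm_le)
        fix lam assume lam: "lam \<in> phases K"
        have "cmod (L s lam - (\<Sum>k<Suc K. c k * f k s lam)) \<le> gbinomial_bound (p/2) * (4 * (C * s)) ^ Suc K"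
          unfolding L_def c_def f_def C_def by (rule pencil_trace_sums(2)[OF K g lam s])
        then show "cmod (phase_weight K \<epsilon> lam * (L s lam - (\<Sum>k<Suc K. c k * f k s lam))) \<le>
            gbinomial_bound (p/2) * (4 * (C * s)) ^ Suc K"
          by (simp only: norm_mult phase_weight_norm[OF lam] mult_1_left)
      qed (use elim(1) in simp)
      also have "\<dots> = E * s"
        using elim(1) by (simp add: E_def power_mult_distrib field_simps)
      finally show ?case .
    qed
  qed
  ultimately have "((\<lambda>s. (?full s - ?main s) + ?main s) \<longlongrightarrow>
      0 + (\<Sum>k<Suc K. c k * ((\<Sum>i<K. of_nat (blocks starred k (cyclic_word K (\<lambda>l. (l, \<epsilon> l)) i))) * T))) (at_right 0)"
    by (intro tendsto_add)
  moreover have "(\<Sum>k<Suc K. c k * ((\<Sum>i<K. of_nat (blocks starred k (cyclic_word K (\<lambda>l. (l, \<epsilon> l)) i))) * T)) =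
      complex_of_real (\<Sum>i<K. \<Sum>k\<le>K. (p/2 gchoose k) * real (blocks starred k (cyclic_word K (\<lambda>l. (l, \<epsilon> l)) i))) * T"
    unfolding lessThan_Suc_atMost
    by (subst sum.swap) (simp add: c_def sum_distrib_left sum_distrib_right mult_ac)
  ultimately show ?thesis by (simp add: L_def T_def)
qed

end


section \<open>Equality of \<open>*\<close>-distributions\<close>

text \<open>
  A variable may occur several times in the word; its matrix coefficient collects all edges that carry
  it.
\<close>

definition pencil_coeff ::
    "nat \<Rightarrow> (nat \<Rightarrow> bool) \<Rightarrow> (nat \<Rightarrow> nat) \<Rightarrow> real \<Rightarrow> (nat \<Rightarrow> complex) \<Rightarrow> nat \<Rightarrow> complex mat" where
  "pencil_coeff K \<epsilon> u s lam v = mat K K (\<lambda>(i, j). \<Sum>l\<in>{l \<in> {..<K}. u l = v}.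
     if (if \<epsilon> l then i = l \<and> j = Suc l mod K else i = Suc l mod K \<and> j = l)
     then complex_of_real s * lam l else 0)"

lemma pencil_eq_tensor_sum:
  fixes x :: "nat \<Rightarrow> 'h::chilbert_space cop"
  assumes u: "\<And>l. l < K \<Longrightarrow> u l < n"
  shows "1\<^sub>m K + mat_sum K {..<n} (\<lambda>v. mat_tensor (pencil_coeff K \<epsilon> u s lam v) (x v)) =
    pencil K \<epsilon> (\<lambda>l. x (u l)) s lam"
proof -
  have "mat_sum K {..<n} (\<lambda>v. mat_tensor (pencil_coeff K \<epsilon> u s lam v) (x v)) =
      mat_sum K {..<K} (\<lambda>l. mat_scaleC (complex_of_real s * lam l) (letter_mat K \<epsilon> (\<lambda>l. x (u l)) (l, True)))"
  proof (rule mat_eqI[where m = K])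
    fix i j assume ij: "i < K" "j < K"
    let ?P = "\<lambda>l. if \<epsilon> l then i = l \<and> j = Suc l mod K else i = Suc l mod K \<and> j = l"
    have "mat_sum K {..<n} (\<lambda>v. mat_tensor (pencil_coeff K \<epsilon> u s lam v) (x v)) $$ (i, j) =
        (\<Sum>v<n. \<Sum>l\<in>{l \<in> {..<K}. u l = v}. (if ?P l then complex_of_real s * lam l else 0) *\<^sub>C x (u l))"
      using ij by (auto simp: mat_sum_index mat_tensor_def pencil_coeff_def cop_scaleC_sum_left intro!: sum.cong)
    also have "\<dots> = (\<Sum>l<K. (if ?P l then complex_of_real s * lam l else 0) *\<^sub>C x (u l))"
      by (rule sum.group) (use u in auto)
    also have "\<dots> = mat_sum K {..<K} (\<lambda>l. mat_scaleC (complex_of_real s * lam l) (letter_mat K \<epsilon> (\<lambda>l. x (u l)) (l, True))) $$ (i, j)"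
      using ij by (auto simp: mat_sum_index mat_scaleC_index letter_mat_def intro!: sum.cong)
    finally show "mat_sum K {..<n} (\<lambda>v. mat_tensor (pencil_coeff K \<epsilon> u s lam v) (x v)) $$ (i, j) =
        mat_sum K {..<K} (\<lambda>l. mat_scaleC (complex_of_real s * lam l) (letter_mat K \<epsilon> (\<lambda>l. x (u l)) (l, True))) $$ (i, j)" .
  qed auto
  then show ?thesis by (simp add: pencil_def)
qed

lemma (in tracial_algebra) \<tau>_nc_eval:
  assumes z: "\<And>i. i < N \<Longrightarrow> z i \<in> M" and P: "P \<in> ncpolys N"
  shows "\<tau> (nc_eval P z) = (\<Sum>w\<in>Poly_Mapping.keys P. Poly_Mapping.lookup P w * \<tau> (prod_list (map z w)))"
proof -
  have "prod_list (map z w) \<in> M" if "w \<in> Poly_Mapping.keys P" for w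
  proof (rule prod_list_M)
    fix T assume "T \<in> set (map z w)"
    then obtain i where i: "i \<in> set w" "T = z i" by auto
    have "set w \<subseteq> {..<N}" using that P by (auto simp: ncpolys_def)
    with i z show "T \<in> M" by auto
  qed
  then show ?thesis by (simp add: nc_eval_def \<tau>_sum \<tau>_scaleC M_scaleC)
qed

theorem theorem3p1:
  fixes M :: "'h::chilbert_space cop set" and \<tau> :: "'h cop \<Rightarrow> complex"
    and N :: "'k::chilbert_space cop set" and \<tau>' :: "'k cop \<Rightarrow> complex"
    and n :: nat and x :: "nat \<Rightarrow> 'h cop" and y :: "nat \<Rightarrow> 'k cop" and p :: real
  assumes "von_neumann_algebra M" and "normal_faithful_tracial_state M \<tau>"
    and "von_neumann_algebra N" and "normal_faithful_tracial_state N \<tau>'"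
    and "\<forall>i<n. x i \<in> M" and "\<forall>i<n. y i \<in> N"
    and "0 < p" and "\<not> (\<exists>k::int. even k \<and> p = real_of_int k)"
    and "\<forall>m\<ge>1. \<forall>a :: nat \<Rightarrow> complex mat. (\<forall>i<n. a i \<in> carrier_mat m m) \<longrightarrow>
           Lp_norm \<tau> m p (1\<^sub>m m + mat_sum m {..<n} (\<lambda>i. mat_tensor (a i) (x i))) =
           Lp_norm \<tau>' m p (1\<^sub>m m + mat_sum m {..<n} (\<lambda>i. mat_tensor (a i) (y i)))"
  shows "\<forall>P \<in> ncpolys (2 * n).
           \<tau> (nc_eval P (with_adj n x)) = \<tau>' (nc_eval P (with_adj n y))"
proof
  fix P assume P: "P \<in> ncpolys (2 * n)"
  interpret A: tracial_algebra M \<tau> by (rule tracial_algebra_von_neumann) fact+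
  interpret B: tracial_algebra N \<tau>' by (rule tracial_algebra_von_neumann) fact+
  have word: "\<tau> (prod_list (map (with_adj n x) w)) = \<tau>' (prod_list (map (with_adj n y) w))"
    if w: "set w \<subseteq> {..<2 * n}" for w
  proof (cases "w = []")
    case True
    then show ?thesis by (simp add: A.\<tau>_one B.\<tau>_one)
  next
    case False
    define K where "K = length w"
    have K: "0 < K" using False by (simp add: K_def)
    define \<epsilon> where "\<epsilon> l \<longleftrightarrow> w ! l < n" for l
    define u where "u l = (if w ! l < n then w ! l else w ! l - n)" for l
    have u: "u l < n" if "l < K" for l
    proof -
      have "w ! l \<in> set w" using that by (simp add: K_def)
      then have "w ! l < 2 * n" using w by auto
      then show ?thesis by (auto simp: u_def)
    qed
    \<comment> \<open>The letter \<open>w ! l\<close> is \<open>x (u l)\<close> or its adjoint, according to \<open>\<epsilon> l\<close>.\<close>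
    let ?gx = "\<lambda>l. x (u l)" and ?gy = "\<lambda>l. y (u l)"
    have gx: "?gx l \<in> M" and gy: "?gy l \<in> N" if "l < K" for l using assms(5,6) u that by auto
    have letters: "map (letter \<epsilon> (\<lambda>l. z (u l))) [0..<K] = map (with_adj n z) w" for z :: "nat \<Rightarrow> 'a::chilbert_space cop"
      by (rule nth_equalityI) (auto simp: K_def letter_def \<epsilon>_def u_def with_adj_def)
    define c where "c = (\<Sum>i<K. \<Sum>k\<le>K. (p/2 gchoose k) * real (blocks starred k (cyclic_word K (\<lambda>l. (l, \<epsilon> l)) i)))"
    have "p/2 \<notin> \<int>"
    proof
      assume "p/2 \<in> \<int>"
      then obtain k :: int where "p/2 = real_of_int k" by (auto elim: Ints_cases)
      then have "p = real_of_int (2 * k)" by simp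
      then show False using assms(8) by (metis dvd_triv_left)
    qed
    then have c: "c \<noteq> 0" unfolding c_def by (rule sum_rotations_nonzero[OF K])
    have posA: "\<forall>\<^sub>F s in at_right 0. \<forall>lam\<in>phases K.
        pencil_trace \<tau> K p \<epsilon> ?gx s lam \<in> \<real> \<and>
        0 < Re (pencil_trace \<tau> K p \<epsilon> ?gx s lam)"
      by (rule A.pencil_trace_positive[OF K]) (rule gx)
    have posB: "\<forall>\<^sub>F s in at_right 0. \<forall>lam\<in>phases K.
        pencil_trace \<tau>' K p \<epsilon> ?gy s lam \<in> \<real> \<and>
        0 < Re (pencil_trace \<tau>' K p \<epsilon> ?gy s lam)"
      by (rule B.pencil_trace_positive[OF K]) (rule gy)
    have limA: "((\<lambda>s. averaged_trace \<tau> K p \<epsilon> ?gx s)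
        \<longlongrightarrow> complex_of_real c * (4 ^ K * \<tau> (prod_list (map (with_adj n x) w)) / of_nat K)) (at_right 0)"
      unfolding letters[symmetric] c_def by (rule A.pencil_trace_limit[OF K]) (rule gx)
    have limB: "((\<lambda>s. averaged_trace \<tau>' K p \<epsilon> ?gy s)
        \<longlongrightarrow> complex_of_real c * (4 ^ K * \<tau>' (prod_list (map (with_adj n y) w)) / of_nat K)) (at_right 0)"
      unfolding letters[symmetric] c_def by (rule B.pencil_trace_limit[OF K]) (rule gy)
    have "\<forall>\<^sub>F s in at_right 0. \<forall>lam\<in>phases K.
        pencil_trace \<tau> K p \<epsilon> ?gx s lam =
        pencil_trace \<tau>' K p \<epsilon> ?gy s lam"
      using posA posB
    proof eventually_elim
      case (elim s)
      show ?case
      proof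
        fix lam assume lam: "lam \<in> phases K"
        let ?a = "pencil_trace \<tau> K p \<epsilon> ?gx s lam"
        let ?b = "pencil_trace \<tau>' K p \<epsilon> ?gy s lam"
        have "Lp_norm \<tau> K p (pencil K \<epsilon> ?gx s lam) = Lp_norm \<tau>' K p (pencil K \<epsilon> ?gy s lam)"
        proof -
          let ?a = "pencil_coeff K \<epsilon> u s lam"
          have car: "\<forall>v<n. ?a v \<in> carrier_mat K K" by (simp add: pencil_coeff_def)
          have px: "1\<^sub>m K + mat_sum K {..<n} (\<lambda>v. mat_tensor (?a v) (x v)) = pencil K \<epsilon> ?gx s lam"
            by (rule pencil_eq_tensor_sum) (rule u)
          have py: "1\<^sub>m K + mat_sum K {..<n} (\<lambda>v. mat_tensor (?a v) (y v)) = pencil K \<epsilon> ?gy s lam"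
            by (rule pencil_eq_tensor_sum) (rule u)
          have "1 \<le> K" using K by simp
          from assms(9)[rule_format, OF this, of ?a] car show ?thesis by (simp only: px py)
        qed
        then have eq: "Re ?a powr (1/p) = Re ?b powr (1/p)" by (simp add: Lp_norm_def)
        have pos: "0 < Re ?a" "0 < Re ?b" using bspec[OF elim(1) lam] bspec[OF elim(2) lam] by blast+
        \<comment> \<open>Taking \<open>p\<close>-th roots is injective on positive numbers.\<close>
        have "(r powr (1/p)) powr p = r" if "0 < r" for r using that assms(7) by (simp add: powr_powr)
        from this[OF pos(1)] this[OF pos(2)] have "Re ?a = Re ?b" unfolding eq by (rule trans[OF sym])
        moreover have "?a \<in> \<real>" "?b \<in> \<real>" using bspec[OF elim(1) lam] bspec[OF elim(2) lam] by blast+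
        ultimately show "?a = ?b" by (simp add: complex_eq_iff complex_is_Real_iff)
      qed
    qed
    then have ev: "\<forall>\<^sub>F s in at_right 0.
        averaged_trace \<tau> K p \<epsilon> ?gx s =
        averaged_trace \<tau>' K p \<epsilon> ?gy s"
      by eventually_elim simp
    have "complex_of_real c * (4 ^ K * \<tau> (prod_list (map (with_adj n x) w)) / of_nat K) =
        complex_of_real c * (4 ^ K * \<tau>' (prod_list (map (with_adj n y) w)) / of_nat K)"
    proof (rule tendsto_unique[OF trivial_limit_at_right_real])
      show "((\<lambda>s. averaged_trace \<tau>' K p \<epsilon> ?gy s)
          \<longlongrightarrow> complex_of_real c * (4 ^ K * \<tau> (prod_list (map (with_adj n x) w)) / of_nat K)) (at_right 0)"
        using limA ev by (rule Lim_transform_eventually)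
      show "((\<lambda>s. averaged_trace \<tau>' K p \<epsilon> ?gy s)
          \<longlongrightarrow> complex_of_real c * (4 ^ K * \<tau>' (prod_list (map (with_adj n y) w)) / of_nat K)) (at_right 0)"
        by (rule limB)
    qed
    then show ?thesis using c K by simp
  qed
  have "with_adj n x i \<in> M" "with_adj n y i \<in> N" if "i < 2 * n" for i
    using that assms(5,6) by (auto simp: with_adj_def A.M_adj B.M_adj)
  then show "\<tau> (nc_eval P (with_adj n x)) = \<tau>' (nc_eval P (with_adj n y))"
    using P word by (simp add: A.\<tau>_nc_eval[OF _ P] B.\<tau>_nc_eval[OF _ P] ncpolys_def)
qed

end
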